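(* Let $\Lambda$ be a block with $|\Lambda|<\infty$. Then the generalised Khovanov algebra $H_\Lambda$ is a cellular algebra in the sense of Graham and Lehrer with cell datum $(\Lambda,M,C,* )$, where $\Lambda$ is partially ordered by the Bruhat order, $M(\lambda)=\{\alpha\in\Lambda^\circ\mid\alpha\subset\lambda\}$, $C^\lambda_{\alpha,\beta}=(\underline\alpha\lambda\overline\beta)$ for $\alpha,\beta\in M(\lambda)$, and $*$ is the linear map $(a\lambda b)\mapsto(b^*\lambda a^* )$ on $H_\Lambda$.
   Context: A number line carries vertices indexed by consecutive integers. A weight labels each vertex by $\circ,\times,\vee,\wedge$ with, outside a finite set of vertices, no $\vee$ to the left of an $\wedge$. Bruhat order: generated by declaring that interchanging a $\vee$ with an $\wedge$ to its right makes a weight bigger. Blocks: classes of weights related by permuting $\vee$'s and $\wedge$'s. Cup diagrams: finitely many non-crossing cups joining pairs of vertices plus rays down to infinity; cap diagrams similarly upward; $c^*$ = mirror image. $c\lambda$ is an oriented cup diagram if free vertices are $\circ/\times$, each cup has one $\vee$ and one $\wedge$ end, ray vertices are $\vee/\wedge$, and no two rays are labelled $\vee,\wedge$ in that order left to right; $\lambda c$ for a cap diagram is oriented if $c^*\lambda$ is. Clockwise cup/cap: left end labelled $\wedge$; degree = number of clockwise cups/caps. Oriented circle diagram $a\lambda b$: $a\lambda,\lambda b$ oriented. $\underline\lambda$: the unique cup diagram with $\underline\lambda\lambda$ oriented of degree $0$; $\overline\lambda=(\underline\lambda)^*$; $\mu\subset\lambda$: $\mu\sim\lambda$ and $\underline\mu\lambda$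 oriented. $\mathrm{def}(\lambda)$ = number of cups in $\underline\lambda$, $\mathrm{def}(\Lambda)=\sup_\Lambda\mathrm{def}$. $K_\Lambda$ is the graded algebra with basis $(a\lambda b)$ over oriented circle diagrams with $\lambda\in\Lambda$, multiplication defined via closure: add $p$ vertices labelled $\vee$ on the left and $q$ labelled $\wedge$ on the right ($p$, $q$ the numbers of $\wedge$'s and $\vee$'s in weights of $\Lambda$), with $\mathrm{cl}(\underline\alpha)=\underline{\mathrm{cl}\alpha}$, $\mathrm{cl}(\overline\beta)=\overline{\mathrm{cl}\beta}$, and $K_\Lambda\cong H_\Delta/I_\Lambda$, $(a\lambda b)\mapsto\mathrm{cl}(a\lambda b)+I_\Lambda$, where $H_\Delta$ is Khovanov's diagram algebra of the block $\Delta\supset\mathrm{cl}(\Lambda)$ (basis: closed oriented circle diagrams; product by iterated surgery with rules $1\otimes1\mapsto1$, $1\otimes x\mapsto x$, $x\otimes1\mapsto x$, $x\otimes x\mapsto0$, $1\mapsto1\otimes x+x\otimes1$, $x\mapsto x\otimes x$, product zero unless the middle diagrams are mirror images) and $I_\Lambda$ is spanned by basis vectors with weight outside $\mathrm{cl}(\Lambda)$. $e_\lambda=(\underline\lambda\lambda\overline\lambda)$. $\Lambda^\circ=\{\lambda\in\Lambda\mid\mathrm{def}(\lambda)=\mathrm{def}(\Lambda)\}$, and the generalised Khovanov algebra is $H_\Lambda=\bigoplus_{\alpha,\beta\in\Lambda^\circ}e_\alpha K_\Lambda e_\beta=eK_\Lambda e$ with $e=\sum_{\lambda\in\Lambda^\circ}e_\lambda$;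 it has basis $(\underline\alpha\lambda\overline\beta)$ for $\alpha,\beta\in\Lambda^\circ$, $\lambda\in\Lambda$, $\alpha\subset\lambda\supset\beta$. Cellular algebra (Graham–Lehrer): unital algebra with $(\Lambda,M,C,* )$: poset $\Lambda$, finite sets $M(\lambda)$, $C$ injective onto a basis, $*$ anti-automorphism with $(C^\lambda_{\alpha\beta})^*=C^\lambda_{\beta\alpha}$, and $xC^\mu_{\gamma\delta}\equiv\sum_{\gamma'}r_x(\gamma',\gamma)C^\mu_{\gamma'\delta}$ modulo the span of $C^\nu_{**}$ for $\nu>\mu$, with $r_x$ independent of $\delta$. *)

theory Defs
  imports Main "HOL-Library.Product_Lexorder"
begin

text \<open>Labels: Circ = \<circ>, Cross = \<times>, Dn = \<or> (vee), Up = \<and> (wedge).\<close>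
datatype lab = Circ | Cross | Dn | Up

type_synonym weight = "int \<Rightarrow> lab"

definition is_weight :: "weight \<Rightarrow> bool" where
  "is_weight la \<longleftrightarrow> (\<exists>F. finite F \<and>
     (\<forall>i j. i < j \<and> i \<notin> F \<and> j \<notin> F \<longrightarrow> \<not> (la i = Dn \<and> la j = Up)))"

definition same_block :: "weight \<Rightarrow> weight \<Rightarrow> bool" where
  "same_block la mu \<longleftrightarrow> (\<exists>\<sigma>::int \<Rightarrow> int. bij \<sigma> \<and> finite {i. \<sigma> i \<noteq> i} \<and>
      (\<forall>i. la i \<in> {Circ, Cross} \<longrightarrow> \<sigma> i = i) \<and> mu = la \<circ> \<sigma>)"

definition is_block :: "weight set \<Rightarrow> bool" where
  "is_block L \<longleftrightarrow> (\<exists>la. is_weight la \<and> L = {mu. is_weight mu \<and> same_block la mu})"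

definition bruhat_step :: "weight \<Rightarrow> weight \<Rightarrow> bool" where
  "bruhat_step la mu \<longleftrightarrow> (\<exists>i j. i < j \<and> la i = Dn \<and> la j = Up \<and> mu = la(i := Up, j := Dn))"

definition bruhat_le :: "weight \<Rightarrow> weight \<Rightarrow> bool" where
  "bruhat_le = bruhat_step\<^sup>*\<^sup>*"

record cupd =
  cups :: "(int \<times> int) set"
  rays :: "int set"

text \<open>A cap diagram is recorded as the mirror image of a cup diagram.\<close>
datatype capd = Cap cupd

definition cap_star :: "capd \<Rightarrow> cupd" where
  "cap_star b = (case b of Cap c \<Rightarrow> c)"

definition cup_star :: "cupd \<Rightarrow> capd" where
  "cup_star c = Cap c"

definition valid_cupd :: "cupd \<Rightarrow> bool" where
  "valid_cupd c \<longleftrightarrow> finite (cups c)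
    \<and> (\<forall>(i,j)\<in>cups c. i < j)
    \<and> (\<forall>(i,j)\<in>cups c. \<forall>(k,l)\<in>cups c. (i,j) \<noteq> (k,l) \<longrightarrow> {i,j} \<inter> {k,l} = {})
    \<and> (\<forall>(i,j)\<in>cups c. i \<notin> rays c \<and> j \<notin> rays c)
    \<and> (\<forall>(i,j)\<in>cups c. \<forall>(k,l)\<in>cups c. \<not> (i < k \<and> k < j \<and> j < l))
    \<and> (\<forall>(i,j)\<in>cups c. \<forall>k\<in>rays c. \<not> (i < k \<and> k < j))"

definition free :: "cupd \<Rightarrow> int \<Rightarrow> bool" where
  "free c k \<longleftrightarrow> k \<notin> rays c \<and> (\<forall>(i,j)\<in>cups c. k \<noteq> i \<and> k \<noteq> j)"

definition oriented :: "cupd \<Rightarrow> weight \<Rightarrow> bool" where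
  "oriented c la \<longleftrightarrow> valid_cupd c
    \<and> (\<forall>k. free c k \<longrightarrow> la k \<in> {Circ, Cross})
    \<and> (\<forall>(i,j)\<in>cups c. {la i, la j} = {Dn, Up})
    \<and> (\<forall>k\<in>rays c. la k \<in> {Dn, Up})
    \<and> (\<forall>k\<in>rays c. \<forall>l\<in>rays c. k < l \<longrightarrow> \<not> (la k = Dn \<and> la l = Up))"

definition oriented_cap :: "weight \<Rightarrow> capd \<Rightarrow> bool" where
  "oriented_cap la b \<longleftrightarrow> oriented (cap_star b) la"

definition degree :: "cupd \<Rightarrow> weight \<Rightarrow> nat" where
  "degree c la = card {(i,j)\<in>cups c. la i = Up}"

definition underline :: "weight \<Rightarrow> cupd" where
  "underline la = (THE c. oriented c la \<and> degree c la = 0)"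

definition overline :: "weight \<Rightarrow> capd" where
  "overline la = cup_star (underline la)"

definition subw :: "weight \<Rightarrow> weight \<Rightarrow> bool" where
  "subw mu la \<longleftrightarrow> same_block mu la \<and> oriented (underline mu) la"

definition defect :: "weight \<Rightarrow> nat" where
  "defect la = card (cups (underline la))"

definition defectB :: "weight set \<Rightarrow> nat" where
  "defectB L = Sup (defect ` L)"

definition circB :: "weight set \<Rightarrow> weight set" where
  "circB L = {la \<in> L. defect la = defectB L}"

definition vaS :: "weight set \<Rightarrow> int set" where
  "vaS L = {i. \<exists>la\<in>L. la i \<in> {Dn, Up}}"

definition pB :: "weight set \<Rightarrow> nat" where
  "pB L = card {i \<in> vaS L. (SOME la. la \<in> L) i = Up}"

definition qB :: "weight set \<Rightarrow> nat" where
  "qB L = card {i \<in> vaS L. (SOME la. la \<in> L) i = Dn}"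

text \<open>Closure of a weight: p new \<or>'s on the left, q new \<and>'s on the right; the vertices
  labelled \<or>/\<and> are re-indexed consecutively (the \<circ>/\<times> vertices play no role).\<close>
definition clw :: "weight set \<Rightarrow> weight \<Rightarrow> weight" where
  "clw L la k = (let p = int (pB L); n = int (card (vaS L)); q = int (qB L) in
     if 0 \<le> k \<and> k < p then Dn
     else if p \<le> k \<and> k < p + n then la (sorted_list_of_set (vaS L) ! nat (k - p))
     else if p + n \<le> k \<and> k < p + n + q then Up
     else Circ)"

type_synonym vert = "bool \<times> int"  (* False: first factor, True: second factor *)
type_synonym state = "vert \<Rightarrow> bool"  (* True = x, False = 1 *)

text \<open>Stack (a la c^*) under (c mu d); the surgeries in D have been performed.\<close>
definition srel :: "cupd \<Rightarrow> cupd \<Rightarrow> cupd \<Rightarrow> (int \<times> int) set \<Rightarrow> (vert \<times> vert) set" where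
  "srel a c d D =
     {((False,i),(False,j)) | i j. (i,j) \<in> cups a}
   \<union> {((True,i),(True,j)) | i j. (i,j) \<in> cups d}
   \<union> {((False,i),(False,j)) | i j. (i,j) \<in> cups c - D}
   \<union> {((True,i),(True,j)) | i j. (i,j) \<in> cups c - D}
   \<union> {((False,i),(True,i)) | i j. (i,j) \<in> D}
   \<union> {((False,j),(True,j)) | i j. (i,j) \<in> D}"

definition sconn :: "cupd \<Rightarrow> cupd \<Rightarrow> cupd \<Rightarrow> (int \<times> int) set \<Rightarrow> (vert \<times> vert) set" where
  "sconn a c d D = (srel a c d D \<union> (srel a c d D)\<inverse>)\<^sup>*"

definition scomp :: "cupd \<Rightarrow> cupd \<Rightarrow> cupd \<Rightarrow> (int \<times> int) set \<Rightarrow> vert \<Rightarrow> vert set" where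
  "scomp a c d D v = {w. (v, w) \<in> sconn a c d D}"

text \<open>One surgery at the cup (i,j) of c (and its mirror cap), with the TQFT rules
  1*1->1, 1*x->x, x*1->x, x*x->0 (merge), 1->1*x+x*1, x->x*x (split).\<close>
definition sstep :: "cupd \<Rightarrow> cupd \<Rightarrow> cupd \<Rightarrow> (int \<times> int) set \<Rightarrow> int \<times> int \<Rightarrow> state
                      \<Rightarrow> (int \<times> state) list" where
  "sstep a c d D pr s = (case pr of (i,j) \<Rightarrow>
     (let u = (False,i); w = (True,i); D' = insert (i,j) D;
          C1 = scomp a c d D' (False,i); C2 = scomp a c d D' (False,j) in
      if (u, w) \<notin> sconn a c d D then
        (if s u \<and> s w then [] else [(1, \<lambda>v. if v \<in> C1 then s u \<or> s w else s v)])
      else if s u then [(1, \<lambda>v. if v \<in> C1 \<union> C2 then True else s v)]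
      else [(1, \<lambda>v. if v \<in> C1 then False else if v \<in> C2 then True else s v),
            (1, \<lambda>v. if v \<in> C1 then True else if v \<in> C2 then False else s v)]))"

fun surg :: "cupd \<Rightarrow> cupd \<Rightarrow> cupd \<Rightarrow> (int \<times> int) set \<Rightarrow> (int \<times> int) list
              \<Rightarrow> (int \<times> state) list \<Rightarrow> (int \<times> state) list" where
  "surg a c d D [] L = L"
| "surg a c d D (pr # prs) L =
     surg a c d (insert pr D) prs
       (concat (map (\<lambda>(k,s). map (\<lambda>(k',s'). (k * k', s')) (sstep a c d D pr s)) L))"

text \<open>Initial state: a circle is anticlockwise (label 1) iff its leftmost vertex is \<or>.\<close>
definition st0 :: "cupd \<Rightarrow> cupd \<Rightarrow> cupd \<Rightarrow> weight \<Rightarrow> weight \<Rightarrow> state" where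
  "st0 a c d la mu v = ((if fst v then mu else la) (Min (snd ` scomp a c d {} v)) = Up)"

definition nu :: "cupd \<Rightarrow> cupd \<Rightarrow> cupd \<Rightarrow> weight \<Rightarrow> state \<Rightarrow> weight" where
  "nu a c d la s = (THE n. oriented a n \<and> oriented d n \<and> (\<forall>k. free a k \<longrightarrow> n k = la k)
     \<and> (\<forall>k. \<not> free a k \<longrightarrow>
            (n (Min (snd ` scomp a c d (cups c) (False,k))) = Up \<longleftrightarrow> s (False,k))))"

type_synonym cdiag = "cupd \<times> weight \<times> capd"

definition hprod :: "cdiag \<Rightarrow> cdiag \<Rightarrow> (int \<times> cdiag) list" where
  "hprod x y = (case x of (a, la, b) \<Rightarrow> case y of (c, mu, Cap d) \<Rightarrow>
     if cap_star b \<noteq> c then []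
     else map (\<lambda>(k,s). (k, (a, nu a c d la s, Cap d)))
            (surg a c d {} (sorted_list_of_set (cups c)) [(1, st0 a c d la mu)]))"

text \<open>Basis vectors (underline alpha, lambda, overline beta) are indexed by (alpha, lambda, beta).\<close>
definition HB :: "weight set \<Rightarrow> (weight \<times> weight \<times> weight) set" where
  "HB L = {(al, la, be). al \<in> circB L \<and> be \<in> circB L \<and> la \<in> L \<and> subw al la \<and> subw be la}"

definition hdiag :: "weight \<times> weight \<times> weight \<Rightarrow> cdiag" where
  "hdiag t = (case t of (al, la, be) \<Rightarrow> (underline al, la, overline be))"

text \<open>Closure of a basis diagram: cl(underline al) = underline (cl al), etc.\<close>
definition cl_diag :: "weight set \<Rightarrow> weight \<times> weight \<times> weight \<Rightarrow> cdiag" where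
  "cl_diag L t = (case t of (al, la, be) \<Rightarrow>
      (underline (clw L al), clw L la, overline (clw L be)))"

text \<open>Structure constant: coefficient of cl(z) in cl(x) cl(y) (modulo I_Lambda).\<close>
definition hcoeff :: "weight set \<Rightarrow> weight \<times> weight \<times> weight \<Rightarrow> weight \<times> weight \<times> weight
                       \<Rightarrow> weight \<times> weight \<times> weight \<Rightarrow> int" where
  "hcoeff L x y z = sum_list (map (\<lambda>(k, D). if D = cl_diag L z then k else 0)
                                 (hprod (cl_diag L x) (cl_diag L y)))"

definition Hspace :: "weight set \<Rightarrow> (weight \<times> weight \<times> weight \<Rightarrow> 'k::comm_ring_1) set" where
  "Hspace L = {f. \<forall>z. z \<notin> HB L \<longrightarrow> f z = 0}"

definition hmult :: "weight set \<Rightarrow> (weight \<times> weight \<times> weight \<Rightarrow> 'k::comm_ring_1)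
                     \<Rightarrow> (weight \<times> weight \<times> weight \<Rightarrow> 'k) \<Rightarrow> (weight \<times> weight \<times> weight \<Rightarrow> 'k)" where
  "hmult L f g = (\<lambda>z. if z \<in> HB L then
      (\<Sum>x\<in>HB L. \<Sum>y\<in>HB L. f x * g y * of_int (hcoeff L x y z)) else 0)"

definition hstar :: "(weight \<times> weight \<times> weight \<Rightarrow> 'k) \<Rightarrow> (weight \<times> weight \<times> weight \<Rightarrow> 'k)" where
  "hstar f = (\<lambda>(al, la, be). f (be, la, al))"

definition Mset :: "weight set \<Rightarrow> weight \<Rightarrow> weight set" where
  "Mset L la = {al \<in> circB L. subw al la}"

definition Cbasis :: "weight \<Rightarrow> weight \<Rightarrow> weight \<Rightarrow> (weight \<times> weight \<times> weight \<Rightarrow> 'k::comm_ring_1)" where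
  "Cbasis la al be = (\<lambda>z. if z = (al, la, be) then 1 else 0)"

definition lspan :: "('i \<Rightarrow> 'k::comm_ring_1) set \<Rightarrow> ('i \<Rightarrow> 'k) set" where
  "lspan S = {v. \<exists>F c. finite F \<and> F \<subseteq> S \<and> v = (\<lambda>i. \<Sum>w\<in>F. c w * w i)}"

definition is_algebra :: "('i \<Rightarrow> 'k::comm_ring_1) set
     \<Rightarrow> (('i \<Rightarrow> 'k) \<Rightarrow> ('i \<Rightarrow> 'k) \<Rightarrow> ('i \<Rightarrow> 'k)) \<Rightarrow> bool" where
  "is_algebra V mult \<longleftrightarrow>
     (\<lambda>i. 0) \<in> V
   \<and> (\<forall>x\<in>V. \<forall>y\<in>V. (\<lambda>i. x i + y i) \<in> V)
   \<and> (\<forall>r. \<forall>x\<in>V. (\<lambda>i. r * x i) \<in> V)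
   \<and> (\<forall>x\<in>V. \<forall>y\<in>V. mult x y \<in> V)
   \<and> (\<forall>x\<in>V. \<forall>y\<in>V. \<forall>z\<in>V. mult (\<lambda>i. x i + y i) z = (\<lambda>i. mult x z i + mult y z i))
   \<and> (\<forall>x\<in>V. \<forall>y\<in>V. \<forall>z\<in>V. mult z (\<lambda>i. x i + y i) = (\<lambda>i. mult z x i + mult z y i))
   \<and> (\<forall>r. \<forall>x\<in>V. \<forall>y\<in>V. mult (\<lambda>i. r * x i) y = (\<lambda>i. r * mult x y i)
                        \<and> mult x (\<lambda>i. r * y i) = (\<lambda>i. r * mult x y i))
   \<and> (\<forall>x\<in>V. \<forall>y\<in>V. \<forall>z\<in>V. mult (mult x y) z = mult x (mult y z))
   \<and> (\<exists>u\<in>V. \<forall>x\<in>V. mult u x = x \<and> mult x u = x)"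

definition cellular_algebra :: "('i \<Rightarrow> 'k::comm_ring_1) set
     \<Rightarrow> (('i \<Rightarrow> 'k) \<Rightarrow> ('i \<Rightarrow> 'k) \<Rightarrow> ('i \<Rightarrow> 'k))
     \<Rightarrow> 'l set \<Rightarrow> ('l \<Rightarrow> 'l \<Rightarrow> bool) \<Rightarrow> ('l \<Rightarrow> 'm set)
     \<Rightarrow> ('l \<Rightarrow> 'm \<Rightarrow> 'm \<Rightarrow> ('i \<Rightarrow> 'k)) \<Rightarrow> (('i \<Rightarrow> 'k) \<Rightarrow> ('i \<Rightarrow> 'k)) \<Rightarrow> bool" where
  "cellular_algebra V mult P le M C star \<longleftrightarrow>
     is_algebra V mult
   \<comment> \<open>P is partially ordered by le\<close>
   \<and> (\<forall>x\<in>P. le x x)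
   \<and> (\<forall>x\<in>P. \<forall>y\<in>P. le x y \<and> le y x \<longrightarrow> x = y)
   \<and> (\<forall>x\<in>P. \<forall>y\<in>P. \<forall>z\<in>P. le x y \<and> le y z \<longrightarrow> le x z)
   \<comment> \<open>finite sets M(lambda)\<close>
   \<and> (\<forall>la\<in>P. finite (M la))
   \<comment> \<open>C is injective onto a basis\<close>
   \<and> inj_on (\<lambda>(la, s, t). C la s t) (SIGMA la:P. M la \<times> M la)
   \<and> (\<forall>la\<in>P. \<forall>s\<in>M la. \<forall>t\<in>M la. C la s t \<in> V)
   \<and> V \<subseteq> lspan {C la s t | la s t. la \<in> P \<and> s \<in> M la \<and> t \<in> M la}
   \<and> (\<forall>F c. finite F \<and> F \<subseteq> (SIGMA la:P. M la \<times> M la)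
          \<and> (\<lambda>i. \<Sum>(la, s, t)\<in>F. c (la, s, t) * C la s t i) = (\<lambda>i. 0)
          \<longrightarrow> (\<forall>q\<in>F. c q = 0))
   \<comment> \<open>star is a linear anti-automorphism\<close>
   \<and> bij_betw star V V
   \<and> (\<forall>x\<in>V. \<forall>y\<in>V. star (\<lambda>i. x i + y i) = (\<lambda>i. star x i + star y i))
   \<and> (\<forall>r. \<forall>x\<in>V. star (\<lambda>i. r * x i) = (\<lambda>i. r * star x i))
   \<and> (\<forall>x\<in>V. \<forall>y\<in>V. star (mult x y) = mult (star y) (star x))
   \<and> (\<forall>la\<in>P. \<forall>s\<in>M la. \<forall>t\<in>M la. star (C la s t) = C la t s)
   \<comment> \<open>the multiplication rule modulo higher cells\<close>
   \<and> (\<forall>x\<in>V. \<forall>mu\<in>P. \<forall>g\<in>M mu. \<exists>r :: 'm \<Rightarrow> 'k. \<forall>dl\<in>M mu.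
        (\<lambda>i. mult x (C mu g dl) i - (\<Sum>g'\<in>M mu. r g' * C mu g' dl i))
          \<in> lspan {C nu s t | nu s t. nu \<in> P \<and> le mu nu \<and> nu \<noteq> mu \<and> s \<in> M nu \<and> t \<in> M nu})"

end

theory Submission
  imports Defs
begin

text \<open>
  Deform Khovanov's Frobenius algebra \<open>\<int>[x]/(x\<^sup>2)\<close> to \<open>x\<^sup>2 = t x\<close> for an arbitrary nonzero integer \<open>t\<close>.
  An element attached to a circle diagram \<open>a b\<^sup>*\<close> is then determined by its values at the
  orientations \<open>\<kappa>\<close> of \<open>a b\<^sup>*\<close> (assigning to every circle the value \<open>0\<close> or \<open>t\<close>), and the product of
  \<open>f\<close> on \<open>a c\<^sup>*\<close> and \<open>g\<close> on \<open>c d\<^sup>*\<close> becomes the function \<open>f(\<kappa>) g(\<kappa>) E(\<kappa>)\<close>, supported on the \<open>\<kappa>\<close> that also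
  orient \<open>c\<close>, where \<open>E(\<kappa>)\<close> is a power of \<open>\<plusminus>t\<close> whose exponent counts circles. Reducing modulo every \<open>t\<close>
  gives back the structure constants. Associativity, unit and the anti-involution become identities
  between circle counts. The basis vector \<open>(a \<nu> b)\<close> is supported on the orientations obtained from \<open>\<nu>\<close> by
  turning anticlockwise circles clockwise, that is, on weights above \<open>\<nu>\<close>; so products only involve
  larger weights, which makes \<open>I\<^sub>\<Lambda>\<close> an ideal and gives the cell filtration. The coefficient
  of \<open>(a \<mu> d)\<close> in \<open>(a \<lambda> b)(b \<mu> d)\<close> is read off at \<open>\<kappa> = \<mu>\<close>, and its independence of \<open>d\<close> follows from the fact that a circle
  made of \<open>2k\<close> cups and caps has \<open>k \<plusminus> 1\<close> clockwise ones.
\<close>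

section \<open>Components of a pair of involutions\<close>

text \<open>With x^2 = 0 the labels are nilpotent and cannot be told apart by evaluation, and each
  product is a composite of surgeries in a fixed order. For t \<noteq> 0 evaluation at the two roots
  0 and t is injective, which makes the product pointwise and the order of surgeries invisible.
  Integers t are enough in place of an indeterminate, because an integer divisible by every nonzero
  t is 0. A point must assign one value to a circle of every diagram that it orients. Labels
  alternate along arcs, so this value is the label twisted by the parity of the vertex. As a
  consequence anticlockwise means x = 0 on some circles and x = t on others, according to the parity
  of the leftmost vertex. Basis vectors therefore use x on circles of the first kind and x - t on
  those of the second: modulo t nothing changes, and the support of a basis vector is now described
  by clockwise circles alone. A split contributes t where its two circles have the value t and - t
  where they have the value 0. This is the origin of the sign in E, and the reason why every count
  is kept separately for the two values.\<close>

definition conn :: "'a set \<Rightarrow> ('a \<Rightarrow> 'a) \<Rightarrow> ('a \<Rightarrow> 'a) \<Rightarrow> ('a \<times> 'a) set" where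
  "conn W f g = ({(x, f x) | x. x \<in> W} \<union> {(x, g x) | x. x \<in> W})\<^sup>*"

definition orb :: "'a set \<Rightarrow> ('a \<Rightarrow> 'a) \<Rightarrow> ('a \<Rightarrow> 'a) \<Rightarrow> 'a \<Rightarrow> 'a set" where
  "orb W f g v = {w. (v, w) \<in> conn W f g}"

definition norb :: "'a set \<Rightarrow> ('a \<Rightarrow> 'a) \<Rightarrow> ('a \<Rightarrow> 'a) \<Rightarrow> 'a set \<Rightarrow> nat" where
  "norb W f g A = card (orb W f g ` A)"

lemma conn_commute: "conn W f g = conn W g f"
  unfolding conn_def by (simp add: Un_commute)

lemma orb_commute: "orb W f g = orb W g f"
  unfolding orb_def by (simp add: conn_commute[of W f g])

lemma orb_self [simp]: "v \<in> orb W f g v"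
  unfolding orb_def conn_def by simp

lemma conn_f: "x \<in> W \<Longrightarrow> (x, f x) \<in> conn W f g"
  unfolding conn_def by (rule r_into_rtrancl) auto

lemma conn_g: "x \<in> W \<Longrightarrow> (x, g x) \<in> conn W f g"
  unfolding conn_def by (rule r_into_rtrancl) auto

lemma conn_trans: "(x, y) \<in> conn W f g \<Longrightarrow> (y, z) \<in> conn W f g \<Longrightarrow> (x, z) \<in> conn W f g"
  unfolding conn_def by (rule rtrancl_trans)

lemma orb_least:
  assumes "v \<in> A" and "\<And>x. x \<in> A \<Longrightarrow> x \<in> W \<Longrightarrow> f x \<in> A \<and> g x \<in> A"
  shows "orb W f g v \<subseteq> A"
proof
  fix w assume "w \<in> orb W f g v"
  then have "(v, w) \<in> conn W f g" unfolding orb_def by simp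
  then show "w \<in> A" unfolding conn_def
    by (induction rule: rtrancl_induct) (use assms in auto)
qed

lemma orb_outside: "v \<notin> W \<Longrightarrow> orb W f g v = {v}"
  using orb_least[of v "{v}" W f g] orb_self[of v W f g] by blast

definition invol_on :: "'a set \<Rightarrow> ('a \<Rightarrow> 'a) \<Rightarrow> bool" where
  "invol_on W f \<longleftrightarrow> (\<forall>x\<in>W. f x \<in> W \<and> f (f x) = x)"

lemma invol_onD: "invol_on W f \<Longrightarrow> x \<in> W \<Longrightarrow> f x \<in> W" "invol_on W f \<Longrightarrow> x \<in> W \<Longrightarrow> f (f x) = x"
  unfolding invol_on_def by auto

lemma conn_sym:
  assumes "invol_on W f" "invol_on W g" "(x, y) \<in> conn W f g"
  shows "(y, x) \<in> conn W f g"
proof -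
  let ?R = "{(x, f x) | x. x \<in> W} \<union> {(x, g x) | x. x \<in> W}"
  have "sym ?R" unfolding sym_def using assms(1,2) unfolding invol_on_def by fastforce
  then have "sym (?R\<^sup>*)" by (rule sym_rtrancl)
  then show ?thesis using assms(3) unfolding conn_def by (meson symD)
qed

lemma orb_eq:
  assumes "invol_on W f" "invol_on W g" "w \<in> orb W f g v"
  shows "orb W f g w = orb W f g v"
proof -
  have vw: "(v, w) \<in> conn W f g" using assms(3) unfolding orb_def by simp
  have wv: "(w, v) \<in> conn W f g" by (rule conn_sym[OF assms(1,2) vw])
  show ?thesis unfolding orb_def using conn_trans[OF vw] conn_trans[OF wv] by auto
qed

lemma orb_closed:
  assumes "invol_on W f" "invol_on W g" "v \<in> W" "x \<in> orb W f g v"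
  shows "x \<in> W" "f x \<in> orb W f g v" "g x \<in> orb W f g v"
proof -
  show W: "x \<in> W" using orb_least[of v W W f g] assms by (auto simp: invol_on_def)
  show "f x \<in> orb W f g v" "g x \<in> orb W f g v"
    using assms(4) conn_trans[OF _ conn_f[OF W]] conn_trans[OF _ conn_g[OF W]] unfolding orb_def by auto
qed

lemma orb_step:
  assumes "invol_on W f" "invol_on W g" "v \<in> W"
  shows "orb W f g (f v) = orb W f g v" "orb W f g (g v) = orb W f g v"
  using orb_eq[OF assms(1,2)] orb_closed[OF assms(1,2,3) orb_self] by blast+

lemma orb_subset_closed:
  assumes "v \<in> A" "\<And>x. x \<in> A \<Longrightarrow> f x \<in> A" "\<And>x. x \<in> A \<Longrightarrow> g x \<in> A"
  shows "orb W f g v \<subseteq> A"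
  using assms by (intro orb_least) auto

text \<open>A surgery replaces the edges \<open>p - g p\<close>, \<open>r - g r\<close> by \<open>p - g r\<close>, \<open>r - g p\<close>. The two-colouring
  is what makes every surgery either merge two components or split one.\<close>

locale surgery =
  fixes W :: "'a set" and f g :: "'a \<Rightarrow> 'a" and col :: "'a \<Rightarrow> bool" and p q r s :: 'a
  assumes fin: "finite W"
    and invf: "invol_on W f" and invg: "invol_on W g"
    and colf: "\<And>x. x \<in> W \<Longrightarrow> col (f x) \<longleftrightarrow> \<not> col x"
    and colg: "\<And>x. x \<in> W \<Longrightarrow> col (g x) \<longleftrightarrow> \<not> col x"
    and pW: "p \<in> W" and rW: "r \<in> W" and pr: "p \<noteq> r" and colpr: "col p = col r"
    and q: "g p = q" and s: "g r = s"
begin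

definition g' :: "'a \<Rightarrow> 'a" where "g' = g(p := s, s := p, r := q, q := r)"

lemma dist: "p \<noteq> q" "p \<noteq> s" "r \<noteq> q" "r \<noteq> s" "q \<noteq> s" "q \<in> W" "s \<in> W" "g q = p" "g s = r"
  "col q = (\<not> col p)" "col s = (\<not> col p)"
  using colg[OF pW] colg[OF rW] colpr pr invg pW rW q s unfolding invol_on_def by metis+

lemma g'_simps [simp]: "g' p = s" "g' s = p" "g' r = q" "g' q = r"
  using dist pr unfolding g'_def by auto

lemma g'_other: "x \<notin> {p, q, r, s} \<Longrightarrow> g' x = g x"
  unfolding g'_def by auto

lemma invg': "invol_on W g'"
  unfolding invol_on_def
proof
  fix x assume x: "x \<in> W"
  show "g' x \<in> W \<and> g' (g' x) = x"
  proof (cases "x \<in> {p, q, r, s}")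
    case True then show ?thesis using pW rW by (auto simp: dist)
  next
    case False
    then have "g x \<notin> {p, q, r, s}" using q s dist x invg unfolding invol_on_def
      by (metis insert_iff singletonD)
    then show ?thesis using False g'_other x invg unfolding invol_on_def by auto
  qed
qed

lemma colg': "x \<in> W \<Longrightarrow> col (g' x) \<longleftrightarrow> \<not> col x"
  using g'_other[of x] colg[of x] by (cases "x \<in> {p,q,r,s}") (auto simp: dist colpr)

text \<open>Surgery is undone by the surgery with q and s interchanged. Through this symmetry every
  statement on splits follows from the one on merges.\<close>

lemma swap: "surgery W f g' col p s r q"
  using fin invf invg' colf colg' pW rW pr colpr dist
  by unfold_locales auto

lemma swap_g': "surgery.g' g' p s r q = g"
proof -
  interpret S: surgery W f g' col p s r q by (rule swap)
  show ?thesis unfolding S.g'_def unfolding g'_def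
    using q s dist pr by (auto simp: fun_eq_iff)
qed

text \<open>Cut the \<open>g\<close>-edges at p and at r. The path leaving p through
  \<open>f\<close> then ends at q or at s and never meets r, because vertices of the colour of p are
  entered only through a \<open>g\<close>-edge. If it ends at q, it closes up under
  \<open>g\<close>, and under \<open>g'\<close> the edge from q leads on to r. If it ends at s, the
  two roles are exchanged.\<close>

lemma dichotomy: "(p, r) \<in> conn W f g \<longleftrightarrow> (p, r) \<notin> conn W f g'"
proof -
  \<comment> \<open>Every second vertex of the path, all of the colour of p; the vertices
    \<open>f (x k)\<close> in between have the other colour.\<close>
  define x where "x k = ((g \<circ> f) ^^ k) p" for k :: nat
  have xW: "x k \<in> W" for k unfolding x_def by (induction k) (use pW invf invg in \<open>auto simp: invol_on_def\<close>)
  have fxW: "f (x k) \<in> W" for k using xW invf by (auto simp: invol_on_def)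
  have xS: "x (Suc k) = g (f (x k))" for k unfolding x_def by simp
  have x0: "x 0 = p" unfolding x_def by simp
  have colx: "col (x k) = col p" for k
    by (induction k) (use x0 xS xW fxW colf colg in auto)
  have colfx: "col (f (x k)) = (\<not> col p)" for k using colx colf xW by auto
  have inj: "inj_on (g \<circ> f) W" using invf invg unfolding inj_on_def invol_on_def by (metis comp_apply)
  \<comment> \<open>By finiteness and injectivity of \<open>g \<circ> f\<close> the sequence returns
    to p, and the vertex just before that is q.\<close>
  have "\<exists>k. f (x k) \<in> {q, s}"
  proof -
    have "\<not> inj x" using finite_imageD[of x UNIV] xW fin
      by (metis finite_subset image_subsetI infinite_UNIV_nat)
    then obtain i j where ij: "i < j" "x i = x j" unfolding inj_def by (metis linorder_neqE_nat)
    have "x 0 = x (j - i)" using ij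
    proof (induction i arbitrary: j)
      case (Suc i)
      obtain j' where j': "j = Suc j'" using Suc.prems by (cases j) auto
      have "x i = x j'" using Suc.prems(2) inj xW unfolding j' inj_on_def x_def by auto
      then show ?case using Suc.IH[of j'] Suc.prems(1) j' by auto
    qed simp
    moreover obtain m where "j - i = Suc m" using ij by (metis Suc_diff_Suc)
    ultimately have "g (f (x m)) = p" using x0 xS by metis
    then have "f (x m) = q" using q fxW[of m] invg unfolding invol_on_def by metis
    then show ?thesis by blast
  qed
  then obtain T where T: "f (x T) \<in> {q, s}" and Tmin: "\<And>k. k < T \<Longrightarrow> f (x k) \<notin> {q, s}"
    by (meson exists_least_iff)
  define P where "P = x ` {..T} \<union> (f \<circ> x) ` {..T}"
  have PW: "P \<subseteq> W" unfolding P_def using xW fxW by auto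
  have pP: "p \<in> P" unfolding P_def using x0 by (metis UnI1 atMost_iff image_eqI le0)
  have eP: "f (x T) \<in> P" unfolding P_def by auto
  have rP: "r \<notin> P"
  proof
    assume "r \<in> P"
    then obtain k where k: "k \<le> T" "r = x k" unfolding P_def using colfx colpr by fastforce
    with pr x0 obtain m where m: "k = Suc m" by (cases k) auto
    then have "g (f (x m)) = r" using xS k by simp
    then have "f (x m) = s" using s fxW[of m] invg unfolding invol_on_def by metis
    then show False using Tmin[of m] m k by auto
  qed
  have only: "y = f (x T)" if "y \<in> P" "y \<in> {q, s}" for y
  proof -
    from that colx dist obtain k where k: "k \<le> T" "y = f (x k)" unfolding P_def by fastforce
    then have "\<not> k < T" using Tmin[of k] that(2) by blast
    then show ?thesis using k by simp
  qed
  have Pf: "f y \<in> P" if "y \<in> P" for y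
    using that invf xW unfolding P_def invol_on_def by auto
  have Pg: "g y \<in> P" if y: "y \<in> P" "y \<noteq> p" "y \<noteq> f (x T)" for y
  proof -
    from y(1) consider k where "k \<le> T" "y = x k" | k where "k \<le> T" "y = f (x k)" unfolding P_def by fastforce
    then show ?thesis
    proof cases
      case 1
      then obtain m where m: "k = Suc m" using y(2) x0 by (cases k) auto
      have "g y = f (x m)" using 1 m xS invg fxW unfolding invol_on_def by auto
      then show ?thesis unfolding P_def using m 1 by auto
    next
      case 2
      then have "k < T" using y(3) by (metis le_neq_implies_less)
      then show ?thesis unfolding P_def using 2 xS[of k]
        by (metis UnI1 atMost_iff image_eqI less_eq_Suc_le)
    qed
  qed
  \<comment> \<open>Up to time \<open>T\<close> the path uses no \<open>g\<close>-edge at p, q, r,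
    s, so it is a path for both \<open>g\<close> and \<open>g'\<close>.\<close>
  have link: "(p, x k) \<in> conn W f h \<and> (p, f (x k)) \<in> conn W f h"
    if k: "k \<le> T" and h: "\<And>v. v \<notin> {p, q, r, s} \<Longrightarrow> h v = g v" for h k
    using k
  proof (induction k)
    case 0
    have "(p, p) \<in> conn W f h" unfolding conn_def by simp
    then show ?case using x0 conn_f[OF pW, of f h] by simp
  next
    case (Suc k)
    then have IH: "(p, f (x k)) \<in> conn W f h" by simp
    have "f (x k) \<noteq> q \<and> f (x k) \<noteq> s" using Tmin[of k] Suc.prems by simp
    moreover have "f (x k) \<noteq> p" using colfx[of k] by auto
    moreover have "f (x k) \<noteq> r" using colfx[of k] colpr by auto
    ultimately have "h (f (x k)) = x (Suc k)" using h[of "f (x k)"] xS[of k] by simp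
    then have "(p, x (Suc k)) \<in> conn W f h"
      using conn_trans[OF IH conn_g[OF fxW[of k], of h f]] by simp
    then show ?case using conn_trans[OF _ conn_f[OF xW[of "Suc k"], of f h]] by simp
  qed
  show ?thesis
  proof (cases "f (x T) = q")
    case True
    have "g y \<in> P" if "y \<in> P" for y using Pg[OF that] True pP eP q dist by metis
    then have "orb W f g p \<subseteq> P" using Pf pP by (intro orb_subset_closed)
    then have "(p, r) \<notin> conn W f g" using rP unfolding orb_def by auto
    moreover have "(p, q) \<in> conn W f g'" using link[of T g'] g'_other True by auto
    then have "(p, r) \<in> conn W f g'" using conn_g[OF dist(6), of g' f] conn_trans g'_simps by metis
    ultimately show ?thesis by auto
  next
    case False
    then have T': "f (x T) = s" using T by auto
    have "q \<notin> P" using only[of q] False by auto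
    have "g' y \<in> P" if "y \<in> P" for y
    proof (cases "y \<in> {p, s}")
      case True
      have "s \<in> P" using eP T' by simp
      then show ?thesis using True pP by auto
    next
      case False
      then have "g' y = g y" using \<open>q \<notin> P\<close> rP that g'_other by (metis insertE singletonD insertI1 insertI2)
      then show ?thesis using Pg that False T' by auto
    qed
    then have "orb W f g' p \<subseteq> P" using Pf pP by (intro orb_subset_closed)
    then have "(p, r) \<notin> conn W f g'" using rP unfolding orb_def by auto
    moreover have "(p, s) \<in> conn W f g" using link[of T g] T' by auto
    then have "(p, r) \<in> conn W f g" using conn_g[OF dist(7), of g f] conn_trans dist(9) by metis
    ultimately show ?thesis by auto
  qed
qed

text \<open>Both maps permute {p, q, r, s} and agree elsewhere. This carries closed sets from one
  structure to the other.\<close>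

lemma closed_all_or_none:
  assumes "{p, q, r, s} \<subseteq> A \<or> {p, q, r, s} \<inter> A = {}"
  shows "(\<forall>x\<in>A. g x \<in> A) \<longleftrightarrow> (\<forall>x\<in>A. g' x \<in> A)"
proof -
  have "g x \<in> A \<longleftrightarrow> g' x \<in> A" if "x \<in> A" for x
    using assms that g'_other[of x] by (cases "x \<in> {p, q, r, s}") (auto simp: q s dist)
  then show ?thesis by blast
qed

text \<open>By \<open>dichotomy\<close> the surgery links p to r. Nothing else is added, since the
  union of the two old components contains all four points where \<open>g\<close> and
  \<open>g'\<close> differ.\<close>

lemma merge:
  assumes "(p, r) \<notin> conn W f g"
  shows "orb W f g' p = orb W f g p \<union> orb W f g r"
    and "\<And>v. v \<notin> orb W f g p \<union> orb W f g r \<Longrightarrow> orb W f g' v = orb W f g v"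
    and "orb W f g' r = orb W f g' p" and "orb W f g p \<inter> orb W f g r = {}"
proof -
  let ?O = "orb W f g" and ?O' = "orb W f g'"
  have c: "(p, r) \<in> conn W f g'" using dichotomy assms by auto
  then have rp: "r \<in> ?O' p" unfolding orb_def by simp
  then show orr: "?O' r = ?O' p" by (rule orb_eq[OF invf invg'])
  note cl' = orb_closed[OF invf invg' pW]
  have all': "{p, q, r, s} \<subseteq> ?O' p" using rp cl'(3)[of p] cl'(3)[of r] by auto
  have g'cl: "\<forall>x\<in>?O' p. g x \<in> ?O' p" using closed_all_or_none[of "?O' p"] all' cl' by blast
  have sub1: "?O p \<union> ?O r \<subseteq> ?O' p"
    using orb_subset_closed[of p "?O' p" f g W] orb_subset_closed[of r "?O' p" f g W] all' g'cl cl'(2) by auto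
  have clp: "x \<in> ?O p \<Longrightarrow> f x \<in> ?O p \<and> g x \<in> ?O p \<and> x \<in> W" for x using orb_closed[OF invf invg pW] by auto
  have clr: "x \<in> ?O r \<Longrightarrow> f x \<in> ?O r \<and> g x \<in> ?O r \<and> x \<in> W" for x using orb_closed[OF invf invg rW] by auto
  have all: "{p, q, r, s} \<subseteq> ?O p \<union> ?O r" using clp[of p] clr[of r] q s by auto
  then have "\<forall>x\<in>?O p \<union> ?O r. g' x \<in> ?O p \<union> ?O r"
    using closed_all_or_none[of "?O p \<union> ?O r"] clp clr by blast
  then have "?O' p \<subseteq> ?O p \<union> ?O r" using clp clr by (intro orb_subset_closed) auto
  then show eq: "?O' p = ?O p \<union> ?O r" using sub1 by auto
  show "?O p \<inter> ?O r = {}"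
  proof (rule ccontr)
    assume "?O p \<inter> ?O r \<noteq> {}"
    then have "?O p = ?O r" using orb_eq[OF invf invg] by blast
    then show False using assms unfolding orb_def by (metis mem_Collect_eq orb_def orb_self)
  qed
  fix v assume v: "v \<notin> ?O p \<union> ?O r"
  show "?O' v = ?O v"
  proof (cases "v \<in> W")
    case True
    have n: "{p, q, r, s} \<inter> ?O v = {}"
    proof (rule ccontr)
      assume "{p, q, r, s} \<inter> ?O v \<noteq> {}"
      then obtain y where y: "y \<in> {p, q, r, s}" "y \<in> ?O v" by auto
      then have "?O y = ?O v" using orb_eq[OF invf invg] by auto
      moreover have "?O y = ?O p \<or> ?O y = ?O r" using y(1) orb_step[OF invf invg pW] orb_step[OF invf invg rW] q s by auto
      ultimately show False using v orb_self[of v W f g] by auto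
    qed
    have n': "{p, q, r, s} \<inter> ?O' v = {}"
    proof (rule ccontr)
      assume "{p, q, r, s} \<inter> ?O' v \<noteq> {}"
      then obtain y where y: "y \<in> {p, q, r, s}" "y \<in> ?O' v" by auto
      then have "?O' y = ?O' v" using orb_eq[OF invf invg'] by auto
      moreover have "?O' y = ?O' p" using y(1) all' orb_eq[OF invf invg'] by auto
      ultimately show False using v eq orb_self[of v W f g'] by auto
    qed
    have "?O' v \<subseteq> ?O v" using closed_all_or_none[of "?O v"] n orb_closed[OF invf invg True]
      by (intro orb_subset_closed) auto
    moreover have "?O v \<subseteq> ?O' v" using closed_all_or_none[of "?O' v"] n' orb_closed[OF invf invg' True]
      by (intro orb_subset_closed) auto
    ultimately show ?thesis by auto
  next
    case False then show ?thesis by (simp add: orb_outside)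
  qed
qed

text \<open>The count is taken inside a closed set \<open>A\<close>, because surgeries will be
  counted separately on the part where a point has value t and the part where it has value
  0.\<close>

lemma norb_merge:
  assumes "(p, r) \<notin> conn W f g" "A \<subseteq> W" "\<And>x. x \<in> A \<Longrightarrow> f x \<in> A" "\<And>x. x \<in> A \<Longrightarrow> g x \<in> A"
    "p \<in> A" "r \<in> A"
  shows "norb W f g A = norb W f g' A + 1"
proof -
  let ?O = "orb W f g" and ?O' = "orb W f g'"
  note m = merge[OF assms(1)]
  have fA: "finite A" using fin assms(2) finite_subset by auto
  have sub: "?O p \<subseteq> A" "?O r \<subseteq> A" using assms by (auto intro!: orb_subset_closed del: subsetI)
  define B where "B = A - ?O p - ?O r"
  have A: "A = ?O p \<union> ?O r \<union> B" using sub B_def by auto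
  have e1: "?O ` ?O p = {?O p}" "?O ` ?O r = {?O r}" "?O' ` (?O p \<union> ?O r) = {?O' p}"
  proof -
    have *: "h ` S = {h a}" if "a \<in> S" "\<And>x. x \<in> S \<Longrightarrow> h x = h a" for h :: "'a \<Rightarrow> 'a set" and S a
    proof -
      have "h ` S = (\<lambda>_. h a) ` S" using that(2) by (rule image_cong[OF refl])
      then show ?thesis using image_constant[OF that(1)] by simp
    qed
    show "?O ` ?O p = {?O p}" "?O ` ?O r = {?O r}" by (rule *, simp, erule orb_eq[OF invf invg])+
    show "?O' ` (?O p \<union> ?O r) = {?O' p}"
      unfolding m(1)[symmetric] by (rule *, simp, erule orb_eq[OF invf invg'])
  qed
  have eB: "?O' ` B = ?O ` B" using m(2) B_def by (intro image_cong) auto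
  have nB: "?O y \<notin> ?O ` B" if "y \<in> {p, r}" for y
  proof
    assume "?O y \<in> ?O ` B"
    then obtain b where b: "b \<in> B" "?O y = ?O b" by auto
    then have "b \<in> ?O y" by simp
    then show False using that b(1) B_def by auto
  qed
  have nB': "?O' p \<notin> ?O' ` B" 
  proof
    assume "?O' p \<in> ?O' ` B"
    then obtain b where b: "b \<in> B" "?O' p = ?O' b" by auto
    then have "b \<in> ?O' p" by simp
    then show False using m(1) b(1) B_def by auto
  qed
  have pr': "?O p \<noteq> ?O r" using m(4) orb_self[of p W f g] by (metis IntI empty_iff)
  have fB: "finite B" using fA B_def by auto
  have "?O ` A = insert (?O p) (insert (?O r) (?O ` B))" using A e1 by (metis image_Un insert_is_Un Un_assoc)
  then have "norb W f g A = card (?O ` B) + 2" unfolding norb_def using nB pr' fB by simp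
  moreover have "?O' ` A = insert (?O' p) (?O' ` B)" using A e1 by (metis image_Un insert_is_Un)
  then have "norb W f g' A = card (?O' ` B) + 1" unfolding norb_def using nB' fB by simp
  ultimately show ?thesis using eB by simp
qed

lemma norb_split:
  assumes "(p, r) \<in> conn W f g" "A \<subseteq> W" "\<And>x. x \<in> A \<Longrightarrow> f x \<in> A" "\<And>x. x \<in> A \<Longrightarrow> g' x \<in> A"
    "p \<in> A" "r \<in> A"
  shows "norb W f g' A = norb W f g A + 1"
proof -
  interpret S: surgery W f g' col p s r q by (rule swap)
  show ?thesis using S.norb_merge[of A] assms dichotomy swap_g' by auto
qed

lemma split:
  assumes "(p, r) \<in> conn W f g"
  shows "orb W f g p = orb W f g' p \<union> orb W f g' r"
    and "\<And>v. v \<notin> orb W f g p \<Longrightarrow> orb W f g' v = orb W f g v"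
    and "orb W f g' p \<inter> orb W f g' r = {}"
proof -
  interpret S: surgery W f g' col p s r q by (rule swap)
  have a: "(p, r) \<notin> conn W f g'" using assms dichotomy by auto
  note m = S.merge[OF a, unfolded swap_g']
  show "orb W f g p = orb W f g' p \<union> orb W f g' r" using m by auto
  show "\<And>v. v \<notin> orb W f g p \<Longrightarrow> orb W f g' v = orb W f g v" using m by auto
  show "orb W f g' p \<inter> orb W f g' r = {}" using m by auto
qed

text \<open>Closure under \<open>g\<close> and \<open>g'\<close> spreads membership among p, q, r,
  s, so a set avoiding p avoids every point where the two maps differ.\<close>

lemma orb_away:
  assumes "A \<subseteq> W" "\<And>x. x \<in> A \<Longrightarrow> f x \<in> A" "\<And>x. x \<in> A \<Longrightarrow> g x \<in> A" "\<And>x. x \<in> A \<Longrightarrow> g' x \<in> A"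
    "p \<notin> A" "v \<in> A"
  shows "orb W f g' v = orb W f g v"
proof -
  have "q \<notin> A" using assms(3)[of q] assms(5) dist by auto
  moreover have sA: "s \<notin> A" using assms(4)[of s] assms(5) by auto
  moreover have "r \<notin> A" using assms(3)[of r] s sA by auto
  ultimately have n: "{p, q, r, s} \<inter> A = {}" using assms by auto
  have "orb W f g v \<subseteq> A" "orb W f g' v \<subseteq> A" using assms by (auto intro!: orb_subset_closed del: subsetI)
  then have "{p, q, r, s} \<inter> orb W f g v = {}" "{p, q, r, s} \<inter> orb W f g' v = {}" using n by auto
  moreover have vW: "v \<in> W" using assms by auto
  ultimately show ?thesis
    using closed_all_or_none[of "orb W f g v"] closed_all_or_none[of "orb W f g' v"]
      orb_closed[OF invf invg vW] orb_closed[OF invf invg' vW]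
    by (intro equalityI orb_subset_closed) auto
qed

end

section \<open>Turning number\<close>

definition noncrossing :: "int set \<Rightarrow> (int \<Rightarrow> int) \<Rightarrow> bool" where
  "noncrossing S h \<longleftrightarrow> invol_on S h \<and> (\<forall>x\<in>S. h x \<noteq> x) \<and>
     (\<forall>x\<in>S. \<forall>y\<in>S. x < y \<and> y < h x \<longrightarrow> x < h y \<and> h y < h x)"

definition flips :: "'a set \<Rightarrow> ('a \<Rightarrow> 'a) \<Rightarrow> ('a \<Rightarrow> bool) \<Rightarrow> bool" where
  "flips S h col \<longleftrightarrow> (\<forall>x\<in>S. col (h x) \<longleftrightarrow> \<not> col x)"

lemma noncrossing_subset:
  assumes "noncrossing S h" "T \<subseteq> S" "\<And>x. x \<in> T \<Longrightarrow> h x \<in> T"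
  shows "noncrossing T h"
  using assms unfolding noncrossing_def invol_on_def by blast

text \<open>Nothing lies between i and j, so the arcs i-p and j-q can be pulled together over this
  gap and joined to a single arc p-q without meeting any other arc.\<close>

lemma noncrossing_removal:
  assumes g: "noncrossing S g" and ij: "i \<in> S" "j \<in> S" "i < j" and none: "\<And>y. y \<in> S \<Longrightarrow> \<not> (i < y \<and> y < j)"
    and pq: "g i = p" "g j = q" "p \<noteq> j"
  shows "noncrossing (S - {i, j}) (g(p := q, q := p))"
proof -
  let ?g = "g(p := q, q := p)"
  have inv: "\<And>x. x \<in> S \<Longrightarrow> g x \<in> S \<and> g (g x) = x \<and> g x \<noteq> x"
    using g unfolding noncrossing_def invol_on_def by auto
  have NC: "\<And>x y. x \<in> S \<Longrightarrow> y \<in> S \<Longrightarrow> x < y \<Longrightarrow> y < g x \<Longrightarrow> x < g y \<and> g y < g x"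
    using g unfolding noncrossing_def by auto
  have gp: "g p = i" "g q = j" "p \<in> S" "q \<in> S" using inv ij pq by metis+
  have ne: "p \<noteq> i" "q \<noteq> j" "q \<noteq> i" "p \<noteq> q" using inv ij pq gp by (metis less_irrefl)+
  have pos: "p < i \<or> j < p" "q < i \<or> j < q" using none[of p] none[of q] gp ne pq(3) by linarith+
  have inv': "?g x \<in> S - {i, j} \<and> ?g (?g x) = x \<and> ?g x \<noteq> x" if "x \<in> S - {i, j}" for x
  proof (cases "x = p \<or> x = q")
    case True
    then show ?thesis using gp ne pq(3) by auto
  next
    case False
    then have "g x \<notin> {i, j, p, q}" using that inv gp pq by (metis Diff_iff insertCI insert_iff singletonD)
    then show ?thesis using False inv that by auto
  qed
  have "x < ?g y \<and> ?g y < ?g x"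
    if x: "x \<in> S - {i, j}" and y: "y \<in> S - {i, j}" and lt: "x < y" "y < ?g x" for x y
  proof -
    have xy: "x \<in> S" "y \<in> S" "x \<noteq> i" "x \<noteq> j" "y \<noteq> i" "y \<noteq> j" using x y by auto
    have ypos: "y < i \<or> j < y" using none[of y] xy by linarith
    \<comment> \<open>When p and q lie on the same side of the gap, the arcs i-p and j-q are nested,
      and in both cases this forces q < p.\<close>
    have order: "\<not> (p < q \<and> q < i)" "\<not> (j < p \<and> p < q)"
      using NC[of p q] NC[of i j] gp ij pq by auto
    consider "x = p" | "x = q" | "x \<noteq> p" "x \<noteq> q" by blast
    then show ?thesis
    proof cases
      case 1
      then have y': "p < y" "y < q" using lt ne by auto
      have "p < i" "j < q" using pos order y' by linarith+
      have "y \<noteq> q" "y \<noteq> p" using y' by auto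
      have "p < g y \<and> g y < q"
      proof (cases "y < i")
        case True
        then have "p < g y \<and> g y < i" using NC[of p y] y' gp xy by auto
        then show ?thesis using \<open>j < q\<close> ij(3) by auto
      next
        case False
        then have "j < g y \<and> g y < q" using NC[of j y] y' ypos gp pq ij xy by auto
        then show ?thesis using \<open>p < i\<close> ij(3) by auto
      qed
      then show ?thesis using 1 \<open>y \<noteq> p\<close> \<open>y \<noteq> q\<close> ne by auto
    next
      case 2
      then have y': "q < y" "y < p" using lt ne by auto
      have yne: "y \<noteq> q" "y \<noteq> p" using y' by auto
      have gyS: "g y \<in> S" "g (g y) = y" using inv xy by auto
      have gy: "g y \<noteq> i" "g y \<noteq> j" "g y \<noteq> p" using gyS(2) gp pq xy yne by metis+
      have gypos: "g y < i \<or> j < g y" using none[OF gyS(1)] gy by linarith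
      have "q < g y \<and> g y < p"
      proof (cases "p < i")
        case True
        then have "y < j" using y' ij(3) by linarith
        then have "q < g y \<and> g y < j" using NC[of q y] gp xy y' by auto
        then have a: "q < g y" "g y < i" using gypos by auto
        have "\<not> p < g y" using NC[of p "g y"] gp gyS a(2) y' by auto
        then show ?thesis using a gy by linarith
      next
        case False
        then have jp: "j < p" using pos by linarith
        show ?thesis
        proof (cases "q < i")
          case True
          show ?thesis
          proof (cases "y < i")
            case True
            then have "q < g y \<and> g y < j" using NC[of q y] gp xy y' ij(3) by auto
            then show ?thesis using jp by linarith
          next
            case False
            then have "i < g y \<and> g y < p" using NC[of i y] pq ij xy y' ypos by auto
            then show ?thesis using \<open>q < i\<close> by linarith
          qed
        next
          case False
          then have jq: "j < q" using pos by linarith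
          then have a: "i < g y" "g y < p" using NC[of i y] pq ij xy y' by auto
          have "g y \<noteq> q" using gyS gp xy by metis
          moreover have "\<not> g y < q" using NC[of j "g y"] gyS ij pq gypos a y' by auto
          ultimately show ?thesis using a by linarith
        qed
      qed
      then show ?thesis using 2 yne ne by auto
    next
      case 3
      then have lt': "x < y" "y < g x" using lt by auto
      have gxS: "g x \<in> S" "g (g x) = x" using inv xy by auto
      have gx: "g x \<noteq> i" "g x \<noteq> j" using gxS pq 3 by metis+
      have gxpos: "g x < i \<or> j < g x" using none[OF gxS(1)] gx by linarith
      have xpos: "x < i \<or> j < x" using none[OF xy(1)] xy by linarith
      have "x < g y \<and> g y < g x" using NC xy lt' by auto
      moreover have "x < q \<and> q < g x" if "y = p"
      proof -
        have "x < i \<and> i < g x" using NC[of x p] lt' that gp xy by auto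
        then have "x < j \<and> j < g x" using gxpos ij(3) by linarith
        then show ?thesis using NC[of x j] xy ij pq by auto
      qed
      moreover have "x < p \<and> p < g x" if "y = q"
      proof -
        have "x < j \<and> j < g x" using NC[of x q] lt' that gp xy by auto
        then have "x < i \<and> i < g x" using xpos ij(3) by linarith
        then show ?thesis using NC[of x i] xy ij pq by auto
      qed
      ultimately show ?thesis using 3 by auto
    qed
  qed
  then show ?thesis unfolding noncrossing_def invol_on_def using inv' by auto
qed

text \<open>The turning number of a simple closed curve is \<open>\<plusminus>1\<close>: a circle made of \<open>card S\<close> arcs has
  \<open>card S / 2 \<plusminus> 1\<close> clockwise ones. The induction contracts an innermost arc of \<open>f\<close> that avoids the
  leftmost vertex.\<close>

lemma clockwise_arcs_circle:
  assumes "finite S" "noncrossing S f" "noncrossing S g" "S \<noteq> {}"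
    and "\<And>U. U \<subseteq> S \<Longrightarrow> U \<noteq> {} \<Longrightarrow> (\<And>x. x \<in> U \<Longrightarrow> f x \<in> U \<and> g x \<in> U) \<Longrightarrow> U = S"
    and "flips S f col" "flips S g col"
  shows "2 * (card {x\<in>S. x < f x \<and> col x} + card {x\<in>S. x < g x \<and> col x}) + 2
    = card S + (if col (Min S) then 4 else 0)"
  using assms
proof (induction "card S" arbitrary: S g rule: less_induct)
  case less
  note fin = less.prems(1) and conn = less.prems(5)
  have F: "\<And>x. x \<in> S \<Longrightarrow> f x \<in> S \<and> f (f x) = x \<and> f x \<noteq> x"
    "\<And>x y. x \<in> S \<Longrightarrow> y \<in> S \<Longrightarrow> x < y \<Longrightarrow> y < f x \<Longrightarrow> x < f y \<and> f y < f x"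
    using less.prems(2) unfolding noncrossing_def invol_on_def by auto
  have G: "\<And>x. x \<in> S \<Longrightarrow> g x \<in> S \<and> g (g x) = x \<and> g x \<noteq> x"
    using less.prems(3) unfolding noncrossing_def invol_on_def by auto
  have cf: "\<And>x. x \<in> S \<Longrightarrow> col (f x) = (\<not> col x)" and cg: "\<And>x. x \<in> S \<Longrightarrow> col (g x) = (\<not> col x)"
    using less.prems(6,7) unfolding flips_def by auto
  define m where "m = Min S"
  have m: "m \<in> S" "\<And>x. x \<in> S \<Longrightarrow> m \<le> x" unfolding m_def using fin less.prems(4) by auto
  have mf: "m < f m" "m < g m" using m F(1)[of m] G[of m] by (metis order_le_less)+
  show ?case
  proof (cases "f m = g m")
    case True
    have "U = S" if "U = {m, f m}" for U
      using conn[of U] that m F(1)[of m] G[of m] True by auto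
    then have S: "S = {m, f m}" by simp
    have "{x\<in>S. x < f x \<and> col x} = (if col m then {m} else {})"
      using S mf F(1)[OF m(1)] by auto
    moreover have "{x\<in>S. x < g x \<and> col x} = (if col m then {m} else {})"
      using S mf F(1)[OF m(1)] G[OF m(1)] True by auto
    moreover have "card S = 2" using S mf by (metis card_2_iff less_irrefl)
    ultimately show ?thesis unfolding m_def[symmetric] by simp
  next
    case False
    \<comment> \<open>Left ends of the \<open>f\<close>-arcs avoiding m. There is one, because
      \<open>g m\<close> lies on such an arc. Since m survives the contraction, the term for
      \<open>Min S\<close> stays the same.\<close>
    define A where "A = {x\<in>S. x \<noteq> m \<and> x < f x}"
    have "A \<noteq> {}"
    proof -
      let ?y = "g m"
      have y: "?y \<in> S" "?y \<noteq> m" "?y \<noteq> f m" using G m False by auto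
      then have "f ?y \<in> S" "f ?y \<noteq> m" using F(1) by (blast, metis)
      then show ?thesis unfolding A_def using y F(1)[OF y(1)]
        by (smt (verit) empty_iff mem_Collect_eq)
    qed
    moreover have "finite A" unfolding A_def using fin by auto
    \<comment> \<open>A shortest such arc has no vertex under it: that vertex would lie on a still
      shorter arc avoiding m.\<close>
    ultimately obtain i where iA: "i \<in> A" and imin: "\<And>x. x \<in> A \<Longrightarrow> f i - i \<le> f x - x"
      using ex_min_if_finite[of "(\<lambda>x. f x - x) ` A"] by (metis (no_types, lifting) finite_imageI image_iff image_is_empty not_le)
    define j where "j = f i"
    have ij: "i \<in> S" "j \<in> S" "i < j" "f j = i" "i \<noteq> m" using iA F(1) unfolding A_def j_def by auto
    have jm: "j \<noteq> m" using m(2)[OF ij(1)] ij(3) by auto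
    have none: "\<not> (i < y \<and> y < j)" if y: "y \<in> S" for y
    proof
      assume a: "i < y \<and> y < j"
      then have b: "i < f y" "f y < j" using F(2)[OF ij(1) y] j_def by auto
      show False
      proof (cases "y < f y")
        case True
        then have "y \<in> A" unfolding A_def using y a m(2)[OF ij(1)] by auto
        then show False using imin[of y] a b j_def by auto
      next
        case False
        then have "f y < f (f y)" using F(1)[OF y] by auto
        then have "f y \<in> A" unfolding A_def using F(1)[OF y] b m(2)[OF ij(1)] by auto
        then show False using imin[of "f y"] a b j_def F(1)[OF y] by auto
      qed
    qed
    define p q where "p = g i" and "q = g j"
    have pj: "p \<noteq> j"
    proof
      assume pj: "p = j"
      have "U = S" if "U = {i, j}" for U
        using conn[of U] that ij pj p_def j_def G[of i] by auto
      then show False using m(1) ij(5) jm by auto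
    qed
    define S' g' where "S' = S - {i, j}" and "g' = g(p := q, q := p)"
    have gp: "g p = i" "g q = j" "p \<in> S" "q \<in> S" using G ij p_def q_def by auto
    have ne: "p \<noteq> i" "q \<noteq> j" "q \<noteq> i" "p \<noteq> q" using G ij p_def q_def gp pj by (metis less_irrefl)+
    have pos: "p < i \<or> j < p" "q < i \<or> j < q" using none[of p] none[of q] gp ne pj by linarith+
    have S'S: "S' \<subseteq> S" "finite S'" "card S' < card S" "card S = card S' + 2"
      using fin ij card_Diff_subset[of "{i,j}" S] card_mono[of S "{i,j}"] unfolding S'_def by auto
    have pS': "p \<in> S'" "q \<in> S'" unfolding S'_def using gp ne pj by auto
    have ncg': "noncrossing S' g'" unfolding S'_def g'_def
      by (rule noncrossing_removal[OF less.prems(3) ij(1-3) none p_def[symmetric] q_def[symmetric] pj])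
    have ncf': "noncrossing S' f"
    proof (rule noncrossing_subset[OF less.prems(2) S'S(1)])
      fix x assume "x \<in> S'"
      then have x: "x \<in> S" "x \<noteq> i" "x \<noteq> j" unfolding S'_def by auto
      have "f x \<noteq> i" using F(1)[OF x(1)] x(3) j_def by metis
      moreover have "f x \<noteq> j" using F(1)[OF x(1)] x(2) ij(4) by metis
      ultimately show "f x \<in> S'" using F(1)[OF x(1)] unfolding S'_def by simp
    qed
    have g'o: "g' x = g x" if "x \<noteq> p" "x \<noteq> q" for x using that unfolding g'_def by auto
    have g'pq: "g' p = q" "g' q = p" using ne unfolding g'_def by auto
    have IH: "2 * (card {x\<in>S'. x < f x \<and> col x} + card {x\<in>S'. x < g' x \<and> col x}) + 2
        = card S' + (if col (Min S') then 4 else 0)"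
    proof (rule less.hyps[OF S'S(3,2) ncf' ncg'])
      show "S' \<noteq> {}" using pS' by auto
      fix U assume U: "U \<subseteq> S'" "U \<noteq> {}" "\<And>x. x \<in> U \<Longrightarrow> f x \<in> U \<and> g' x \<in> U"
      have pq: "p \<in> U \<longleftrightarrow> q \<in> U" using U(3) g'pq by metis
      \<comment> \<open>Reinserting i and j whenever p is present turns a closed set of the
        contracted circle into a closed set of the original one.\<close>
      define U' where "U' = U \<union> (if p \<in> U then {i, j} else {})"
      have "f x \<in> U' \<and> g x \<in> U'" if x: "x \<in> U'" for x
      proof (cases "x \<in> U")
        case True
        have "g x \<in> U'"
        proof (cases "x = p \<or> x = q")
          case True
          then show ?thesis using \<open>x \<in> U\<close> pq gp unfolding U'_def by auto
        next
          case False
          then show ?thesis using U(3)[OF True] g'o[of x] unfolding U'_def by auto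
        qed
        then show ?thesis using U(3)[OF True] unfolding U'_def by auto
      next
        case False
        then have "p \<in> U" "x = i \<or> x = j" using x unfolding U'_def by (auto split: if_splits)
        then show ?thesis using pq ij j_def p_def q_def unfolding U'_def by auto
      qed
      moreover have "U' \<subseteq> S" unfolding U'_def using U(1) S'S ij by auto
      moreover have "U' \<noteq> {}" unfolding U'_def using U(2) by auto
      ultimately have "U' = S" using conn by blast
      then show "U = S'" using U(1) unfolding U'_def S'_def by (auto split: if_splits)
    next
      show "flips S' f col" unfolding flips_def using cf S'S by auto
      show "flips S' g' col" unfolding flips_def
      proof
        fix x assume x: "x \<in> S'"
        have "col (f i) = (\<not> col i)" using cf ij by auto
        then have "col q = (\<not> col p)" using cg ij p_def q_def j_def by auto
        then show "col (g' x) = (\<not> col x)" using x S'S cg g'o[of x] g'pq by (cases "x = p \<or> x = q") auto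
      qed
    qed
    have "Min S' = m"
      using m S'S ij(5) jm by (intro Min_eqI) (auto simp: S'_def)
    have cq: "col p = (\<not> col i)" "col q = col i" "col j = (\<not> col i)"
      using cg ij p_def q_def cf[OF ij(1)] j_def by auto
    have Af: "{x\<in>S. x < f x \<and> col x} = {x\<in>S'. x < f x \<and> col x} \<union> (if col i then {i} else {})"
      using ij j_def unfolding S'_def by auto
    have cAf: "card {x\<in>S. x < f x \<and> col x} = card {x\<in>S'. x < f x \<and> col x} + (if col i then 1 else 0)"
      unfolding Af using S'S(2) by (auto simp: S'_def)
    define R where "R = {x\<in>S'. x < g x \<and> col x \<and> x \<noteq> p \<and> x \<noteq> q}"
    have fR: "finite R" unfolding R_def using S'S by auto
    have Ag: "{x\<in>S. x < g x \<and> col x} = R \<union> {x\<in>{i,j,p,q}. x < g x \<and> col x}"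
      unfolding R_def S'_def using gp ij by auto
    have Ag': "{x\<in>S'. x < g' x \<and> col x} = R \<union> {x\<in>{p,q}. x < g' x \<and> col x}"
      unfolding R_def using g'o pS' by auto
    have d: "R \<inter> {x\<in>{i,j,p,q}. x < g x \<and> col x} = {}" "R \<inter> {x\<in>{p,q}. x < g' x \<and> col x} = {}"
      unfolding R_def S'_def by auto
    have NC: "\<And>x y. x \<in> S \<Longrightarrow> y \<in> S \<Longrightarrow> x < y \<Longrightarrow> y < g x \<Longrightarrow> x < g y \<and> g y < g x"
      using less.prems(3) unfolding noncrossing_def by auto
    have order: "\<not> (p < q \<and> q < i)" "\<not> (j < p \<and> p < q)"
      using NC[of p q] NC[of i j] gp ij p_def q_def by auto
    have gi: "g i = p" "g j = q" using p_def q_def by auto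
    \<comment> \<open>The contraction removes two vertices, so it must lose exactly one clockwise
      arc. In each position of p and q relative to the gap, the arcs i-j, i-p, j-q together have one
      clockwise arc more than the new arc p-q.\<close>
    have cc: "card {x\<in>{i,j,p,q}. x < g x \<and> col x} + (if col i then 1 else 0)
        = card {x\<in>{p,q}. x < g' x \<and> col x} + 1"
    proof (cases "p < i")
      case True
      show ?thesis
      proof (cases "q < i")
        case True
        then have o: "q < p" using order ne \<open>p < i\<close> by linarith
        have "{x\<in>{i,j,p,q}. x < g x \<and> col x} = (if col i then {q} else {p})"
          using True \<open>p < i\<close> cq gi gp ij(3) by auto
        moreover have "{x\<in>{p,q}. x < g' x \<and> col x} = (if col i then {q} else {})"
          using o cq g'pq by auto
        ultimately show ?thesis by simp
      next
        case False
        then have q: "j < q" using pos by auto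
        have "{x\<in>{i,j,p,q}. x < g x \<and> col x} = (if col i then {} else {p, j})"
          using q \<open>p < i\<close> cq gi gp ij(3) by auto
        moreover have "{x\<in>{p,q}. x < g' x \<and> col x} = (if col i then {} else {p})"
          using q ij \<open>p < i\<close> cq g'pq by auto
        ultimately show ?thesis using pj by simp
      qed
    next
      case False
      then have p: "j < p" using pos by auto
      show ?thesis
      proof (cases "q < i")
        case True
        then have "p < j" using NC[of q i] gp gi ij by auto
        then show ?thesis using p by simp
      next
        case False
        then have q: "j < q" using pos by auto
        then have o: "q < p" using order ne p by linarith
        have "{x\<in>{i,j,p,q}. x < g x \<and> col x} = (if col i then {i} else {j})"
          using q p cq gi gp ij(3) by auto
        moreover have "{x\<in>{p,q}. x < g' x \<and> col x} = (if col i then {q} else {})"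
          using o cq g'pq by auto
        ultimately show ?thesis by simp
      qed
    qed
    have "card {x\<in>S. x < g x \<and> col x} = card R + card {x\<in>{i,j,p,q}. x < g x \<and> col x}"
      unfolding Ag using d fR by (intro card_Un_disjoint) auto
    moreover have "card {x\<in>S'. x < g' x \<and> col x} = card R + card {x\<in>{p,q}. x < g' x \<and> col x}"
      unfolding Ag' using d fR by (intro card_Un_disjoint) auto
    ultimately show ?thesis using IH cAf cc S'S(4) \<open>Min S' = m\<close>
      unfolding m_def[symmetric] by (cases "col i") auto
  qed
qed

section \<open>Closed circle diagrams\<close>

definition verts :: "int \<Rightarrow> int set" where "verts N = {0..<N}"

definition closed_cupd :: "int \<Rightarrow> cupd \<Rightarrow> bool" where
  "closed_cupd N a \<longleftrightarrow> valid_cupd a \<and> rays a = {} \<and> (\<forall>k. k \<in> verts N \<longleftrightarrow> (\<exists>(i,j)\<in>cups a. k = i \<or> k = j))"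

definition mate :: "cupd \<Rightarrow> int \<Rightarrow> int" where
  "mate a v = (THE w. (v, w) \<in> cups a \<or> (w, v) \<in> cups a)"

lemma finite_verts [simp]: "finite (verts N)"
  unfolding verts_def by simp

lemma closed_cupd_free: "closed_cupd N a \<Longrightarrow> free a k \<longleftrightarrow> k \<notin> verts N"
  unfolding closed_cupd_def free_def by blast

context
  fixes N :: int and a :: cupd
  assumes a: "closed_cupd N a"
begin

lemma cup_less: "(i, j) \<in> cups a \<Longrightarrow> i < j"
  using a unfolding closed_cupd_def valid_cupd_def by auto

lemma cup_verts:
  assumes e: "(i, j) \<in> cups a"
  shows "i \<in> verts N" "j \<in> verts N"
proof -
  have "\<exists>(i', j')\<in>cups a. i = i' \<or> i = j'" "\<exists>(i', j')\<in>cups a. j = i' \<or> j = j'"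
    by (rule bexI[OF _ e], simp)+
  then show "i \<in> verts N" "j \<in> verts N" using a unfolding closed_cupd_def by simp_all
qed

lemma cup_disjoint: "(i, j) \<in> cups a \<Longrightarrow> (k, l) \<in> cups a \<Longrightarrow> {i, j} \<inter> {k, l} \<noteq> {} \<Longrightarrow> i = k \<and> j = l"
proof -
  assume e: "(i, j) \<in> cups a" "(k, l) \<in> cups a" "{i, j} \<inter> {k, l} \<noteq> {}"
  have "\<forall>(i,j)\<in>cups a. \<forall>(k,l)\<in>cups a. (i,j) \<noteq> (k,l) \<longrightarrow> {i,j} \<inter> {k,l} = {}"
    using a unfolding closed_cupd_def valid_cupd_def by simp
  from case_prodD[OF bspec[OF case_prodD[OF bspec[OF this e(1)]] e(2)]] e(3) show "i = k \<and> j = l" by blast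
qed

lemma cup_noncrossing: "(i, j) \<in> cups a \<Longrightarrow> (k, l) \<in> cups a \<Longrightarrow> \<not> (i < k \<and> k < j \<and> j < l)"
proof -
  assume e: "(i, j) \<in> cups a" "(k, l) \<in> cups a"
  have "\<forall>(i,j)\<in>cups a. \<forall>(k,l)\<in>cups a. \<not> (i < k \<and> k < j \<and> j < l)"
    using a unfolding closed_cupd_def valid_cupd_def by simp
  from case_prodD[OF bspec[OF case_prodD[OF bspec[OF this e(1)]] e(2)]] show "\<not> (i < k \<and> k < j \<and> j < l)" .
qed

lemma mate_unique:
  assumes "(v, w) \<in> cups a \<or> (w, v) \<in> cups a" "(v, u) \<in> cups a \<or> (u, v) \<in> cups a"
  shows "w = u"
  using assms cup_disjoint[of v w v u] cup_disjoint[of v w u v] cup_disjoint[of w v v u] cup_disjoint[of w v u v]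
    cup_less[of v w] cup_less[of w v] by auto

lemma mate_eq: "(v, w) \<in> cups a \<or> (w, v) \<in> cups a \<Longrightarrow> mate a v = w"
  unfolding mate_def using mate_unique by (intro the_equality) auto

lemma mate_cup: "(i, j) \<in> cups a \<Longrightarrow> mate a i = j" "(i, j) \<in> cups a \<Longrightarrow> mate a j = i"
  using mate_eq by auto

lemma mate_cups: "v \<in> verts N \<Longrightarrow> (v, mate a v) \<in> cups a \<or> (mate a v, v) \<in> cups a"
proof -
  assume "v \<in> verts N"
  then obtain i j where "(i, j) \<in> cups a" "v = i \<or> v = j" using a unfolding closed_cupd_def by blast
  then show ?thesis using mate_cup by auto
qed

lemma mate_less_cup: "v \<in> verts N \<Longrightarrow> v < mate a v \<Longrightarrow> (v, mate a v) \<in> cups a"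
  using mate_cups[of v] cup_less[of "mate a v" v] by auto

lemma mate_verts: "v \<in> verts N \<Longrightarrow> mate a v \<in> verts N"
  using mate_cups[of v] cup_verts by auto

lemma mate_mate: "v \<in> verts N \<Longrightarrow> mate a (mate a v) = v"
  using mate_cups[of v] mate_cup by auto

lemma mate_neq: "v \<in> verts N \<Longrightarrow> mate a v \<noteq> v"
  using mate_cups[of v] cup_less[of v v] by auto

lemma invol_mate: "invol_on (verts N) (mate a)"
  unfolding invol_on_def using mate_verts mate_mate by auto

lemma noncrossing_mate: "noncrossing (verts N) (mate a)"
  unfolding noncrossing_def
proof (intro conjI ballI impI invol_mate)
  fix x y assume x: "x \<in> verts N" and y: "y \<in> verts N" and lt: "x < y \<and> y < mate a x"
  have X: "(x, mate a x) \<in> cups a" using mate_less_cup x lt by auto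
  note nc = cup_noncrossing
  have ne: "mate a y \<noteq> x" "mate a y \<noteq> mate a x" using mate_mate x y lt by (metis less_irrefl)+
  have "x < mate a y \<and> mate a y < mate a x"
    using mate_cups[OF y]
  proof
    assume c: "(y, mate a y) \<in> cups a"
    then show ?thesis using nc[OF X c] cup_less[OF c] lt ne by auto
  next
    assume c: "(mate a y, y) \<in> cups a"
    then show ?thesis using nc[OF c X] cup_less[OF c] lt ne by auto
  qed
  then show "x < mate a y" "mate a y < mate a x" by auto
qed (simp add: mate_neq)

lemma cups_eq_mate: "cups a = {(i, mate a i) | i. i \<in> verts N \<and> i < mate a i}"
proof (intro equalityI subsetI)
  fix e assume "e \<in> cups a"
  then show "e \<in> {(i, mate a i) | i. i \<in> verts N \<and> i < mate a i}"
    using mate_cup cup_less cup_verts by (cases e) auto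
qed (auto simp: mate_less_cup)

lemma finite_cups: "finite (cups a)"
  using a unfolding closed_cupd_def valid_cupd_def by auto

end

section \<open>Parity along arcs\<close>

lemma even_card_invol:
  assumes "finite A" "invol_on A h" "\<And>x. x \<in> A \<Longrightarrow> h x \<noteq> x"
  shows "even (card A)"
  using assms
proof (induction "card A" arbitrary: A rule: less_induct)
  case less
  show ?case
  proof (cases "A = {}")
    case False
    then obtain x where x: "x \<in> A" by auto
    let ?B = "A - {x, h x}"
    have hx: "h x \<in> A" "h x \<noteq> x" "h (h x) = x" using less.prems x unfolding invol_on_def by auto
    have c: "card A = card ?B + 2"
      using less.prems(1) x hx card_Diff_subset[of "{x, h x}" A] card_mono[of A "{x, h x}"] by auto
    have "invol_on ?B h" unfolding invol_on_def
    proof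
      fix y assume y: "y \<in> ?B"
      then have "h y \<in> A" "h (h y) = y" using less.prems(2) unfolding invol_on_def by auto
      then show "h y \<in> ?B \<and> h (h y) = y" using y hx by auto
    qed
    then have "even (card ?B)" using less.hyps[of ?B] c less.prems by auto
    then show ?thesis using c by simp
  qed simp
qed

definition rank :: "int set \<Rightarrow> int \<Rightarrow> nat" where
  "rank S v = card {u\<in>S. u < v}"

lemma rank_Min: "finite C \<Longrightarrow> rank C (Min C) = 0"
  unfolding rank_def by (auto simp: not_less)

text \<open>The vertices strictly under an arc are paired among themselves, so the ranks of its two
  ends differ by an odd number.\<close>

lemma rank_flips:
  assumes S: "finite S" "noncrossing S h"
  shows "flips S h (\<lambda>v. even (rank S v))"
proof -
  have H: "\<And>x. x \<in> S \<Longrightarrow> h x \<in> S \<and> h (h x) = x \<and> h x \<noteq> x"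
    "\<And>x y. x \<in> S \<Longrightarrow> y \<in> S \<Longrightarrow> x < y \<Longrightarrow> y < h x \<Longrightarrow> x < h y \<and> h y < h x"
    using S unfolding noncrossing_def invol_on_def by auto
  have *: "even (rank S (h x)) \<longleftrightarrow> \<not> even (rank S x)" if x: "x \<in> S" "x < h x" for x
  proof -
    let ?B = "{u\<in>S. x < u \<and> u < h x}"
    have "{u\<in>S. u < h x} = {u\<in>S. u < x} \<union> {x} \<union> ?B" using x by auto
    moreover have "card ({u\<in>S. u < x} \<union> {x} \<union> ?B) = card ({u\<in>S. u < x} \<union> {x}) + card ?B"
      using S by (intro card_Un_disjoint) auto
    moreover have "card ({u\<in>S. u < x} \<union> {x}) = rank S x + 1" unfolding rank_def using S by auto
    ultimately have "rank S (h x) = rank S x + 1 + card ?B" unfolding rank_def by auto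
    moreover have "even (card ?B)"
    proof (rule even_card_invol)
      show "invol_on ?B h" unfolding invol_on_def using H x by auto
    qed (use S H in auto)
    ultimately show ?thesis by auto
  qed
  show ?thesis unfolding flips_def
  proof
    fix x assume x: "x \<in> S"
    consider "x < h x" | "h x < h (h x)" using H(1)[OF x] by fastforce
    then show "even (rank S (h x)) \<longleftrightarrow> \<not> even (rank S x)"
    proof cases
      case 1 then show ?thesis using * x by auto
    next
      case 2 then show ?thesis using *[of "h x"] H(1)[OF x] by auto
    qed
  qed
qed

lemma rank_verts: "v \<in> verts N \<Longrightarrow> rank (verts N) v = nat v"
proof -
  assume v: "v \<in> verts N"
  then have "{u \<in> verts N. u < v} = {0..<v}" unfolding verts_def by auto
  then show ?thesis unfolding rank_def by simp
qed

lemma parity_flips: "closed_cupd N a \<Longrightarrow> flips (verts N) (mate a) even"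
  using rank_flips[OF finite_verts noncrossing_mate] rank_verts mate_verts
  unfolding flips_def by (metis (no_types, lifting) atLeastLessThan_iff even_nat_iff verts_def)

text \<open>Fixing \<open>Circ\<close> off the vertices matches the default of \<open>clw\<close>
  and lets an orientation be determined by its clockwise circles.\<close>

definition Or :: "int \<Rightarrow> cupd \<Rightarrow> weight set" where
  "Or N a = {\<kappa>. oriented a \<kappa> \<and> (\<forall>k. k \<notin> verts N \<longrightarrow> \<kappa> k = Circ)}"

lemma Or_iff:
  assumes "closed_cupd N a"
  shows "\<kappa> \<in> Or N a \<longleftrightarrow> (\<forall>k. k \<notin> verts N \<longrightarrow> \<kappa> k = Circ) \<and> (\<forall>k\<in>verts N. \<kappa> k \<in> {Dn, Up})
    \<and> flips (verts N) (mate a) (\<lambda>k. \<kappa> k = Up)"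
proof -
  have "oriented a \<kappa> \<longleftrightarrow> (\<forall>k. k \<notin> verts N \<longrightarrow> \<kappa> k \<in> {Circ, Cross}) \<and> (\<forall>(i,j)\<in>cups a. {\<kappa> i, \<kappa> j} = {Dn, Up})"
    using assms closed_cupd_free[OF assms] unfolding oriented_def closed_cupd_def by auto
  moreover have "(\<forall>(i,j)\<in>cups a. {\<kappa> i, \<kappa> j} = {Dn, Up}) \<longleftrightarrow>
      (\<forall>k\<in>verts N. \<kappa> k \<in> {Dn, Up} \<and> (\<kappa> (mate a k) = Up \<longleftrightarrow> \<kappa> k \<noteq> Up))" (is "?L \<longleftrightarrow> ?R")
  proof
    assume L: ?L
    show ?R
    proof
      fix k assume k: "k \<in> verts N"
      have "{\<kappa> k, \<kappa> (mate a k)} = {Dn, Up}"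
        using mate_cups[OF assms k]
      proof (elim disjE)
        assume c: "(k, mate a k) \<in> cups a"
        show ?thesis using case_prodD[OF bspec[OF L c]] .
      next
        assume c: "(mate a k, k) \<in> cups a"
        show ?thesis using case_prodD[OF bspec[OF L c]] by (simp only: insert_commute)
      qed
      then show "\<kappa> k \<in> {Dn, Up} \<and> (\<kappa> (mate a k) = Up \<longleftrightarrow> \<kappa> k \<noteq> Up)" by (auto simp: doubleton_eq_iff)
    qed
  next
    assume R: ?R
    show ?L
    proof (clarify)
      fix i j assume c: "(i, j) \<in> cups a"
      then have "\<kappa> i \<in> {Dn, Up}" "\<kappa> j \<in> {Dn, Up}" "\<kappa> j = Up \<longleftrightarrow> \<kappa> i \<noteq> Up"
        using R cup_verts[OF assms c] mate_cup[OF assms c] by auto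
      then show "{\<kappa> i, \<kappa> j} = {Dn, Up}" by auto
    qed
  qed
  ultimately show ?thesis unfolding Or_def flips_def by auto
qed

lemma OrD:
  assumes "closed_cupd N a" "\<kappa> \<in> Or N a"
  shows "k \<notin> verts N \<Longrightarrow> \<kappa> k = Circ" "k \<in> verts N \<Longrightarrow> \<kappa> k = Dn \<or> \<kappa> k = Up"
    "flips (verts N) (mate a) (\<lambda>k. \<kappa> k = Up)"
  using assms Or_iff by auto

section \<open>Circles of two glued diagrams\<close>

definition circle :: "int \<Rightarrow> cupd \<Rightarrow> cupd \<Rightarrow> int \<Rightarrow> int set" where
  "circle N a d v = orb (verts N) (mate a) (mate d) v"

definition circles :: "int \<Rightarrow> cupd \<Rightarrow> cupd \<Rightarrow> int set set" where
  "circles N a d = circle N a d ` verts N"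

definition cw :: "int \<Rightarrow> cupd \<Rightarrow> cupd \<Rightarrow> weight \<Rightarrow> int set set" where
  "cw N a d \<kappa> = {C \<in> circles N a d. \<kappa> (Min C) = Up}"

lemma circle_commute: "circle N a d = circle N d a"
  unfolding circle_def by (simp add: orb_commute[of _ "mate a"] fun_eq_iff)

lemma circles_commute: "circles N a d = circles N d a"
  unfolding circles_def by (simp add: circle_commute[of N a])

lemma cw_commute: "cw N a d \<kappa> = cw N d a \<kappa>"
  unfolding cw_def by (simp add: circles_commute[of N a])

lemma finite_circles [simp]: "finite (circles N a d)"
  unfolding circles_def by simp

lemma finite_cw [simp]: "finite (cw N a d \<kappa>)"
  unfolding cw_def by simp

definition flip :: "int set \<Rightarrow> weight \<Rightarrow> weight" where
  "flip C \<kappa> v = (if v \<in> C then (if \<kappa> v = Dn then Up else Dn) else \<kappa> v)"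

section \<open>The Bruhat order\<close>

lemma bruhat_le_refl: "bruhat_le x x"
  unfolding bruhat_le_def by simp

lemma bruhat_le_trans: "bruhat_le x y \<Longrightarrow> bruhat_le y z \<Longrightarrow> bruhat_le x z"
  unfolding bruhat_le_def by simp

text \<open>A step is strictly increasing lexicographically, with \<open>Dn\<close> before
  \<open>Up\<close>: the leftmost changed vertex goes from \<open>Dn\<close> to
  \<open>Up\<close>.\<close>

lemma bruhat_le_antisym:
  assumes "bruhat_le x y" "bruhat_le y x" shows "x = y"
proof -
  define lt where "lt x y \<longleftrightarrow> (\<exists>i::int. (\<forall>k<i. x k = y k) \<and> x i = Dn \<and> y i = Up)" for x y :: weight
  have tr: "lt x z" if xy: "lt x y" and yz: "lt y z" for x y z
  proof -
    obtain i where i: "\<forall>k<i. x k = y k" "x i = Dn" "y i = Up" using xy unfolding lt_def by blast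
    obtain j where j: "\<forall>k<j. y k = z k" "y j = Dn" "z j = Up" using yz unfolding lt_def by blast
    consider "i < j" | "j < i" using i j by (metis lab.distinct(11) linorder_neqE_linordered_idom)
    then show ?thesis
    proof cases
      case 1 then show ?thesis unfolding lt_def using i j by (intro exI[of _ i]) auto
    next
      case 2 then show ?thesis unfolding lt_def using i j by (intro exI[of _ j]) auto
    qed
  qed
  have step: "lt x y" if stage: "bruhat_step x y" for x y
  proof -
    obtain i j where "i < j" "x i = Dn" "x j = Up" "y = x(i := Up, j := Dn)"
      using stage unfolding bruhat_step_def by blast
    then show ?thesis unfolding lt_def by (intro exI[of _ i]) auto
  qed
  have main: "x = y \<or> lt x y" if "bruhat_le x y" for x y
    using that unfolding bruhat_le_def
    by (induction rule: rtranclp_induct) (use step tr in blast)+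
  have "\<not> lt x x" for x unfolding lt_def by auto
  then show ?thesis using main assms tr by blast
qed

text \<open>From left to right the labels on \<open>C\<close> read \<open>Dn\<close>,
  \<open>Up\<close>, \<open>Dn\<close>, \<open>Up\<close> and so on; interchanging each consecutive
  pair is one Bruhat step.\<close>

lemma bruhat_le_flip:
  assumes "finite C" "even (card C)" "\<And>u. u \<in> C \<Longrightarrow> \<kappa> u = (if even (rank C u) then Dn else Up)"
  shows "bruhat_le \<kappa> (flip C \<kappa>)"
  using assms
proof (induction "card C" arbitrary: C \<kappa> rule: less_induct)
  case less
  show ?case
  proof (cases "C = {}")
    case True
    then have "flip C \<kappa> = \<kappa>" unfolding flip_def by auto
    then show ?thesis by (simp add: bruhat_le_refl)
  next
    case False
    define x where "x = Min C"
    have x: "x \<in> C" "\<And>u. u \<in> C \<Longrightarrow> x \<le> u" unfolding x_def using False less.prems by auto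
    let ?C1 = "C - {x}"
    have c1: "card C = Suc (card ?C1)" using x less.prems by (metis card.remove)
    then have ne: "?C1 \<noteq> {}" using less.prems(2) by (metis card.empty One_nat_def odd_one)
    define y where "y = Min ?C1"
    have "y \<in> ?C1" unfolding y_def using ne less.prems by (intro Min_in) auto
    moreover have "\<And>u. u \<in> ?C1 \<Longrightarrow> y \<le> u" unfolding y_def using less.prems by simp
    ultimately have y: "y \<in> C" "y \<noteq> x" "\<And>u. u \<in> C \<Longrightarrow> u \<noteq> x \<Longrightarrow> y \<le> u" by auto
    have xy: "x < y" using x y by force
    define D where "D = C - {x, y}"
    have cD: "card C = card D + 2"
      using less.prems(1) x y card_Diff_subset[of "{x, y}" C] card_mono[of C "{x, y}"] unfolding D_def by auto
    define k1 where "k1 = \<kappa>(x := Up, y := Dn)"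
    have kx: "\<kappa> x = Dn" using less.prems(3)[OF x(1)] rank_Min[OF less.prems(1)] unfolding x_def by simp
    have "{u \<in> C. u < y} = {x}" using x y xy by force
    then have "rank C y = 1" unfolding rank_def by (metis One_nat_def card_1_singleton_iff)
    then have ky: "\<kappa> y = Up" using less.prems(3)[OF y(1)] by simp
    have "bruhat_step \<kappa> k1" unfolding bruhat_step_def k1_def using xy kx ky by blast
    then have b1: "bruhat_le \<kappa> k1" unfolding bruhat_le_def by simp
    have fD: "finite D" unfolding D_def using less.prems by auto
    have "bruhat_le k1 (flip D k1)"
    proof (rule less.hyps)
      show "card D < card C" using cD by simp
      show "finite D" by (rule fD)
      show "even (card D)" using cD less.prems(2) by simp
      fix u assume u: "u \<in> D"
      then have u': "u \<in> C" "u \<noteq> x" "u \<noteq> y" unfolding D_def by auto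
      then have gt: "y < u" using y by force
      have "{w \<in> C. w < u} = {x, y} \<union> {w \<in> D. w < u}" unfolding D_def using gt xy x y by auto
      moreover have "card ({x, y} \<union> {w \<in> D. w < u}) = card {x, y} + card {w \<in> D. w < u}"
        using fD by (intro card_Un_disjoint) (auto simp: D_def)
      ultimately have "rank C u = 2 + rank D u" unfolding rank_def using xy by simp
      then show "k1 u = (if even (rank D u) then Dn else Up)"
        using less.prems(3)[OF u'(1)] u' unfolding k1_def by simp
    qed
    moreover have "flip D k1 = flip C \<kappa>"
      unfolding flip_def D_def k1_def using kx ky xy x y by (auto simp: fun_eq_iff)
    ultimately show ?thesis using b1 bruhat_le_trans by metis
  qed
qed

section \<open>Orientations of a pair of closed diagrams\<close>

locale two_cupd =
  fixes N :: int and a d :: cupd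
  assumes a: "closed_cupd N a" and d: "closed_cupd N d"
begin

abbreviation "V \<equiv> verts N"
abbreviation "cc \<equiv> circle N a d"

lemma circle_self [simp]: "v \<in> cc v"
  unfolding circle_def by simp

lemma circle_eq: "w \<in> cc v \<Longrightarrow> cc w = cc v"
  unfolding circle_def by (rule orb_eq[OF invol_mate[OF a] invol_mate[OF d]])

lemma circle_closed:
  assumes "v \<in> V" "x \<in> cc v"
  shows "x \<in> V" "mate a x \<in> cc v" "mate d x \<in> cc v"
  using orb_closed[OF invol_mate[OF a] invol_mate[OF d] assms(1)] assms(2) unfolding circle_def by auto

lemma circle_mate: "v \<in> V \<Longrightarrow> cc (mate a v) = cc v" "v \<in> V \<Longrightarrow> cc (mate d v) = cc v"
  using circle_closed[of v v] circle_eq by auto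

lemma circlesE:
  assumes "C \<in> circles N a d"
  obtains v where "v \<in> V" "C = cc v"
  using assms unfolding circles_def by auto

lemma circles_props:
  assumes "C \<in> circles N a d"
  shows "finite C" "C \<noteq> {}" "C \<subseteq> V" "Min C \<in> C" "Min C \<in> V" "\<And>v. v \<in> C \<Longrightarrow> cc v = C"
    "\<And>x. x \<in> C \<Longrightarrow> mate a x \<in> C" "\<And>x. x \<in> C \<Longrightarrow> mate d x \<in> C"
proof -
  obtain v where v: "v \<in> V" "C = cc v" using assms circlesE by blast
  show CV: "C \<subseteq> V" using circle_closed v by auto
  then show f: "finite C" by (rule finite_subset) simp
  show ne: "C \<noteq> {}" using v circle_self[of v] by blast
  then show "Min C \<in> C" using f by simp
  then show "Min C \<in> V" using CV by auto
  show "\<And>v. v \<in> C \<Longrightarrow> cc v = C" using circle_eq v by auto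
  show "\<And>x. x \<in> C \<Longrightarrow> mate a x \<in> C" "\<And>x. x \<in> C \<Longrightarrow> mate d x \<in> C" using circle_closed v by auto
qed

lemma circle_in: "v \<in> V \<Longrightarrow> cc v \<in> circles N a d"
  unfolding circles_def by auto

lemma circles_disjoint:
  assumes "C \<in> circles N a d" "C' \<in> circles N a d" "v \<in> C" "v \<in> C'"
  shows "C = C'"
  using assms circles_props(6) by metis

lemma noncrossing_circle:
  assumes "C \<in> circles N a d"
  shows "noncrossing C (mate a)" "noncrossing C (mate d)"
  using noncrossing_subset[OF noncrossing_mate[OF a]] noncrossing_subset[OF noncrossing_mate[OF d]]
    circles_props[OF assms] by auto

text \<open>Two colourings that both change along every arc differ by a constant on each circle, and
  the parity of the rank inside the circle is such a colouring.\<close>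

lemma flips_circle:
  assumes "C \<in> circles N a d" "flips V (mate a) c1" "flips V (mate d) c1" "v \<in> C" "w \<in> C"
  shows "(c1 w \<longleftrightarrow> even (rank C w)) \<longleftrightarrow> (c1 v \<longleftrightarrow> even (rank C v))"
proof -
  note p = circles_props[OF assms(1)]
  have f: "flips C (mate a) c1" "flips C (mate d) c1" using assms(2,3) p(3) unfolding flips_def by auto
  note r = rank_flips[OF p(1) noncrossing_circle(1)[OF assms(1)]] rank_flips[OF p(1) noncrossing_circle(2)[OF assms(1)]]
  let ?A = "{w\<in>C. (c1 w \<longleftrightarrow> even (rank C w)) \<longleftrightarrow> (c1 v \<longleftrightarrow> even (rank C v))}"
  have "orb V (mate a) (mate d) v \<subseteq> ?A"
    by (rule orb_least) (use assms f r p in \<open>auto simp: flips_def\<close>)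
  then show ?thesis using p(6)[OF assms(4)] assms(5) unfolding circle_def by auto
qed

lemma circle_labels:
  assumes "C \<in> circles N a d" "\<kappa> \<in> Or N a" "\<kappa> \<in> Or N d" "v \<in> C"
  shows "\<kappa> v = Up \<longleftrightarrow> (\<kappa> (Min C) = Up \<longleftrightarrow> even (rank C v))"
  using flips_circle[OF assms(1) OrD(3)[OF a assms(2)] OrD(3)[OF d assms(3)] circles_props(4)[OF assms(1)] assms(4)]
    rank_Min[OF circles_props(1)[OF assms(1)]] by auto

lemma parity_rank:
  assumes "C \<in> circles N a d" "v \<in> C"
  shows "even (rank C v) \<longleftrightarrow> (even v \<longleftrightarrow> even (Min C))"
  using flips_circle[OF assms(1) parity_flips[OF a] parity_flips[OF d] circles_props(4)[OF assms(1)] assms(2)]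
    rank_Min[OF circles_props(1)[OF assms(1)]] by auto

lemma cw_inj:
  assumes "\<kappa> \<in> Or N a" "\<kappa> \<in> Or N d" "\<nu> \<in> Or N a" "\<nu> \<in> Or N d" "cw N a d \<kappa> = cw N a d \<nu>"
  shows "\<kappa> = \<nu>"
proof
  fix v
  show "\<kappa> v = \<nu> v"
  proof (cases "v \<in> V")
    case True
    let ?C = "cc v"
    have C: "?C \<in> circles N a d" using circle_in True by auto
    have "\<kappa> (Min ?C) = Up \<longleftrightarrow> \<nu> (Min ?C) = Up" using assms(5) C unfolding cw_def by auto
    then have "\<kappa> v = Up \<longleftrightarrow> \<nu> v = Up"
      using circle_labels[OF C _ _ circle_self] assms by auto
    then show ?thesis using OrD(2)[OF a] assms True by metis
  next
    case False
    then show ?thesis using OrD(1)[OF a assms(1) False] OrD(1)[OF a assms(3) False] by simp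
  qed
qed

lemma Or_exists:
  assumes "S \<subseteq> circles N a d"
  obtains \<nu> where "\<nu> \<in> Or N a" "\<nu> \<in> Or N d" "cw N a d \<nu> = S"
proof -
  \<comment> \<open>Vertex parity changes along every arc, so comparing it with the parity of the
    leftmost vertex of the circle gives a consistent labelling, with the orientation of each circle
    free to choose.\<close>
  define \<nu> where "\<nu> v = (if v \<notin> V then Circ else if (cc v \<in> S) = (even v \<longleftrightarrow> even (Min (cc v))) then Up else Dn)" for v
  have up: "\<nu> v = Up \<longleftrightarrow> (cc v \<in> S) = (even v \<longleftrightarrow> even (Min (cc v)))" if "v \<in> V" for v
    using that unfolding \<nu>_def by auto
  have "flips V (mate a) (\<lambda>k. \<nu> k = Up)" "flips V (mate d) (\<lambda>k. \<nu> k = Up)"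
    unfolding flips_def using up mate_verts[OF a] mate_verts[OF d] circle_mate
      parity_flips[OF a] parity_flips[OF d] unfolding flips_def by auto
  then have "\<nu> \<in> Or N a" "\<nu> \<in> Or N d" unfolding Or_iff[OF a] Or_iff[OF d] by (auto simp: \<nu>_def)
  moreover have "cw N a d \<nu> = S"
  proof -
    have "\<nu> (Min C) = Up \<longleftrightarrow> C \<in> S" if "C \<in> circles N a d" for C
      using up[of "Min C"] circles_props[OF that] by auto
    then show ?thesis unfolding cw_def using assms by auto
  qed
  ultimately show thesis using that by blast
qed

text \<open>The labels alternate along a circle read from left to right, so turning an anticlockwise circle
  into a clockwise one only moves labels \<open>\<or>\<close> to the right.\<close>

lemma cw_mono_bruhat:
  assumes "\<nu> \<in> Or N a" "\<nu> \<in> Or N d" "\<kappa> \<in> Or N a" "\<kappa> \<in> Or N d" "cw N a d \<nu> \<subseteq> cw N a d \<kappa>"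
  shows "bruhat_le \<nu> \<kappa>"
  using assms
proof (induction "card (cw N a d \<kappa> - cw N a d \<nu>)" arbitrary: \<nu>)
  case 0
  then have "cw N a d \<nu> = cw N a d \<kappa>" by auto
  then show ?case using 0 cw_inj bruhat_le_refl by metis
next
  case (Suc n)
  then have "cw N a d \<kappa> - cw N a d \<nu> \<noteq> {}" by (metis card.empty nat.distinct(1))
  then obtain C where C: "C \<in> cw N a d \<kappa>" "C \<notin> cw N a d \<nu>" by auto
  then have CC: "C \<in> circles N a d" unfolding cw_def by auto
  then have mD: "\<nu> (Min C) \<noteq> Up" using C unfolding cw_def by auto
  note p = circles_props[OF CC]
  define n1 where "n1 = flip C \<nu>"
  have "bruhat_le \<nu> n1" unfolding n1_def
  proof (rule bruhat_le_flip[OF p(1)])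
    show "even (card C)"
      using even_card_invol[OF p(1), of "mate a"] noncrossing_circle(1)[OF CC] unfolding noncrossing_def by auto
    show "\<nu> u = (if even (rank C u) then Dn else Up)" if "u \<in> C" for u
      using circle_labels[OF CC Suc.prems(1,2) that] mD OrD(2)[OF a Suc.prems(1), of u] p(3) that by auto
  qed
  moreover have n1: "n1 v = Up \<longleftrightarrow> (if v \<in> C then \<nu> v = Dn else \<nu> v = Up)" for v
    unfolding n1_def flip_def by auto
  have memC: "mate a v \<in> C \<longleftrightarrow> v \<in> C" "mate d v \<in> C \<longleftrightarrow> v \<in> C" if "v \<in> V" for v
    using p(7)[of v] p(8)[of v] p(7)[of "mate a v"] p(8)[of "mate d v"] unfolding mate_mate[OF a that] mate_mate[OF d that] by blast+
  have dn: "\<nu> v = Dn \<longleftrightarrow> \<nu> v \<noteq> Up" if "v \<in> V" for v using OrD(2)[OF a Suc.prems(1) that] by auto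
  have "n1 \<in> Or N a \<and> n1 \<in> Or N d"
    unfolding Or_iff[OF a] Or_iff[OF d]
  proof (intro conjI allI impI ballI)
    show "n1 k = Circ" if "k \<notin> V" for k using OrD(1)[OF a Suc.prems(1) that] that p(3) unfolding n1_def flip_def by auto
    then show "n1 k = Circ" if "k \<notin> V" for k using that by auto
    show "n1 k \<in> {Dn, Up}" if "k \<in> V" for k using OrD(2)[OF a Suc.prems(1) that] unfolding n1_def flip_def by auto
    then show "n1 k \<in> {Dn, Up}" if "k \<in> V" for k using that by auto
    show "flips V (mate a) (\<lambda>k. n1 k = Up)" "flips V (mate d) (\<lambda>k. n1 k = Up)"
      unfolding flips_def n1 using memC OrD(3)[OF a Suc.prems(1)] OrD(3)[OF d Suc.prems(2)] dn
        mate_verts[OF a] mate_verts[OF d] unfolding flips_def by auto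
  qed
  moreover have cwn1: "cw N a d n1 = insert C (cw N a d \<nu>)"
  proof -
    have "n1 (Min C') = Up \<longleftrightarrow> C' = C \<or> \<nu> (Min C') = Up" if "C' \<in> circles N a d" for C'
    proof (cases "C' = C")
      case True
      then show ?thesis using n1 p(4,5) mD dn by auto
    next
      case False
      then have "Min C' \<notin> C" using circles_disjoint[OF that CC circles_props(4)[OF that]] by auto
      then show ?thesis using n1 False by auto
    qed
    then show ?thesis unfolding cw_def using CC by auto
  qed
  moreover have "n = card (cw N a d \<kappa> - cw N a d n1)"
  proof -
    have "cw N a d \<kappa> - cw N a d \<nu> = insert C (cw N a d \<kappa> - cw N a d n1)" using cwn1 C by auto
    moreover have "C \<notin> cw N a d \<kappa> - cw N a d n1" using cwn1 by auto
    ultimately show ?thesis using Suc.hyps(2) by simp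
  qed
  moreover have "cw N a d n1 \<subseteq> cw N a d \<kappa>" using cwn1 C(1) Suc.prems(5) by simp
  ultimately show ?case using Suc.hyps(1)[of n1] Suc.prems(3,4) bruhat_le_trans[of \<nu> n1 \<kappa>] by simp
qed

end

section \<open>The deformed basis\<close>

text \<open>Orientations are encoded as points: along every arc the label and the parity of the vertex both
  flip, so \<open>pt\<close> is constant on circles.\<close>

definition pt :: "weight \<Rightarrow> int \<Rightarrow> bool" where
  "pt \<kappa> v \<longleftrightarrow> (\<kappa> v = Up \<longleftrightarrow> even v)"

text \<open>On an anticlockwise circle \<open>pt\<close> is the oddness of the leftmost vertex. The
  subtracted value is therefore t for odd \<open>Min C\<close> and 0 for even \<open>Min C\<close>,
  which leaves - t or t at a clockwise circle.\<close>

definition cw_factor :: "int \<Rightarrow> weight \<Rightarrow> int set \<Rightarrow> int" where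
  "cw_factor t \<kappa> C = (if \<kappa> (Min C) = Up then (if even (Min C) then t else - t) else 0)"

text \<open>The deformed basis vector of the oriented circle diagram \<open>a \<nu> d\<close>, as a function of the points
  \<open>\<kappa>\<close>: every clockwise circle contributes \<open>x - e\<close> with \<open>x \<in> {0, t}\<close> and \<open>e\<close> the value of \<open>x\<close> at the
  anticlockwise orientation.\<close>

definition dbasis :: "int \<Rightarrow> int \<Rightarrow> cupd \<Rightarrow> cupd \<Rightarrow> weight \<Rightarrow> weight \<Rightarrow> int" where
  "dbasis t N a d \<nu> \<kappa> = (\<Prod>C\<in>cw N a d \<nu>. cw_factor t \<kappa> C)"

definition Ors :: "int \<Rightarrow> cupd \<Rightarrow> cupd \<Rightarrow> weight set" where
  "Ors N a d = Or N a \<inter> Or N d"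

text \<open>The Boolean \<sigma> is the common value of \<open>pt\<close> on a circle. This and the
  following counts are split by it, since value True leads to powers of t and value False to powers
  of - t.\<close>

definition sign_verts :: "int \<Rightarrow> weight \<Rightarrow> bool \<Rightarrow> int set" where
  "sign_verts N \<kappa> \<sigma> = {v \<in> verts N. pt \<kappa> v = \<sigma>}"

definition num_circles :: "int \<Rightarrow> cupd \<Rightarrow> cupd \<Rightarrow> weight \<Rightarrow> bool \<Rightarrow> nat" where
  "num_circles N a d \<kappa> \<sigma> = card {C \<in> circles N a d. pt \<kappa> (Min C) = \<sigma>}"

definition num_cw :: "int \<Rightarrow> cupd \<Rightarrow> cupd \<Rightarrow> weight \<Rightarrow> bool \<Rightarrow> nat" where
  "num_cw N a d \<kappa> \<sigma> = card {C \<in> cw N a d \<kappa>. pt \<kappa> (Min C) = \<sigma>}"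

definition cw_arcs :: "int \<Rightarrow> cupd \<Rightarrow> weight \<Rightarrow> bool \<Rightarrow> nat" where
  "cw_arcs N a \<kappa> \<sigma> = card {x \<in> sign_verts N \<kappa> \<sigma>. x < mate a x \<and> \<kappa> x = Up}"

lemma Ors_commute: "Ors N a d = Ors N d a"
  unfolding Ors_def by auto

lemma dbasis_commute: "dbasis t N a d = dbasis t N d a"
  unfolding dbasis_def by (simp add: cw_commute[of N a] fun_eq_iff)

lemma num_circles_commute: "num_circles N a d = num_circles N d a"
  unfolding num_circles_def by (simp add: circles_commute[of N a] fun_eq_iff)

lemma pt_flip:
  assumes "closed_cupd N a" "\<kappa> \<in> Or N a" "v \<in> verts N"
  shows "pt \<kappa> (mate a v) = pt \<kappa> v"
  using OrD(3)[OF assms(1,2)] parity_flips[OF assms(1)] assms(3) unfolding flips_def pt_def by auto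

lemma sum_eq_single:
  assumes "finite A" "x \<in> A" "\<And>y. y \<in> A \<Longrightarrow> y \<noteq> x \<Longrightarrow> f y = 0"
  shows "sum f A = f x"
proof -
  have "sum f A = f x + sum f (A - {x})" using assms by (simp add: sum.remove)
  also have "sum f (A - {x}) = 0" using assms by (intro sum.neutral) auto
  finally show ?thesis by simp
qed

section \<open>Triangularity and clockwise counts\<close>

context two_cupd
begin

lemma finite_Ors [simp]: "finite (Ors N a d)"
proof (rule inj_on_finite[of "cw N a d" _ "Pow (circles N a d)"])
  show "inj_on (cw N a d) (Ors N a d)"
    unfolding Ors_def by (intro inj_onI) (auto intro: cw_inj)
qed (auto simp: cw_def)

text \<open>This is the triangularity of the deformed basis: it gives independence, and through
  \<open>cw_mono_bruhat\<close> it ties supports to the Bruhat order.\<close>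

lemma dbasis_nonzero: "t \<noteq> 0 \<Longrightarrow> dbasis t N a d \<nu> \<kappa> \<noteq> 0 \<longleftrightarrow> cw N a d \<nu> \<subseteq> cw N a d \<kappa>"
  unfolding dbasis_def cw_factor_def by (auto simp: cw_def split: if_splits)

text \<open>Among the indices with nonzero coefficient whose clockwise circles are contained in
  those of \<nu>, take one with the fewest clockwise circles. At that point no other basis vector of
  the expansion contributes.\<close>

lemma expansion_support:
  assumes "t \<noteq> 0" "\<nu> \<in> Ors N a d" "c \<nu> \<noteq> 0"
  obtains \<kappa> where "\<kappa> \<in> Ors N a d" "(\<Sum>\<mu>\<in>Ors N a d. c \<mu> * dbasis t N a d \<mu> \<kappa>) \<noteq> 0" "cw N a d \<kappa> \<subseteq> cw N a d \<nu>"
proof -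
  define A where "A = {\<mu> \<in> Ors N a d. c \<mu> \<noteq> 0 \<and> cw N a d \<mu> \<subseteq> cw N a d \<nu>}"
  have "\<nu> \<in> A" unfolding A_def using assms by auto
  then obtain \<kappa> where k: "\<kappa> \<in> A" and least: "\<And>\<mu>. \<mu> \<in> A \<Longrightarrow> card (cw N a d \<kappa>) \<le> card (cw N a d \<mu>)"
    using ex_has_least_nat[of "\<lambda>x. x \<in> A" \<nu> "\<lambda>\<mu>. card (cw N a d \<mu>)"] by blast
  have kO: "\<kappa> \<in> Ors N a d" using k A_def by auto
  have "(\<Sum>\<mu>\<in>Ors N a d. c \<mu> * dbasis t N a d \<mu> \<kappa>) = c \<kappa> * dbasis t N a d \<kappa> \<kappa>"
  proof (rule sum_eq_single[OF finite_Ors kO])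
    fix \<mu> assume m: "\<mu> \<in> Ors N a d" "\<mu> \<noteq> \<kappa>"
    show "c \<mu> * dbasis t N a d \<mu> \<kappa> = 0"
    proof (rule ccontr)
      assume "c \<mu> * dbasis t N a d \<mu> \<kappa> \<noteq> 0"
      then have n: "c \<mu> \<noteq> 0" "cw N a d \<mu> \<subseteq> cw N a d \<kappa>" using dbasis_nonzero[OF assms(1)] by auto
      then have "\<mu> \<in> A" using m k unfolding A_def by auto
      then have "cw N a d \<mu> = cw N a d \<kappa>" using least[of \<mu>] n(2) by (intro card_seteq) auto
      then show False using cw_inj[of \<mu> \<kappa>] m kO unfolding Ors_def by auto
    qed
  qed
  also have "\<dots> \<noteq> 0" using dbasis_nonzero[OF assms(1), of \<kappa> \<kappa>] k unfolding A_def by auto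
  finally show thesis using that kO k unfolding A_def by auto
qed

lemma expansion_unique:
  assumes "t \<noteq> 0" "\<nu> \<in> Ors N a d"
    "\<And>\<kappa>. \<kappa> \<in> Ors N a d \<Longrightarrow> (\<Sum>\<mu>\<in>Ors N a d. c \<mu> * dbasis t N a d \<mu> \<kappa>) = (\<Sum>\<mu>\<in>Ors N a d. c' \<mu> * dbasis t N a d \<mu> \<kappa>)"
  shows "c \<nu> = c' \<nu>"
proof (rule ccontr)
  assume "c \<nu> \<noteq> c' \<nu>"
  then have "c \<nu> - c' \<nu> \<noteq> 0" by simp
  from expansion_support[OF assms(1,2), of "\<lambda>\<mu>. c \<mu> - c' \<mu>", OF this]
  obtain \<kappa> where "\<kappa> \<in> Ors N a d" "(\<Sum>\<mu>\<in>Ors N a d. (c \<mu> - c' \<mu>) * dbasis t N a d \<mu> \<kappa>) \<noteq> 0" by metis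
  then show False using assms(3)[of \<kappa>] by (simp add: left_diff_distrib sum_subtractf)
qed

lemma pt_circle:
  assumes "\<kappa> \<in> Ors N a d" "C \<in> circles N a d" "v \<in> C"
  shows "pt \<kappa> v = pt \<kappa> (Min C)"
  using circle_labels[of C \<kappa> v] parity_rank[OF assms(2,3)] assms unfolding pt_def Ors_def by auto

lemma sign_verts_circles:
  assumes "\<kappa> \<in> Ors N a d"
  shows "sign_verts N \<kappa> \<sigma> = \<Union> {C \<in> circles N a d. pt \<kappa> (Min C) = \<sigma>}"
proof (intro equalityI subsetI)
  fix v assume "v \<in> sign_verts N \<kappa> \<sigma>"
  then have v: "v \<in> V" "pt \<kappa> v = \<sigma>" unfolding sign_verts_def by auto
  then have "pt \<kappa> (Min (cc v)) = \<sigma>" using pt_circle[OF assms circle_in[OF v(1)] circle_self] by simp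
  then show "v \<in> \<Union> {C \<in> circles N a d. pt \<kappa> (Min C) = \<sigma>}" using circle_in[OF v(1)] circle_self by blast
next
  fix v assume "v \<in> \<Union> {C \<in> circles N a d. pt \<kappa> (Min C) = \<sigma>}"
  then obtain C where "C \<in> circles N a d" "pt \<kappa> (Min C) = \<sigma>" "v \<in> C" by auto
  then show "v \<in> sign_verts N \<kappa> \<sigma>" unfolding sign_verts_def using pt_circle[OF assms] circles_props(3) by auto
qed

lemma card_sign_verts_circles:
  assumes "\<kappa> \<in> Ors N a d"
  shows "card {v \<in> sign_verts N \<kappa> \<sigma>. P v} = (\<Sum>C | C \<in> circles N a d \<and> pt \<kappa> (Min C) = \<sigma>. card {v \<in> C. P v})"
proof -
  have "{v \<in> sign_verts N \<kappa> \<sigma>. P v} = (\<Union>C \<in> {C \<in> circles N a d. pt \<kappa> (Min C) = \<sigma>}. {v \<in> C. P v})"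
    unfolding sign_verts_circles[OF assms] by auto
  also have "card \<dots> = (\<Sum>C | C \<in> circles N a d \<and> pt \<kappa> (Min C) = \<sigma>. card {v \<in> C. P v})"
  proof (rule card_UN_disjoint)
    show "\<forall>C\<in>{C \<in> circles N a d. pt \<kappa> (Min C) = \<sigma>}. finite {v \<in> C. P v}"
      using circles_props(1) by auto
    show "\<forall>C\<in>{C \<in> circles N a d. pt \<kappa> (Min C) = \<sigma>}. \<forall>C'\<in>{C \<in> circles N a d. pt \<kappa> (Min C) = \<sigma>}.
        C \<noteq> C' \<longrightarrow> {v \<in> C. P v} \<inter> {v \<in> C'. P v} = {}"
      using circles_disjoint by auto
  qed simp
  finally show ?thesis .
qed

lemma degree_circle:
  assumes "\<kappa> \<in> Ors N a d" "C \<in> circles N a d"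
  shows "2 * (card {x\<in>C. x < mate a x \<and> \<kappa> x = Up} + card {x\<in>C. x < mate d x \<and> \<kappa> x = Up}) + 2
    = card C + (if \<kappa> (Min C) = Up then 4 else 0)"
proof (rule clockwise_arcs_circle)
  note p = circles_props[OF assms(2)]
  show "finite C" "C \<noteq> {}" using p by auto
  show "noncrossing C (mate a)" "noncrossing C (mate d)" using noncrossing_circle[OF assms(2)] by auto
  show "flips C (mate a) (\<lambda>x. \<kappa> x = Up)" "flips C (mate d) (\<lambda>x. \<kappa> x = Up)"
    using OrD(3)[OF a, of \<kappa>] OrD(3)[OF d, of \<kappa>] assms p(3) unfolding Ors_def flips_def by auto
  fix U assume U: "U \<subseteq> C" "U \<noteq> {}" "\<And>x. x \<in> U \<Longrightarrow> mate a x \<in> U \<and> mate d x \<in> U"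
  then obtain v where v: "v \<in> U" by auto
  have "cc v \<subseteq> U" unfolding circle_def using U(3) v by (intro orb_least) auto
  then show "U = C" using p(6)[of v] v U(1) by auto
qed

text \<open>The turning number identity, summed over the circles with value \<sigma>. Apart from
  circle counts, a and d enter through separate arc counts \<open>cw_arcs\<close>, and these cancel
  when different outer diagrams are compared.\<close>

lemma degree_formula:
  assumes "\<kappa> \<in> Ors N a d"
  shows "2 * (cw_arcs N a \<kappa> \<sigma> + cw_arcs N d \<kappa> \<sigma>) + 2 * num_circles N a d \<kappa> \<sigma> = card (sign_verts N \<kappa> \<sigma>) + 4 * num_cw N a d \<kappa> \<sigma>"
proof -
  let ?K = "{C. C \<in> circles N a d \<and> pt \<kappa> (Min C) = \<sigma>}"
  have fK: "finite ?K" by simp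
  have "(\<Sum>C\<in>?K. 2 * (card {x\<in>C. x < mate a x \<and> \<kappa> x = Up} + card {x\<in>C. x < mate d x \<and> \<kappa> x = Up}) + 2)
      = (\<Sum>C\<in>?K. card {x\<in>C. True} + (if \<kappa> (Min C) = Up then 4 else 0))"
    using degree_circle[OF assms] by (intro sum.cong) auto
  moreover have "(\<Sum>C\<in>?K. 2 * (card {x\<in>C. x < mate a x \<and> \<kappa> x = Up} + card {x\<in>C. x < mate d x \<and> \<kappa> x = Up}) + 2)
      = 2 * (cw_arcs N a \<kappa> \<sigma> + cw_arcs N d \<kappa> \<sigma>) + 2 * num_circles N a d \<kappa> \<sigma>"
    unfolding cw_arcs_def card_sign_verts_circles[OF assms] num_circles_def
    by (simp add: sum.distrib sum_distrib_left distrib_left del: add_2_eq_Suc add_2_eq_Suc')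
  moreover have "(\<Sum>C\<in>?K. (if \<kappa> (Min C) = Up then 4 else 0)) = 4 * num_cw N a d \<kappa> \<sigma>"
  proof -
    have "(\<Sum>C\<in>?K. (if \<kappa> (Min C) = Up then 4 else 0::nat)) = (\<Sum>C\<in>{C\<in>?K. \<kappa> (Min C) = Up}. 4)"
      by (rule sum.inter_filter[OF fK, symmetric])
    moreover have "{C\<in>?K. \<kappa> (Min C) = Up} = {C \<in> cw N a d \<kappa>. pt \<kappa> (Min C) = \<sigma>}"
      unfolding cw_def by auto
    ultimately show ?thesis unfolding num_cw_def by simp
  qed
  moreover have "(\<Sum>C\<in>?K. card {x\<in>C. True}) = card (sign_verts N \<kappa> \<sigma>)"
    using card_sign_verts_circles[OF assms, of \<sigma> "\<lambda>_. True"] by simp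
  ultimately show ?thesis by (simp add: sum.distrib)
qed

lemma dbasis_diag:
  "dbasis t N a d \<kappa> \<kappa> = t ^ num_cw N a d \<kappa> True * (- t) ^ num_cw N a d \<kappa> False"
proof -
  let ?T = "{C \<in> cw N a d \<kappa>. pt \<kappa> (Min C) = True}" and ?F = "{C \<in> cw N a d \<kappa>. pt \<kappa> (Min C) = False}"
  have u: "cw N a d \<kappa> = ?T \<union> ?F" by auto
  have "dbasis t N a d \<kappa> \<kappa> = (\<Prod>C\<in>?T. cw_factor t \<kappa> C) * (\<Prod>C\<in>?F. cw_factor t \<kappa> C)"
    unfolding dbasis_def by (subst u, rule prod.union_disjoint) auto
  moreover have "(\<Prod>C\<in>?T. cw_factor t \<kappa> C) = (\<Prod>C\<in>?T. t)" "(\<Prod>C\<in>?F. cw_factor t \<kappa> C) = (\<Prod>C\<in>?F. - t)"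
    by (intro prod.cong; auto simp: cw_factor_def pt_def cw_def)+
  ultimately show ?thesis unfolding num_cw_def by simp
qed

lemma norb_num_circles:
  assumes "\<kappa> \<in> Ors N a d"
  shows "norb V (mate a) (mate d) (sign_verts N \<kappa> \<sigma>) = num_circles N a d \<kappa> \<sigma>"
proof -
  have "cc ` sign_verts N \<kappa> \<sigma> = {C \<in> circles N a d. pt \<kappa> (Min C) = \<sigma>}"
  proof (intro equalityI subsetI)
    fix C assume "C \<in> cc ` sign_verts N \<kappa> \<sigma>"
    then obtain v where v: "v \<in> V" "pt \<kappa> v = \<sigma>" "C = cc v" unfolding sign_verts_def by auto
    then show "C \<in> {C \<in> circles N a d. pt \<kappa> (Min C) = \<sigma>}"
      using pt_circle[OF assms circle_in[OF v(1)] circle_self] circle_in[OF v(1)] by simp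
  next
    fix C assume "C \<in> {C \<in> circles N a d. pt \<kappa> (Min C) = \<sigma>}"
    then have "C = cc (Min C)" "Min C \<in> sign_verts N \<kappa> \<sigma>" using circles_props unfolding sign_verts_def by auto
    then show "C \<in> cc ` sign_verts N \<kappa> \<sigma>" by blast
  qed
  then show ?thesis unfolding norb_def num_circles_def circle_def by simp
qed

end

section \<open>Surgery\<close>

lemma norb_add_orb:
  assumes "finite W" "invol_on W f" "invol_on W g" "A \<subseteq> W" "v \<in> W"
    "\<And>x. x \<in> A \<Longrightarrow> f x \<in> A" "\<And>x. x \<in> A \<Longrightarrow> g x \<in> A" "v \<notin> A"
  shows "norb W f g (A \<union> orb W f g v) = norb W f g A + 1"
proof -
  have "orb W f g ` orb W f g v = {orb W f g v}"
  proof -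
    have "orb W f g ` orb W f g v = (\<lambda>_. orb W f g v) ` orb W f g v"
      using orb_eq[OF assms(2,3)] by (rule image_cong[OF refl])
    then show ?thesis using image_constant[OF orb_self[of v W f g]] by simp
  qed
  then have "orb W f g ` (A \<union> orb W f g v) = insert (orb W f g v) (orb W f g ` A)" by auto
  moreover have "orb W f g v \<notin> orb W f g ` A"
  proof
    assume "orb W f g v \<in> orb W f g ` A"
    then obtain x where x: "x \<in> A" "orb W f g v = orb W f g x" by auto
    then have "v \<in> orb W f g x" using orb_self by metis
    moreover have "orb W f g x \<subseteq> A" using assms x by (intro orb_subset_closed) auto
    ultimately show False using assms by auto
  qed
  moreover have "finite A" using finite_subset[OF assms(4,1)] .
  ultimately show ?thesis unfolding norb_def by simp
qed

text \<open>Congruence to 0 modulo t within the integral span of the \<open>B i\<close>, for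
  functions on \<open>P\<close>. Divisibility of the values alone would be too weak: a congruence of
  coefficients needs the quotient by t to be an integral combination too.\<close>

definition multiple_span :: "int \<Rightarrow> 'i set \<Rightarrow> ('i \<Rightarrow> 'p \<Rightarrow> int) \<Rightarrow> 'p set \<Rightarrow> ('p \<Rightarrow> int) \<Rightarrow> bool" where
  "multiple_span t I B P F \<longleftrightarrow> (\<exists>h. \<forall>x\<in>P. F x = t * (\<Sum>i\<in>I. h i * B i x))"

lemma multiple_span_cong:
  "multiple_span t I B P F \<Longrightarrow> (\<And>x. x \<in> P \<Longrightarrow> G x = F x) \<Longrightarrow> multiple_span t I B P G"
  unfolding multiple_span_def by auto

lemma multiple_span_0: "multiple_span t I B P (\<lambda>_. 0)"
  unfolding multiple_span_def by (intro exI[of _ "\<lambda>_. 0"]) simp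

lemma multiple_span_add:
  assumes "multiple_span t I B P F" "multiple_span t I B P G"
  shows "multiple_span t I B P (\<lambda>x. F x + G x)"
proof -
  obtain h h' where "\<forall>x\<in>P. F x = t * (\<Sum>i\<in>I. h i * B i x)" "\<forall>x\<in>P. G x = t * (\<Sum>i\<in>I. h' i * B i x)"
    using assms unfolding multiple_span_def by auto
  then show ?thesis unfolding multiple_span_def
    by (intro exI[of _ "\<lambda>i. h i + h' i"]) (simp add: distrib_right sum.distrib distrib_left)
qed

lemma multiple_span_scale:
  assumes "multiple_span t I B P F"
  shows "multiple_span t I B P (\<lambda>x. k * F x)"
proof -
  obtain h where "\<forall>x\<in>P. F x = t * (\<Sum>i\<in>I. h i * B i x)" using assms unfolding multiple_span_def by auto
  then show ?thesis unfolding multiple_span_def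
    by (intro exI[of _ "\<lambda>i. k * h i"]) (simp add: sum_distrib_left mult.left_commute mult.assoc)
qed

lemma multiple_span_basis:
  "finite I \<Longrightarrow> j \<in> I \<Longrightarrow> multiple_span t I B P (\<lambda>x. t * B j x)"
  unfolding multiple_span_def
  by (intro exI[of _ "\<lambda>i. if i = j then 1 else 0"])
    (simp add: if_distrib[of "\<lambda>x. x * _"] sum.delta cong: if_cong)

lemma multiple_span_sum:
  assumes "finite A" "\<And>y. y \<in> A \<Longrightarrow> multiple_span t I B P (F y)"
  shows "multiple_span t I B P (\<lambda>x. \<Sum>y\<in>A. F y x)"
  using assms by (induction A rule: finite_induct) (auto intro: multiple_span_0 multiple_span_add)

section \<open>Surgery on two copies of the vertices\<close>

locale triple =
  fixes N :: int and a c d :: cupd and t :: int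
  assumes a: "closed_cupd N a" and c: "closed_cupd N c" and d: "closed_cupd N d"
begin

definition W :: "vert set" where "W = UNIV \<times> verts N"

definition outer :: "vert \<Rightarrow> vert" where
  "outer v = (fst v, mate (if fst v then d else a) (snd v))"

definition endp :: "(int \<times> int) set \<Rightarrow> int \<Rightarrow> bool" where
  "endp D k \<longleftrightarrow> (\<exists>(x,y)\<in>D. k = x \<or> k = y)"

definition middle :: "(int \<times> int) set \<Rightarrow> vert \<Rightarrow> vert" where
  "middle D v = (if endp D (snd v) then (\<not> fst v, snd v) else (fst v, mate c (snd v)))"

text \<open>The parity is reversed on one of the two copies, so that the vertical strands created by
  surgery change the colour as arcs do.\<close>

definition col :: "vert \<Rightarrow> bool" where
  "col v \<longleftrightarrow> (fst v \<longleftrightarrow> odd (snd v))"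

abbreviation "orbD D \<equiv> orb W outer (middle D)"

lemma finite_W: "finite W" unfolding W_def by simp

lemma W_iff: "v \<in> W \<longleftrightarrow> snd v \<in> verts N" unfolding W_def by (cases v) auto

lemma invol_outer: "invol_on W outer"
  unfolding invol_on_def outer_def using mate_verts[OF a] mate_verts[OF d] mate_mate[OF a] mate_mate[OF d] by (auto simp: W_iff)

lemma endp_mate:
  assumes "D \<subseteq> cups c" "k \<in> verts N" shows "endp D (mate c k) \<longleftrightarrow> endp D k"
proof -
  have *: "endp D (mate c k)" if e: "endp D k" and k: "k \<in> verts N" for k
  proof -
    obtain x y where xy: "(x, y) \<in> D" "k = x \<or> k = y" using e unfolding endp_def by auto
    then have "mate c k = y \<or> mate c k = x" using mate_cup[OF c] assms(1) by auto
    then show ?thesis unfolding endp_def using xy by auto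
  qed
  show ?thesis using *[of k] *[of "mate c k"] assms(2) mate_mate[OF c] mate_verts[OF c] by metis
qed

lemma invol_middle: "D \<subseteq> cups c \<Longrightarrow> invol_on W (middle D)"
  unfolding invol_on_def middle_def using mate_verts[OF c] mate_mate[OF c] endp_mate by (auto simp: W_iff)

lemma col_outer: "v \<in> W \<Longrightarrow> col (outer v) \<longleftrightarrow> \<not> col v"
  unfolding col_def outer_def W_iff using parity_flips[OF a] parity_flips[OF d] unfolding flips_def by auto

lemma col_middle: "v \<in> W \<Longrightarrow> col (middle D v) \<longleftrightarrow> \<not> col v"
  unfolding col_def middle_def W_iff using parity_flips[OF c] unfolding flips_def by auto

lemma endp_iff:
  assumes "D \<subseteq> cups c" "(i, j) \<in> cups c"
  shows "endp D i \<longleftrightarrow> (i, j) \<in> D" "endp D j \<longleftrightarrow> (i, j) \<in> D"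
proof -
  have *: "endp D k \<longleftrightarrow> (i, j) \<in> D" if k: "k = i \<or> k = j" for k
  proof
    assume "endp D k"
    then obtain x y where xy: "(x, y) \<in> D" "k = x \<or> k = y" unfolding endp_def by auto
    then have "{x, y} \<inter> {i, j} \<noteq> {}" using k by auto
    then have "x = i \<and> y = j" using cup_disjoint[OF c, of x y i j] xy assms by auto
    then show "(i, j) \<in> D" using xy by simp
  next
    assume "(i, j) \<in> D"
    then show "endp D k" unfolding endp_def using k by (intro bexI[of _ "(i, j)"]) auto
  qed
  show "endp D i \<longleftrightarrow> (i, j) \<in> D" "endp D j \<longleftrightarrow> (i, j) \<in> D" using * by auto
qed

text \<open>Replaces the edge sets in the definition of the product by two involutions, so that the
  general facts on components apply.\<close>

lemma srel_edges:
  assumes D: "D \<subseteq> cups c"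
  shows "srel a c d D \<union> (srel a c d D)\<inverse> = {(x, outer x) | x. x \<in> W} \<union> {(x, middle D x) | x. x \<in> W}" (is "?L = ?R")
proof (rule set_eqI)
  fix e :: "vert \<times> vert"
  obtain b k b' k' where e: "e = ((b, k), (b', k'))" by (metis surj_pair)
  have ab: "(k, k') \<in> cups x \<or> (k', k) \<in> cups x \<longleftrightarrow> k \<in> verts N \<and> k' = mate x k" if x: "closed_cupd N x" for x
  proof
    assume e: "(k, k') \<in> cups x \<or> (k', k) \<in> cups x"
    then show "k \<in> verts N \<and> k' = mate x k"
      using mate_eq[OF x e] cup_verts(1)[OF x, of k k'] cup_verts(2)[OF x, of k' k] by auto
  next
    assume "k \<in> verts N \<and> k' = mate x k"
    then show "(k, k') \<in> cups x \<or> (k', k) \<in> cups x" using mate_cups[OF x, of k] by simp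
  qed
  have D1: "(k, k') \<in> cups c - D \<or> (k', k) \<in> cups c - D \<longleftrightarrow> k \<in> verts N \<and> k' = mate c k \<and> \<not> endp D k"
    using ab[OF c] endp_iff[OF D, of k k'] endp_iff[OF D, of k' k] D by auto
  have D2: "(\<exists>j. (k, j) \<in> D \<or> (j, k) \<in> D) \<longleftrightarrow> endp D k" unfolding endp_def by auto
  have kD: "endp D k \<Longrightarrow> k \<in> verts N" unfolding endp_def using D cup_verts[OF c] by blast
  have "e \<in> ?L \<longleftrightarrow> (b = b' \<and> ((k, k') \<in> cups (if b then d else a) \<or> (k', k) \<in> cups (if b then d else a)))
      \<or> (b = b' \<and> ((k, k') \<in> cups c - D \<or> (k', k) \<in> cups c - D))
      \<or> (b \<noteq> b' \<and> k = k' \<and> (\<exists>j. (k, j) \<in> D \<or> (j, k) \<in> D))"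
    unfolding e srel_def by (cases b; cases b'; simp; blast)
  also have "\<dots> \<longleftrightarrow> (b = b' \<and> k \<in> verts N \<and> k' = mate (if b then d else a) k)
      \<or> (b = b' \<and> k \<in> verts N \<and> k' = mate c k \<and> \<not> endp D k)
      \<or> (b \<noteq> b' \<and> k = k' \<and> k \<in> verts N \<and> endp D k)"
    unfolding D1 D2 using ab[OF a] ab[OF d] kD by (cases b) auto
  also have "\<dots> \<longleftrightarrow> e \<in> ?R"
    unfolding e by (auto simp: W_iff outer_def middle_def)
  finally show "e \<in> ?L \<longleftrightarrow> e \<in> ?R" .
qed

lemma sconn_eq: "D \<subseteq> cups c \<Longrightarrow> sconn a c d D = conn W outer (middle D)"
  unfolding sconn_def conn_def by (simp add: srel_edges)

lemma scomp_eq: "D \<subseteq> cups c \<Longrightarrow> scomp a c d D v = orbD D v"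
  unfolding scomp_def orb_def by (simp add: sconn_eq)

text \<open>The second base point is \<open>(True, j)\<close> and not \<open>(True, i)\<close>,
  because \<open>surgery\<close> asks for p and r of equal colour.\<close>

lemma surgery_middle:
  assumes D: "D \<subseteq> cups c" and ij: "(i, j) \<in> cups c" "(i, j) \<notin> D"
  shows "surgery W outer (middle D) col (False, i) (False, j) (True, j) (True, i)"
    and "surgery.g' (middle D) (False, i) (False, j) (True, j) (True, i) = middle (insert (i, j) D)"
proof -
  have V: "i \<in> verts N" "j \<in> verts N" using cup_verts[OF c ij(1)] by auto
  have par: "even j \<longleftrightarrow> odd i" using parity_flips[OF c] V mate_cup[OF c ij(1)] unfolding flips_def by metis
  have g: "middle D (b, i) = (b, j)" "middle D (b, j) = (b, i)" for b
    unfolding middle_def using endp_iff[OF D ij(1)] ij(2) mate_cup[OF c ij(1)] by auto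
  show s: "surgery W outer (middle D) col (False, i) (False, j) (True, j) (True, i)"
    by unfold_locales
      (use finite_W invol_outer invol_middle[OF D] col_outer col_middle V g par in \<open>auto simp: W_iff col_def\<close>)
  interpret S: surgery W outer "middle D" col "(False, i)" "(False, j)" "(True, j)" "(True, i)" by (rule s)
  have "middle (insert (i, j) D) v = S.g' v" for v
  proof -
    obtain b k where v: "v = (b, k)" by (metis surj_pair)
    have "endp (insert (i, j) D) k \<longleftrightarrow> k = i \<or> k = j \<or> endp D k" unfolding endp_def by auto
    then show ?thesis unfolding v S.g'_def
      by (cases b) (auto simp: middle_def)
  qed
  then show "surgery.g' (middle D) (False, i) (False, j) (True, j) (True, i) = middle (insert (i, j) D)" by auto
qed

text \<open>Boolean functions on the components of the partly cut stack. They serve twice: as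
  monomials, marking the components labelled x, and as points, marking the components where x takes
  the value t instead of 0.\<close>

definition stage :: "(int \<times> int) set \<Rightarrow> state set" where
  "stage D = {s. (\<forall>v. v \<notin> W \<longrightarrow> \<not> s v) \<and> (\<forall>v\<in>W. s (outer v) = s v \<and> s (middle D v) = s v)}"

text \<open>The value at the point \<theta> of the product of the variables x over the components
  marked by s.\<close>

definition monomial :: "(int \<times> int) set \<Rightarrow> state \<Rightarrow> state \<Rightarrow> int" where
  "monomial D s \<theta> = (if \<forall>v. s v \<longrightarrow> \<theta> v then t ^ norb W outer (middle D) {v. s v} else 0)"

definition merged :: "(int \<times> int) set \<Rightarrow> int \<times> int \<Rightarrow> bool" where
  "merged D pr \<longleftrightarrow> ((False, fst pr), (True, fst pr)) \<notin> conn W outer (middle D)"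

text \<open>In the case of a split, \<open>\<theta> \<in> stage D\<close> says that the two halves
  of the split circle carry the same value.\<close>

definition surg_factor :: "(int \<times> int) set \<Rightarrow> int \<times> int \<Rightarrow> state \<Rightarrow> int" where
  "surg_factor D pr \<theta> = (if merged D pr then 1 else if \<theta> \<in> stage D then (if \<theta> (False, fst pr) then t else - t) else 0)"

definition eval_list :: "(int \<times> int) set \<Rightarrow> (int \<times> state) list \<Rightarrow> state \<Rightarrow> int" where
  "eval_list D L \<theta> = sum_list (map (\<lambda>(k, s). k * monomial D s \<theta>) L)"

abbreviation "tspan D \<equiv> multiple_span t (stage D) (monomial D) (stage D)"

lemma finite_stage: "finite (stage D)"
proof -
  have "inj_on (\<lambda>s. {v. s v}) (stage D)" by (intro inj_onI) (auto simp: fun_eq_iff)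
  moreover have "(\<lambda>s. {v. s v}) ` stage D \<subseteq> Pow W" unfolding stage_def by auto
  ultimately show ?thesis using finite_W by (meson finite_Pow_iff inj_on_finite)
qed

lemma tspan_X: "s \<in> stage D \<Longrightarrow> tspan D (\<lambda>\<theta>. t * monomial D s \<theta>)"
  by (rule multiple_span_basis[OF finite_stage])

lemma stage_orb:
  assumes "s \<in> stage D" "v \<in> W" "w \<in> orbD D v"
  shows "s w = s v"
proof -
  have "orbD D v \<subseteq> {w. s w = s v}"
    by (rule orb_least) (use assms in \<open>auto simp: stage_def\<close>)
  then show ?thesis using assms by auto
qed

lemma stage_W: "s \<in> stage D \<Longrightarrow> {v. s v} \<subseteq> W"
  unfolding stage_def by auto

lemma stage_closed: "s \<in> stage D \<Longrightarrow> s x \<Longrightarrow> s (outer x)" "s \<in> stage D \<Longrightarrow> s x \<Longrightarrow> s (middle D x)"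
proof -
  assume s: "s \<in> stage D" "s x"
  then have "x \<in> W" using stage_W by blast
  then show "s (outer x)" "s (middle D x)" using s unfolding stage_def by auto
qed

text \<open>In the deformed theory a merge is a restriction of functions and a split is multiplication by
  \<open>x\<^sub>1 + x\<^sub>2 - t\<close>, which is \<open>\<plusminus>t\<close> at the points where \<open>x\<^sub>1 = x\<^sub>2\<close> and \<open>0\<close> elsewhere.\<close>

lemma sstep_correct:
  assumes D: "D \<subseteq> cups c" and ij: "(i, j) \<in> cups c" "(i, j) \<notin> D" and s: "s \<in> stage D"
  shows "tspan (insert (i, j) D) (\<lambda>\<theta>. surg_factor D (i, j) \<theta> * monomial D s \<theta> - eval_list (insert (i, j) D) (sstep a c d D (i, j) s) \<theta>)"
    and "\<forall>(k, s')\<in>set (sstep a c d D (i, j) s). s' \<in> stage (insert (i, j) D)"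
proof -
  define D' where "D' = insert (i, j) D"
  define p q r u where "p = (False, i)" and "q = (False, j)" and "r = (True, j)" and "u = (True, i)"
  interpret S: surgery W outer "middle D" col p q r u unfolding p_def q_def r_def u_def by (rule surgery_middle[OF D ij])
  have g': "S.g' = middle D'" unfolding D'_def p_def q_def r_def u_def by (rule surgery_middle(2)[OF D ij])
  have D's: "D' \<subseteq> cups c" using D ij D'_def by auto
  let ?n = "norb W outer (middle D)" and ?n' = "norb W outer (middle D')"
  let ?C1 = "orbD D' p" and ?C2 = "orbD D' q"
  note inv = S.invf S.invg S.invg'[unfolded g']
  have qr': "?C2 = orbD D' r" using orb_step(2)[OF inv(1,3) S.dist(6)] S.g'_simps g' by metis
  have pu': "orbD D' u = ?C1" using orb_step(2)[OF inv(1,3) S.pW] S.g'_simps g' by metis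
  have ru: "orbD D u = orbD D r" using orb_step(2)[OF inv(1,2) S.rW] S.s by metis
  \<comment> \<open>\<open>sstep\<close> tests whether p is connected to the upper vertex at i,
    \<open>surgery\<close> uses the upper vertex at j; the uncut upper arc joins these two.\<close>
  have "(p, u) \<in> conn W outer (middle D) \<longleftrightarrow> u \<in> orbD D p" unfolding orb_def by simp
  also have "\<dots> \<longleftrightarrow> r \<in> orbD D p"
    using orb_closed(3)[OF inv(1,2) S.pW, of u] orb_closed(3)[OF inv(1,2) S.pW, of r] S.s S.dist by auto
  finally have conn: "(p, u) \<in> conn W outer (middle D) \<longleftrightarrow> (p, r) \<in> conn W outer (middle D)" unfolding orb_def by simp
  then have mgd: "merged D (i, j) \<longleftrightarrow> (p, r) \<notin> conn W outer (middle D)" unfolding merged_def p_def u_def by simp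
  have surg_factor: "surg_factor D (i, j) \<theta> = (if (p, r) \<notin> conn W outer (middle D) then 1 else if \<theta> \<in> stage D then if \<theta> p then t else - t else 0)" for \<theta>
    unfolding surg_factor_def mgd p_def by simp
  have step: "sstep a c d D (i, j) s = (if (p, r) \<notin> conn W outer (middle D) then
        (if s p \<and> s u then [] else [(1, \<lambda>v. if v \<in> ?C1 then s p \<or> s u else s v)])
      else if s p then [(1, \<lambda>v. if v \<in> ?C1 \<union> ?C2 then True else s v)]
      else [(1, \<lambda>v. if v \<in> ?C1 then False else if v \<in> ?C2 then True else s v),
            (1, \<lambda>v. if v \<in> ?C1 then True else if v \<in> ?C2 then False else s v)])"
    unfolding sstep_def Let_def prod.case D'_def[symmetric] p_def[symmetric] q_def[symmetric] u_def[symmetric]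
      scomp_eq[OF D's] sconn_eq[OF D] conn by simp
  let ?A = "{v. s v}"
  have AW: "?A \<subseteq> W" using stage_W[OF s] .
  note Acl = stage_closed[OF s]
  have suq: "s u = s r" "s p = s q" using s S.pW S.rW S.q S.s unfolding stage_def by auto
  have gg_eq: "middle D' x = middle D x" if "x \<notin> {p, q, r, u}" for x using S.g'_other[OF that] g' by simp
  have stI: "s' \<in> stage D'"
    if w1: "\<And>v. s' v \<Longrightarrow> v \<in> W" and w2: "\<And>v. s' v \<Longrightarrow> s' (outer v)" and w3: "\<And>v. s' v \<Longrightarrow> s' (middle D' v)" for s'
    unfolding stage_def
  proof (intro CollectI conjI allI impI ballI)
    show "\<not> s' v" if "v \<notin> W" for v using that w1 by blast
    fix v assume v: "v \<in> W"
    show "s' (outer v) = s' v" using w2[of v] w2[of "outer v"] invol_onD(2)[OF inv(1) v] by auto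
    show "s' (middle D' v) = s' v" using w3[of v] w3[of "middle D' v"] invol_onD(2)[OF inv(3) v] by auto
  qed
  have orbW: "orbD D' v \<subseteq> W" "\<And>x. x \<in> orbD D' v \<Longrightarrow> outer x \<in> orbD D' v" "\<And>x. x \<in> orbD D' v \<Longrightarrow> middle D' x \<in> orbD D' v" if "v \<in> W" for v
    using orb_closed[OF inv(1,3) that] by auto
  have Xeq: "monomial D' (\<lambda>v. v \<in> B) \<theta> = (if B \<subseteq> {v. \<theta> v} then t ^ ?n' B else 0)" for B \<theta>
    unfolding monomial_def by auto
  have Xs: "monomial D s \<theta> = (if ?A \<subseteq> {v. \<theta> v} then t ^ ?n ?A else 0)" for \<theta> unfolding monomial_def by auto
  have Xs': "monomial D' s \<theta> = (if ?A \<subseteq> {v. \<theta> v} then t ^ ?n' ?A else 0)" for \<theta> unfolding monomial_def by auto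
  have all_in: "q \<in> ?A \<longleftrightarrow> p \<in> ?A" "u \<in> ?A \<longleftrightarrow> r \<in> ?A" using suq by auto
  have stD's: "s \<in> stage D'" if "(p \<in> ?A) = (r \<in> ?A)"
  proof (rule stI)
    have "{p, q, r, u} \<subseteq> ?A \<or> {p, q, r, u} \<inter> ?A = {}" using that suq by auto
    from S.closed_all_or_none[OF this] show "\<And>v. s v \<Longrightarrow> s (middle D' v)" using Acl(2) g' by auto
  qed (use AW Acl in auto)
  have away: "?n' ?A = ?n ?A" if "p \<notin> ?A" "r \<notin> ?A"
  proof -
    have "orbD D' v = orbD D v" if v: "v \<in> ?A" for v
      using S.orb_away[of ?A v] v AW Acl stage_closed[OF stD's] \<open>p \<notin> ?A\<close> \<open>r \<notin> ?A\<close> unfolding g' by auto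
    then show ?thesis unfolding norb_def by (metis image_cong)
  qed
  show "\<forall>(k, s')\<in>set (sstep a c d D (i, j) s). s' \<in> stage (insert (i, j) D)"
    and "tspan (insert (i, j) D) (\<lambda>\<theta>. surg_factor D (i, j) \<theta> * monomial D s \<theta> - eval_list (insert (i, j) D) (sstep a c d D (i, j) s) \<theta>)"
    unfolding D'_def[symmetric]
  proof -
    consider (M1) "(p, r) \<notin> conn W outer (middle D)" "s p" "s r"
      | (M2) "(p, r) \<notin> conn W outer (middle D)" "\<not> s p" "\<not> s r"
      | (M3) "(p, r) \<notin> conn W outer (middle D)" "s p \<noteq> s r"
      | (S1) "(p, r) \<in> conn W outer (middle D)" "s p"
      | (S2) "(p, r) \<in> conn W outer (middle D)" "\<not> s p" by blast
    then have "(\<forall>(k, s')\<in>set (sstep a c d D (i, j) s). s' \<in> stage D') \<and>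
      tspan D' (\<lambda>\<theta>. surg_factor D (i, j) \<theta> * monomial D s \<theta> - eval_list D' (sstep a c d D (i, j) s) \<theta>)"
    proof cases
      \<comment> \<open>Here x times x is t x, which the undeformed rule replaces by 0. This is the
        only error made by a merge.\<close>
      case M1
      then have l: "sstep a c d D (i, j) s = []" using step suq by simp
      have "?n ?A = ?n' ?A + 1"
        using S.norb_merge[of ?A] M1 AW Acl unfolding g' by auto
      then have "surg_factor D (i, j) \<theta> * monomial D s \<theta> - eval_list D' [] \<theta> = t * monomial D' s \<theta>" for \<theta>
        unfolding surg_factor Xs Xs' eval_list_def using M1 by simp
      then show ?thesis unfolding l using tspan_X[OF stD's] M1 by simp
    next
      case M2
      have "orbD D p \<subseteq> {v. \<not> s v}" "orbD D r \<subseteq> {v. \<not> s v}" using stage_orb[OF s S.pW] stage_orb[OF s S.rW] M2 by blast+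
      then have "?C1 \<subseteq> {v. \<not> s v}" using S.merge(1)[OF M2(1)] g' by auto
      then have "(\<lambda>v. if v \<in> ?C1 then s p \<or> s u else s v) = s" using M2 suq by (auto simp: fun_eq_iff)
      then have l: "sstep a c d D (i, j) s = [(1, s)]" using step M2 suq by simp
      have "surg_factor D (i, j) \<theta> * monomial D s \<theta> - eval_list D' [(1, s)] \<theta> = 0" for \<theta>
        unfolding surg_factor Xs eval_list_def using M2 away Xs' by simp
      then show ?thesis unfolding l using multiple_span_0 stD's M2 by simp
    next
      case M3
      \<comment> \<open>The one of p and r whose component is not yet labelled x: the merge enlarges
        the marked set by exactly this component.\<close>
      define y where "y = (if s p then r else p)"
      have y: "y \<in> W" "\<not> s y" "y \<in> {p, r}" using M3 S.pW S.rW y_def by auto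
      have C1: "?C1 = orbD D p \<union> orbD D r" using S.merge(1)[OF M3(1)] g' by simp
      let ?B = "?A \<union> orbD D y"
      have AB: "?A \<union> ?C1 = ?B"
      proof (cases "s p")
        case True
        then have "orbD D p \<subseteq> ?A" using stage_orb[OF s S.pW] by blast
        then show ?thesis unfolding C1 y_def using True by auto
      next
        case False
        then have "orbD D r \<subseteq> ?A" using stage_orb[OF s S.rW] M3 by blast
        then show ?thesis unfolding C1 y_def using False by auto
      qed
      then have fn: "(\<lambda>v. if v \<in> ?C1 then s p \<or> s u else s v) = (\<lambda>v. v \<in> ?B)"
        unfolding AB[symmetric] using M3 suq by (auto simp: fun_eq_iff)
      have l: "sstep a c d D (i, j) s = [(1, \<lambda>v. v \<in> ?B)]"
        using step M3 suq fn by (auto simp del: Un_iff)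
      have oD: "orbD D y \<subseteq> W" "\<And>x. x \<in> orbD D y \<Longrightarrow> outer x \<in> orbD D y" "\<And>x. x \<in> orbD D y \<Longrightarrow> middle D x \<in> orbD D y"
        using orb_closed[OF inv(1,2) y(1)] by auto
      have Bcl: "?B \<subseteq> W" "\<And>x. x \<in> ?B \<Longrightarrow> outer x \<in> ?B" "\<And>x. x \<in> ?B \<Longrightarrow> middle D x \<in> ?B" using AW Acl oD by auto
      have pB: "p \<in> ?B" "r \<in> ?B" using M3 y_def by (auto split: if_splits)
      have "?n ?B = ?n' ?B + 1" using S.norb_merge[OF M3(1) Bcl pB] unfolding g' .
      moreover have "?n ?B = ?n ?A + 1"
        by (rule norb_add_orb[OF finite_W inv(1,2) AW y(1)]) (use Acl y in auto)
      ultimately have n: "?n ?A = ?n' ?B" by simp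
      have "q \<in> ?B" "u \<in> ?B" using Bcl(3)[OF pB(1)] Bcl(3)[OF pB(2)] S.q S.s by auto
      then have "{p, q, r, u} \<subseteq> ?B" using pB by auto
      then have Bg': "\<forall>x\<in>?B. middle D' x \<in> ?B" using S.closed_all_or_none[of ?B] Bcl(3) g' by auto
      have stB: "(\<lambda>v. v \<in> ?B) \<in> stage D'" using Bcl Bg' by (intro stI) (auto simp del: Un_iff)
      have AB_iff: "?A \<subseteq> {v. \<theta> v} \<longleftrightarrow> ?B \<subseteq> {v. \<theta> v}" if th: "\<theta> \<in> stage D'" for \<theta>
      proof
        assume A: "?A \<subseteq> {v. \<theta> v}"
        have "\<theta> p" 
        proof (cases "s p")
          case False
          then have "\<theta> r" using M3 A by auto
          then show ?thesis using stage_orb[OF th S.pW, of r] C1 by simp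
        qed (use A in auto)
        then have "?C1 \<subseteq> {v. \<theta> v}" using stage_orb[OF th S.pW] by blast
        then show "?B \<subseteq> {v. \<theta> v}" using A AB by auto
      qed auto
      have "surg_factor D (i, j) \<theta> * monomial D s \<theta> - eval_list D' [(1, \<lambda>v. v \<in> ?B)] \<theta> = 0" if "\<theta> \<in> stage D'" for \<theta>
      proof -
        have "monomial D s \<theta> = monomial D' (\<lambda>v. v \<in> ?B) \<theta>" unfolding Xs Xeq n using AB_iff[OF that] by (simp only:)
        then show ?thesis unfolding surg_factor eval_list_def using M3 by (simp del: Un_iff)
      qed
      then have "tspan D' (\<lambda>\<theta>. surg_factor D (i, j) \<theta> * monomial D s \<theta> - eval_list D' [(1, \<lambda>v. v \<in> ?B)] \<theta>)"
        by (rule multiple_span_cong[OF multiple_span_0])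
      then show ?thesis unfolding l using stB by simp
    next
      \<comment> \<open>The rule sending x to x times x is exact: where the monomial is nonzero,
        both halves have value t, so the point lies in \<open>stage D\<close> and the factor is
        t.\<close>
      case S1
      have "r \<in> orbD D p" using S1 unfolding orb_def by simp
      then have sr: "s r" using stage_orb[OF s S.pW] S1 by blast
      have C12: "orbD D p = ?C1 \<union> ?C2" using S.split(1)[OF S1(1)] g' qr' by simp
      then have "?C1 \<union> ?C2 \<subseteq> ?A" using stage_orb[OF s S.pW] S1 C12 by blast
      then have "(\<lambda>v. if v \<in> ?C1 \<union> ?C2 then True else s v) = s" by (auto simp: fun_eq_iff)
      then have l: "sstep a c d D (i, j) s = [(1, s)]" using step S1 by (simp del: Un_iff)
      have sD': "s \<in> stage D'" using stD's S1 sr by simp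
      have n: "?n' ?A = ?n ?A + 1"
        using S.norb_split[OF S1(1) AW] Acl(1) S1 sr stage_closed(2)[OF sD'] unfolding g' by auto
      have "surg_factor D (i, j) \<theta> * monomial D s \<theta> - eval_list D' [(1, s)] \<theta> = 0" if th: "\<theta> \<in> stage D'" for \<theta>
      proof (cases "?A \<subseteq> {v. \<theta> v}")
        case True
        have "\<theta> \<in> stage D"
          unfolding stage_def
        proof (intro CollectI conjI allI impI ballI)
          show "\<not> \<theta> v" if "v \<notin> W" for v using stage_W[OF th] that by blast
          fix v assume v: "v \<in> W"
          show "\<theta> (outer v) = \<theta> v" using th v unfolding stage_def by auto
          show "\<theta> (middle D v) = \<theta> v"
          proof (cases "v \<in> {p, q, r, u}")
            case True
            then have "s v" using S1 sr suq by auto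
            then show ?thesis using \<open>?A \<subseteq> {v. \<theta> v}\<close> Acl(2)[of v] by blast
          next
            case False
            then show ?thesis using th v gg_eq[OF False] unfolding stage_def by auto
          qed
        qed
        then show ?thesis unfolding surg_factor Xs eval_list_def using S1 True n Xs' by auto
      qed (simp add: Xs eval_list_def Xs')
      then have "tspan D' (\<lambda>\<theta>. surg_factor D (i, j) \<theta> * monomial D s \<theta> - eval_list D' [(1, s)] \<theta>)"
        by (rule multiple_span_cong[OF multiple_span_0])
      then show ?thesis unfolding l using sD' by simp
    next
      \<comment> \<open>The deformed rule sends 1 to the sum of the two variables minus t; omitting
        the last term leaves an error of - t times the unchanged monomial.\<close>
      case S2
      have "r \<in> orbD D p" using S2 unfolding orb_def by simp
      then have sr: "\<not> s r" using stage_orb[OF s S.pW] S2 by blast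
      have C12: "orbD D p = ?C1 \<union> ?C2" "?C1 \<inter> ?C2 = {}" using S.split(1,3)[OF S2(1)] g' qr' by simp_all
      have dA: "?C1 \<inter> ?A = {}" "?C2 \<inter> ?A = {}" using stage_orb[OF s S.pW] S2 C12(1) by blast+
      have f1: "(\<lambda>v. if v \<in> ?C1 then False else if v \<in> ?C2 then True else s v) = (\<lambda>v. v \<in> ?A \<union> ?C2)"
        "(\<lambda>v. if v \<in> ?C1 then True else if v \<in> ?C2 then False else s v) = (\<lambda>v. v \<in> ?A \<union> ?C1)"
        using C12 dA by (auto simp: fun_eq_iff)
      have l: "sstep a c d D (i, j) s = [(1, \<lambda>v. v \<in> ?A \<union> ?C2), (1, \<lambda>v. v \<in> ?A \<union> ?C1)]"
        unfolding step f1 using S2 by (simp del: Un_iff)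
      have sD': "s \<in> stage D'" using stD's S2 sr by simp
      note sc' = stage_closed[OF sD']
      have st1: "(\<lambda>v. v \<in> ?A \<union> orbD D' y) \<in> stage D'" if "y \<in> {p, q}" for y
        using orbW[of y] that S.pW S.dist AW sc' by (intro stI) auto
      have n: "?n' (?A \<union> orbD D' y) = ?n ?A + 1" if "y \<in> {p, q}" for y
      proof -
        have "?n' (?A \<union> orbD D' y) = ?n' ?A + 1"
          by (rule norb_add_orb[OF finite_W inv(1,3) AW]) (use that S.pW S.dist(6) sc' S2 suq in auto)
        then show ?thesis using away S2 sr by simp
      qed
      have "surg_factor D (i, j) \<theta> * monomial D s \<theta> - eval_list D' [(1, \<lambda>v. v \<in> ?A \<union> ?C2), (1, \<lambda>v. v \<in> ?A \<union> ?C1)] \<theta>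
          = (-1) * (t * monomial D' s \<theta>)" if th: "\<theta> \<in> stage D'" for \<theta>
      proof -
        have C: "?A \<union> ?C1 \<subseteq> {v. \<theta> v} \<longleftrightarrow> ?A \<subseteq> {v. \<theta> v} \<and> \<theta> p" "?A \<union> ?C2 \<subseteq> {v. \<theta> v} \<longleftrightarrow> ?A \<subseteq> {v. \<theta> v} \<and> \<theta> q"
          using stage_orb[OF th S.pW] stage_orb[OF th S.dist(6)] orb_self[of p W outer "middle D'"] orb_self[of q W outer "middle D'"] by blast+
        have th_st: "\<theta> \<in> stage D \<longleftrightarrow> \<theta> p = \<theta> q"
        proof
          assume "\<theta> \<in> stage D"
          then show "\<theta> p = \<theta> q" using S.pW S.q unfolding stage_def by auto
        next
          assume pq: "\<theta> p = \<theta> q"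
          have "\<theta> u = \<theta> p" "\<theta> r = \<theta> q"
            using stage_orb[OF th S.pW, of u] stage_orb[OF th S.dist(6), of r] pu' qr' orb_self[of u W outer "middle D'"] orb_self[of r W outer "middle D'"] by auto
          then have "\<theta> (middle D v) = \<theta> v" if "v \<in> {p, q, r, u}" for v using that pq S.dist S.q S.s by auto
          then have "\<theta> (middle D v) = \<theta> v" if "v \<in> W" for v
            using th gg_eq[of v] that unfolding stage_def by (cases "v \<in> {p, q, r, u}") auto
          then show "\<theta> \<in> stage D" using th unfolding stage_def by blast
        qed
        have X: "monomial D' (\<lambda>v. v \<in> ?A \<union> ?C2) \<theta> = (if ?A \<subseteq> {v. \<theta> v} \<and> \<theta> q then t * t ^ ?n ?A else 0)"
          "monomial D' (\<lambda>v. v \<in> ?A \<union> ?C1) \<theta> = (if ?A \<subseteq> {v. \<theta> v} \<and> \<theta> p then t * t ^ ?n ?A else 0)"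
          "monomial D' s \<theta> = (if ?A \<subseteq> {v. \<theta> v} then t ^ ?n ?A else 0)"
          unfolding Xeq C Xs' using n[of p] n[of q] away S2 sr by simp_all
        have f: "surg_factor D (i, j) \<theta> = (if \<theta> p = \<theta> q then if \<theta> p then t else - t else 0)"
          unfolding surg_factor using S2 th_st by simp
        have "eval_list D' [(1, \<lambda>v. v \<in> ?A \<union> ?C2), (1, \<lambda>v. v \<in> ?A \<union> ?C1)] \<theta>
          = monomial D' (\<lambda>v. v \<in> ?A \<union> ?C2) \<theta> + monomial D' (\<lambda>v. v \<in> ?A \<union> ?C1) \<theta>"
          unfolding eval_list_def by (simp del: Un_iff)
        then show ?thesis unfolding X f Xs by (cases "?A \<subseteq> {v. \<theta> v}"; cases "\<theta> p"; cases "\<theta> q") simp_all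
      qed
      then have "tspan D' (\<lambda>\<theta>. surg_factor D (i, j) \<theta> * monomial D s \<theta> - eval_list D' [(1, \<lambda>v. v \<in> ?A \<union> ?C2), (1, \<lambda>v. v \<in> ?A \<union> ?C1)] \<theta>)"
        by (rule multiple_span_cong[OF multiple_span_scale[OF tspan_X[OF sD']]])
      then show ?thesis unfolding l using st1[of p] st1[of q] by simp
    qed
    then show "\<forall>(k, s')\<in>set (sstep a c d D (i, j) s). s' \<in> stage D'"
      "tspan D' (\<lambda>\<theta>. surg_factor D (i, j) \<theta> * monomial D s \<theta> - eval_list D' (sstep a c d D (i, j) s) \<theta>)" by auto
  qed
qed

end

section \<open>Composing the surgeries\<close>

context triple
begin

fun iter_factor :: "(int \<times> int) set \<Rightarrow> (int \<times> int) list \<Rightarrow> (state \<Rightarrow> int) \<Rightarrow> state \<Rightarrow> int" where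
  "iter_factor D [] F = F"
| "iter_factor D (pr # prs) F = iter_factor (insert pr D) prs (\<lambda>\<theta>. surg_factor D pr \<theta> * F \<theta>)"

text \<open>The new vertical strands identify the values on the two copies of i and of j. One
  equation, between i and j, then decides membership in the earlier stage; after a merge it holds
  automatically because all four vertices lie on one component.\<close>

lemma stage_insert:
  assumes D: "D \<subseteq> cups c" and ij: "(i, j) \<in> cups c" "(i, j) \<notin> D" and th: "\<theta> \<in> stage (insert (i, j) D)"
  shows "merged D (i, j) \<Longrightarrow> \<theta> \<in> stage D" "\<theta> \<in> stage D \<longleftrightarrow> \<theta> (False, i) = \<theta> (False, j)"
    "\<theta> (True, i) = \<theta> (False, i)" "\<theta> (True, j) = \<theta> (False, j)"
proof -
  let ?p = "(False, i)" and ?q = "(False, j)" and ?r = "(True, j)" and ?u = "(True, i)"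
  interpret S: surgery W outer "middle D" col "(False, i)" "(False, j)" "(True, j)" "(True, i)" by (rule surgery_middle[OF D ij])
  have g': "S.g' = middle (insert (i, j) D)" by (rule surgery_middle(2)[OF D ij])
  have st': "\<theta> (middle (insert (i, j) D) v) = \<theta> v" if "v \<in> W" for v using th that unfolding stage_def by simp
  show tu: "\<theta> ?u = \<theta> ?p" using st'[OF S.pW] S.g'_simps(1) unfolding g' by simp
  show tr: "\<theta> ?r = \<theta> ?q" using st'[OF S.rW] S.g'_simps(3) unfolding g' by simp
  show iff: "\<theta> \<in> stage D \<longleftrightarrow> \<theta> ?p = \<theta> ?q"
  proof
    assume "\<theta> \<in> stage D"
    then show "\<theta> ?p = \<theta> ?q" using S.pW S.q unfolding stage_def by auto
  next
    assume pq: "\<theta> ?p = \<theta> ?q"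
    have "\<theta> (middle D v) = \<theta> v" if "v \<in> W" for v
    proof (cases "v \<in> {?p, ?q, ?r, ?u}")
      case True
      then show ?thesis using pq tu tr S.q S.s S.dist(8,9) by auto
    next
      case False
      then show ?thesis using S.g'_other[OF False] th that unfolding g' stage_def by auto
    qed
    then show "\<theta> \<in> stage D" using th unfolding stage_def by blast
  qed
  assume m: "merged D (i, j)"
  have "(?p, ?r) \<notin> conn W outer (middle D)"
  proof
    assume "(?p, ?r) \<in> conn W outer (middle D)"
    then have "(?p, ?u) \<in> conn W outer (middle D)" using conn_trans conn_g[OF S.rW, of "middle D" outer] S.s by metis
    then show False using m unfolding merged_def by simp
  qed
  then have "?r \<in> orbD (insert (i, j) D) ?p" using S.dichotomy unfolding g' orb_def by simp
  then have "\<theta> ?r = \<theta> ?p" by (rule stage_orb[OF th S.pW])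
  then show "\<theta> \<in> stage D" using iff tr by simp
qed

text \<open>At each vertex the involution \<open>middle D'\<close> coincides with that of
  \<open>D\<close> or with that of \<open>D''\<close>.\<close>

lemma stage_between:
  assumes "D \<subseteq> D'" "D' \<subseteq> D''" "\<theta> \<in> stage D" "\<theta> \<in> stage D''"
  shows "\<theta> \<in> stage D'"
proof -
  have "\<theta> (middle D' v) = \<theta> v" if "v \<in> W" for v
  proof (cases "endp D' (snd v)")
    case True
    then have "endp D'' (snd v)" using assms(2) unfolding endp_def by blast
    then have "middle D' v = middle D'' v" using True unfolding middle_def by simp
    then show ?thesis using assms(4) that unfolding stage_def by simp
  next
    case False
    then have "\<not> endp D (snd v)" using assms(1) unfolding endp_def by blast
    then have "middle D' v = middle D v" using False unfolding middle_def by simp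
    then show ?thesis using assms(3) that unfolding stage_def by simp
  qed
  then show ?thesis using assms(3) unfolding stage_def by blast
qed

lemma eval_list_simps [simp]: "eval_list D [] \<theta> = 0" "eval_list D (x # L) \<theta> = fst x * monomial D (snd x) \<theta> + eval_list D L \<theta>"
  "eval_list D (L @ L') \<theta> = eval_list D L \<theta> + eval_list D L' \<theta>"
  unfolding eval_list_def by (simp_all add: case_prod_beta)

lemma eval_list_scale: "eval_list D (map (\<lambda>(k', s'). (k * k', s')) L) \<theta> = k * eval_list D L \<theta>"
  by (induction L) (auto simp: distrib_left)

lemma tspan_eval_list: "\<forall>(k, s)\<in>set L. s \<in> stage D \<Longrightarrow> tspan D (\<lambda>\<theta>. t * eval_list D L \<theta>)"
proof (induction L)
  case Nil
  then show ?case using multiple_span_0 by simp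
next
  case (Cons x L)
  then have "tspan D (\<lambda>\<theta>. fst x * (t * monomial D (snd x) \<theta>) + t * eval_list D L \<theta>)"
    by (intro multiple_span_add multiple_span_scale tspan_X Cons.IH) auto
  then show ?case by (rule multiple_span_cong) (simp add: algebra_simps)
qed

text \<open>Errors made earlier remain multiples of t: a surgery turns a monomial into an integral
  combination of monomials up to a further multiple of t.\<close>

lemma surg_factor_span:
  assumes D: "D \<subseteq> cups c" and ij: "(i, j) \<in> cups c" "(i, j) \<notin> D" and F: "tspan D F"
  shows "tspan (insert (i, j) D) (\<lambda>\<theta>. surg_factor D (i, j) \<theta> * F \<theta>)"
proof -
  let ?D' = "insert (i, j) D"
  obtain h where h: "\<forall>\<theta>\<in>stage D. F \<theta> = t * (\<Sum>s\<in>stage D. h s * monomial D s \<theta>)"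
    using F unfolding multiple_span_def by auto
  have "tspan ?D' (\<lambda>\<theta>. \<Sum>s\<in>stage D. h s * (t * (surg_factor D (i, j) \<theta> * monomial D s \<theta>)))"
  proof (rule multiple_span_sum[OF finite_stage multiple_span_scale])
    fix s assume s: "s \<in> stage D"
    note stage = sstep_correct[OF D ij s]
    have "tspan ?D' (\<lambda>\<theta>. t * (surg_factor D (i, j) \<theta> * monomial D s \<theta> - eval_list ?D' (sstep a c d D (i, j) s) \<theta>)
        + t * eval_list ?D' (sstep a c d D (i, j) s) \<theta>)"
      by (rule multiple_span_add[OF multiple_span_scale[OF stage(1)] tspan_eval_list[OF stage(2)]])
    then show "tspan ?D' (\<lambda>\<theta>. t * (surg_factor D (i, j) \<theta> * monomial D s \<theta>))"
      by (rule multiple_span_cong) (simp add: algebra_simps)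
  qed
  then show ?thesis
  proof (rule multiple_span_cong)
    fix \<theta> assume th: "\<theta> \<in> stage ?D'"
    show "surg_factor D (i, j) \<theta> * F \<theta> = (\<Sum>s\<in>stage D. h s * (t * (surg_factor D (i, j) \<theta> * monomial D s \<theta>)))"
    proof (cases "\<theta> \<in> stage D")
      case True
      then show ?thesis using h by (simp add: sum_distrib_left algebra_simps)
    next
      case False
      \<comment> \<open>The hypothesis controls \<open>F\<close> on \<open>stage D\<close> only. A
        new point outside it cannot come from a merge, and a split multiplies by 0 there.\<close>
      then have "surg_factor D (i, j) \<theta> = 0" using stage_insert(1)[OF D ij th] unfolding surg_factor_def by auto
      then show ?thesis by simp
    qed
  qed
qed

text \<open>Induction along the list of cups: \<open>sstep_correct\<close> bounds the error of the
  new surgery and \<open>surg_factor_span\<close> carries the old errors along.\<close>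

lemma surg_correct:
  assumes "D \<subseteq> cups c" "set prs \<subseteq> cups c" "distinct prs" "set prs \<inter> D = {}"
    "\<forall>(k, s)\<in>set L. s \<in> stage D" "tspan D (\<lambda>\<theta>. F \<theta> - eval_list D L \<theta>)"
  shows "(\<forall>(k, s)\<in>set (surg a c d D prs L). s \<in> stage (D \<union> set prs)) \<and>
    tspan (D \<union> set prs) (\<lambda>\<theta>. iter_factor D prs F \<theta> - eval_list (D \<union> set prs) (surg a c d D prs L) \<theta>)"
  using assms
proof (induction prs arbitrary: D L F)
  case Nil
  then show ?case by simp
next
  case (Cons pr prs)
  obtain i j where pr: "pr = (i, j)" by (metis surj_pair)
  have ij: "(i, j) \<in> cups c" "(i, j) \<notin> D" using Cons.prems pr by auto
  let ?D' = "insert pr D"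
  let ?step = "\<lambda>L. concat (map (\<lambda>(k,s). map (\<lambda>(k',s'). (k * k', s')) (sstep a c d D pr s)) L)"
  have A: "(\<forall>(k, s)\<in>set (?step L). s \<in> stage ?D') \<and> tspan ?D' (\<lambda>\<theta>. surg_factor D pr \<theta> * eval_list D L \<theta> - eval_list ?D' (?step L) \<theta>)"
    if "\<forall>(k, s)\<in>set L. s \<in> stage D" for L
    using that
  proof (induction L)
    case Nil
    then show ?case using multiple_span_0 by simp
  next
    case (Cons x L)
    obtain k s where x: "x = (k, s)" by (metis surj_pair)
    have s: "s \<in> stage D" using Cons.prems x by simp
    note stage = sstep_correct[OF \<open>D \<subseteq> cups c\<close> ij s, folded pr]
    have "tspan ?D' (\<lambda>\<theta>. k * (surg_factor D pr \<theta> * monomial D s \<theta> - eval_list ?D' (sstep a c d D pr s) \<theta>)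
        + (surg_factor D pr \<theta> * eval_list D L \<theta> - eval_list ?D' (?step L) \<theta>))"
      using Cons by (intro multiple_span_add multiple_span_scale stage) auto
    then have "tspan ?D' (\<lambda>\<theta>. surg_factor D pr \<theta> * eval_list D (x # L) \<theta> - eval_list ?D' (?step (x # L)) \<theta>)"
      by (rule multiple_span_cong) (simp add: x eval_list_scale, simp add: algebra_simps)
    moreover have "\<forall>(k, s)\<in>set (?step (x # L)). s \<in> stage ?D'"
      using Cons stage(2) unfolding x by fastforce
    ultimately show ?case by blast
  qed
  have "tspan ?D' (\<lambda>\<theta>. surg_factor D pr \<theta> * (F \<theta> - eval_list D L \<theta>) + (surg_factor D pr \<theta> * eval_list D L \<theta> - eval_list ?D' (?step L) \<theta>))"
    using surg_factor_span[OF Cons.prems(1) ij Cons.prems(6)] A[OF Cons.prems(5)] unfolding pr by (intro multiple_span_add) auto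
  then have "tspan ?D' (\<lambda>\<theta>. surg_factor D pr \<theta> * F \<theta> - eval_list ?D' (?step L) \<theta>)"
    by (rule multiple_span_cong) (simp add: algebra_simps)
  then have "(\<forall>(k, s)\<in>set (surg a c d ?D' prs (?step L)). s \<in> stage (?D' \<union> set prs)) \<and>
    tspan (?D' \<union> set prs) (\<lambda>\<theta>. iter_factor ?D' prs (\<lambda>\<theta>. surg_factor D pr \<theta> * F \<theta>) \<theta> - eval_list (?D' \<union> set prs) (surg a c d ?D' prs (?step L)) \<theta>)"
    using A[OF Cons.prems(5)] Cons.prems by (intro Cons.IH) auto
  moreover have "?D' \<union> set prs = D \<union> set (pr # prs)" by auto
  ultimately show ?case by simp
qed

text \<open>Merges lower and splits raise the number of components by one; this determines the power of \<open>\<plusminus>t\<close>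
  collected at a point without reference to the order of the surgeries.\<close>

lemma iter_factor_eval:
  assumes "D \<subseteq> cups c" "set prs \<subseteq> cups c" "distinct prs" "set prs \<inter> D = {}" "\<theta> \<in> stage (D \<union> set prs)"
  shows "\<exists>s :: bool \<Rightarrow> nat. iter_factor D prs F \<theta> = (if \<theta> \<in> stage D then F \<theta> * t ^ s True * (- t) ^ s False else 0) \<and>
    (\<theta> \<in> stage D \<longrightarrow> (\<forall>\<sigma>. 2 * s \<sigma> + norb W outer (middle D) {v \<in> W. \<theta> v = \<sigma>}
      = norb W outer (middle (D \<union> set prs)) {v \<in> W. \<theta> v = \<sigma>} + card {pr \<in> set prs. \<theta> (False, fst pr) = \<sigma>}))"
  using assms
proof (induction prs arbitrary: D F)
  case Nil
  show ?case by (rule exI[of _ "\<lambda>_. 0"]) (use Nil in simp)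
next
  case (Cons pr prs)
  obtain i j where pr: "pr = (i, j)" by (metis surj_pair)
  note D = Cons.prems(1)
  have ij: "(i, j) \<in> cups c" "(i, j) \<notin> D" using Cons.prems pr by auto
  let ?D' = "insert pr D" and ?S = "D \<union> set (pr # prs)"
  have S: "?D' \<union> set prs = ?S" by auto
  have "\<theta> \<in> stage (?D' \<union> set prs)" using Cons.prems(5) S by simp
  then obtain s where s: "iter_factor ?D' prs (\<lambda>\<theta>. surg_factor D pr \<theta> * F \<theta>) \<theta>
      = (if \<theta> \<in> stage ?D' then surg_factor D pr \<theta> * F \<theta> * t ^ s True * (- t) ^ s False else 0)"
    "\<And>\<sigma>. \<theta> \<in> stage ?D' \<Longrightarrow> 2 * s \<sigma> + norb W outer (middle ?D') {v \<in> W. \<theta> v = \<sigma>}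
      = norb W outer (middle ?S) {v \<in> W. \<theta> v = \<sigma>} + card {pr \<in> set prs. \<theta> (False, fst pr) = \<sigma>}"
    using Cons.IH[of ?D' "\<lambda>\<theta>. surg_factor D pr \<theta> * F \<theta>"] Cons.prems(1-4) unfolding S by auto
  show ?case
  proof (cases "\<theta> \<in> stage D")
    case False
    have "iter_factor D (pr # prs) F \<theta> = 0"
    proof (cases "\<theta> \<in> stage ?D'")
      case True
      then have "surg_factor D pr \<theta> = 0" using stage_insert(1)[OF D ij] False unfolding surg_factor_def pr by auto
      then show ?thesis using s(1) by simp
    qed (use s(1) in simp)
    then show ?thesis using False by auto
  next
    case True
    note thD = True
    have thD': "\<theta> \<in> stage ?D'" by (rule stage_between[OF _ _ True Cons.prems(5)]) auto
    interpret S: surgery W outer "middle D" col "(False, i)" "(False, j)" "(True, j)" "(True, i)" by (rule surgery_middle[OF D ij])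
    have g': "S.g' = middle ?D'" unfolding pr by (rule surgery_middle(2)[OF D ij])
    let ?A = "\<lambda>\<sigma>. {v \<in> W. \<theta> v = \<sigma>}"
    have Acl: "outer x \<in> ?A \<sigma>" "middle D x \<in> ?A \<sigma>" "middle ?D' x \<in> ?A \<sigma>" if "x \<in> ?A \<sigma>" for x \<sigma>
      using that thD thD' invol_onD(1)[OF S.invf] invol_onD(1)[OF S.invg] invol_onD(1)[OF S.invg'[unfolded g']]
      unfolding stage_def by auto
    have eq: "\<theta> (True, j) = \<theta> (False, i)"
      using stage_insert(2,4)[OF D ij thD'[unfolded pr]] thD by simp
    have mem: "(False, i) \<in> ?A (\<theta> (False, i))" "(True, j) \<in> ?A (\<theta> (False, i))" using S.pW S.rW eq by auto
    have AW: "?A \<sigma> \<subseteq> W" for \<sigma> by auto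
    \<comment> \<open>The surgery does not touch components on which the point has the value
      opposite to that at i.\<close>
    have away: "norb W outer (middle ?D') (?A \<sigma>) = norb W outer (middle D) (?A \<sigma>)" if "\<sigma> \<noteq> \<theta> (False, i)" for \<sigma>
    proof -
      have n: "(False, i) \<notin> ?A \<sigma>" using that by simp
      have "orbD ?D' ` ?A \<sigma> = orbD D ` ?A \<sigma>"
        by (rule image_cong[OF refl], rule S.orb_away[unfolded g', OF AW Acl n])
      then show ?thesis unfolding norb_def by simp
    qed
    have cardE: "card {pr' \<in> set (pr # prs). \<theta> (False, fst pr') = \<sigma>}
        = card {pr \<in> set prs. \<theta> (False, fst pr) = \<sigma>} + (if \<sigma> = \<theta> (False, i) then 1 else 0)" for \<sigma>
    proof -
      have "{pr' \<in> set (pr # prs). \<theta> (False, fst pr') = \<sigma>}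
          = {pr \<in> set prs. \<theta> (False, fst pr) = \<sigma>} \<union> (if \<sigma> = \<theta> (False, i) then {pr} else {})"
        unfolding pr by auto
      then show ?thesis using Cons.prems(3) by auto
    qed
    have mg: "merged D pr \<longleftrightarrow> ((False, i), (True, j)) \<notin> conn W outer (middle D)"
    proof -
      have "((False, i), (True, i)) \<in> conn W outer (middle D) \<longleftrightarrow> ((False, i), (True, j)) \<in> conn W outer (middle D)"
        using conn_trans[of "(False, i)" "(True, i)" W outer "middle D" "(True, j)"]
          conn_trans[of "(False, i)" "(True, j)" W outer "middle D" "(True, i)"]
          conn_g[OF S.rW, of "middle D" outer] conn_g[OF S.dist(7), of "middle D" outer] S.s S.dist(9) by auto
      then show ?thesis unfolding merged_def pr by simp
    qed
    show ?thesis
    proof (cases "merged D pr")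
      case True
      have "norb W outer (middle D) (?A (\<theta> (False, i))) = norb W outer (middle ?D') (?A (\<theta> (False, i))) + 1"
        using S.norb_merge[OF _ AW Acl(1,2) mem] True mg unfolding g' by auto
      then have "2 * s \<sigma> + norb W outer (middle D) (?A \<sigma>) = norb W outer (middle ?S) (?A \<sigma>) + card {pr' \<in> set (pr # prs). \<theta> (False, fst pr') = \<sigma>}" for \<sigma>
        using s(2)[OF thD', of \<sigma>] away[of \<sigma>] unfolding cardE by (cases "\<sigma> = \<theta> (False, i)") auto
      moreover have "iter_factor D (pr # prs) F \<theta> = F \<theta> * t ^ s True * (- t) ^ s False"
      proof -
        have "surg_factor D pr \<theta> = 1" unfolding surg_factor_def using True by simp
        then show ?thesis using s(1) thD' by simp
      qed
      ultimately show ?thesis using thD by (intro exI[of _ s]) auto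
    next
      case False
      have n: "norb W outer (middle ?D') (?A (\<theta> (False, i))) = norb W outer (middle D) (?A (\<theta> (False, i))) + 1"
        using S.norb_split[OF _ AW _ _ mem] Acl False mg unfolding g' by auto
      let ?s = "s(\<theta> (False, i) := s (\<theta> (False, i)) + 1)"
      have "2 * ?s \<sigma> + norb W outer (middle D) (?A \<sigma>) = norb W outer (middle ?S) (?A \<sigma>) + card {pr' \<in> set (pr # prs). \<theta> (False, fst pr') = \<sigma>}" for \<sigma>
        using s(2)[OF thD', of \<sigma>] away[of \<sigma>] n unfolding cardE by (cases "\<sigma> = \<theta> (False, i)") auto
      moreover have "iter_factor D (pr # prs) F \<theta> = F \<theta> * t ^ ?s True * (- t) ^ ?s False"
      proof -
        have "surg_factor D pr \<theta> = (if \<theta> (False, i) then t else - t)" unfolding surg_factor_def using False thD by (simp add: pr)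
        then show ?thesis using s(1) thD' by (cases "\<theta> (False, i)") simp_all
      qed
      ultimately show ?thesis using thD by (intro exI[of _ ?s]) auto
    qed
  qed
qed

end

text \<open>Every term of the expansion but the first carries a factor t, displayed by lowering an
  exponent that is positive because \<open>A - B\<close> is nonempty. The identity compares products
  of shifted variables with monomials.\<close>

lemma prod_add_split:
  fixes f g :: "'b \<Rightarrow> int"
  assumes "finite A"
  shows "(\<Prod>x\<in>A. f x + t * g x) = prod f A + (\<Sum>B\<in>Pow A - {A}. t * (t ^ (card (A - B) - 1) * prod g (A - B)) * prod f B)"
proof -
  have "(\<Prod>x\<in>A. f x + t * g x) = (\<Sum>B\<in>Pow A. prod f B * (\<Prod>x\<in>A - B. t * g x))"
    by (rule prod_add[OF assms])
  also have "\<dots> = prod f A + (\<Sum>B\<in>Pow A - {A}. prod f B * (\<Prod>x\<in>A - B. t * g x))"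
    using assms by (subst sum.remove[of _ A]) auto
  also have "(\<Sum>B\<in>Pow A - {A}. prod f B * (\<Prod>x\<in>A - B. t * g x))
      = (\<Sum>B\<in>Pow A - {A}. t * (t ^ (card (A - B) - 1) * prod g (A - B)) * prod f B)"
  proof (rule sum.cong[OF refl])
    fix B assume "B \<in> Pow A - {A}"
    then have "A - B \<noteq> {}" by auto
    then have "card (A - B) \<noteq> 0" using assms by simp
    then obtain n where n: "card (A - B) = Suc n" by (cases "card (A - B)") auto
    have "(\<Prod>x\<in>A - B. t * g x) = t ^ card (A - B) * prod g (A - B)" by (simp add: prod.distrib)
    then show "prod f B * (\<Prod>x\<in>A - B. t * g x) = t * (t ^ (card (A - B) - 1) * prod g (A - B)) * prod f B"
      unfolding n by simp
  qed
  finally show ?thesis .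
qed

lemma inj_times: "A \<noteq> {} \<Longrightarrow> inj_on (\<lambda>C. A \<times> C) X"
  by (rule inj_onI) (auto simp: times_eq_iff)

text \<open>The number of splits at cups where the point has value \<sigma>. Merges plus splits is
  the number of such cups of c, which is half the number of vertices; splits minus merges is the
  change in the number of components.\<close>

definition split_count :: "int \<Rightarrow> cupd \<Rightarrow> cupd \<Rightarrow> cupd \<Rightarrow> weight \<Rightarrow> bool \<Rightarrow> nat" where
  "split_count N a c d \<kappa> \<sigma> = (card (sign_verts N \<kappa> \<sigma>) div 2 + num_circles N a d \<kappa> \<sigma> - (num_circles N a c \<kappa> \<sigma> + num_circles N c d \<kappa> \<sigma>)) div 2"

definition euler :: "int \<Rightarrow> int \<Rightarrow> cupd \<Rightarrow> cupd \<Rightarrow> cupd \<Rightarrow> weight \<Rightarrow> int" where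
  "euler t N a c d \<kappa> = t ^ split_count N a c d \<kappa> True * (- t) ^ split_count N a c d \<kappa> False"

definition diag_coeff :: "cdiag \<Rightarrow> cdiag \<Rightarrow> cdiag \<Rightarrow> int" where
  "diag_coeff x y z = sum_list (map (\<lambda>(k, D). if D = z then k else 0) (hprod x y))"

lemma card_sign_verts_even:
  assumes "closed_cupd N a" "\<kappa> \<in> Or N a"
  shows "card (sign_verts N \<kappa> \<sigma>) = 2 * card {pr \<in> cups a. pt \<kappa> (fst pr) = \<sigma>}"
proof -
  let ?A = "{x \<in> sign_verts N \<kappa> \<sigma>. x < mate a x}"
  have cl: "mate a x \<in> sign_verts N \<kappa> \<sigma>" if "x \<in> sign_verts N \<kappa> \<sigma>" for x
    using that pt_flip[OF assms] mate_verts[OF assms(1)] unfolding sign_verts_def by auto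
  have mm: "mate a (mate a x) = x" "mate a x \<noteq> x" if "x \<in> sign_verts N \<kappa> \<sigma>" for x
    using that mate_mate[OF assms(1)] mate_neq[OF assms(1)] unfolding sign_verts_def by auto
  have U: "sign_verts N \<kappa> \<sigma> = ?A \<union> mate a ` ?A"
  proof (intro equalityI subsetI)
    fix x assume x: "x \<in> sign_verts N \<kappa> \<sigma>"
    show "x \<in> ?A \<union> mate a ` ?A"
    proof (cases "x < mate a x")
      case False
      then have "mate a x < x" using mm(2)[OF x] by linarith
      then have "mate a x \<in> ?A" using cl[OF x] mm(1)[OF x] by simp
      then have "mate a (mate a x) \<in> mate a ` ?A" by (rule imageI)
      then show ?thesis using mm(1)[OF x] by simp
    qed (use x in simp)
  qed (use cl in auto)
  have "finite ?A" unfolding sign_verts_def by simp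
  moreover have "?A \<inter> mate a ` ?A = {}"
  proof (rule ccontr)
    assume "?A \<inter> mate a ` ?A \<noteq> {}"
    then obtain x where "x \<in> ?A" "mate a x \<in> ?A" by auto
    then show False using mm(1)[of x] by auto
  qed
  ultimately have "card (?A \<union> mate a ` ?A) = card ?A + card (mate a ` ?A)" by (intro card_Un_disjoint) auto
  moreover have "inj_on (mate a) ?A" by (rule inj_on_inverseI[of _ "mate a"]) (use mm(1) in simp)
  ultimately have "card (sign_verts N \<kappa> \<sigma>) = 2 * card ?A" using U by (simp add: card_image)
  moreover have "{pr \<in> cups a. pt \<kappa> (fst pr) = \<sigma>} = (\<lambda>x. (x, mate a x)) ` ?A"
    unfolding cups_eq_mate[OF assms(1)] sign_verts_def by auto
  then have "card {pr \<in> cups a. pt \<kappa> (fst pr) = \<sigma>} = card ?A"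
    by (simp add: card_image inj_on_def)
  ultimately show ?thesis by simp
qed

sublocale triple \<subseteq> ac: two_cupd N a c by unfold_locales (rule a c)+
sublocale triple \<subseteq> cd: two_cupd N c d by unfold_locales (rule c d)+
sublocale triple \<subseteq> ad: two_cupd N a d by unfold_locales (rule a d)+

section \<open>The stack before and after all surgeries\<close>

context triple
begin

lemma orb_start: "orbD {} (b, v) = {b} \<times> (if b then circle N c d v else circle N a c v)" if "v \<in> verts N" for b v
proof
  let ?C = "if b then circle N c d v else circle N a c v"
  have g: "middle {} w = (fst w, mate c (snd w))" for w unfolding middle_def endp_def by simp
  show "orbD {} (b, v) \<subseteq> {b} \<times> ?C"
    by (rule orb_least)
      (use that ac.circle_closed[OF that] cd.circle_closed[OF that] in \<open>auto simp: g outer_def split: if_splits\<close>)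
  have inv: "invol_on W (middle {})" using invol_middle by simp
  have bv: "(b, v) \<in> W" using that by (simp add: W_iff)
  have "?C \<subseteq> {k. (b, k) \<in> orbD {} (b, v)}"
  proof (cases b)
    case True
    have "orb (verts N) (mate c) (mate d) v \<subseteq> {k. (b, k) \<in> orbD {} (b, v)}"
    proof (rule orb_least)
      fix x assume "x \<in> {k. (b, k) \<in> orbD {} (b, v)}"
      then show "mate c x \<in> {k. (b, k) \<in> orbD {} (b, v)} \<and> mate d x \<in> {k. (b, k) \<in> orbD {} (b, v)}"
        using orb_closed(2,3)[OF invol_outer inv bv, of "(b, x)"] True by (simp add: g outer_def)
    qed simp
    then show ?thesis using True unfolding circle_def by simp
  next
    case False
    have "orb (verts N) (mate a) (mate c) v \<subseteq> {k. (b, k) \<in> orbD {} (b, v)}"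
    proof (rule orb_least)
      fix x assume "x \<in> {k. (b, k) \<in> orbD {} (b, v)}"
      then show "mate a x \<in> {k. (b, k) \<in> orbD {} (b, v)} \<and> mate c x \<in> {k. (b, k) \<in> orbD {} (b, v)}"
        using orb_closed(2,3)[OF invol_outer inv bv, of "(b, x)"] False by (simp add: g outer_def)
    qed simp
    then show ?thesis using False unfolding circle_def by simp
  qed
  then show "{b} \<times> ?C \<subseteq> orbD {} (b, v)" by auto
qed

lemma endp_all: "v \<in> verts N \<Longrightarrow> endp (cups c) v"
  using mate_cups[OF c, of v] unfolding endp_def by auto

lemma middle_end: "v \<in> verts N \<Longrightarrow> middle (cups c) (b, v) = (\<not> b, v)"
  unfolding middle_def using endp_all by simp

lemma orb_end: "orbD (cups c) (b, v) = UNIV \<times> circle N a d v" if "v \<in> verts N" for b v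
proof
  show "orbD (cups c) (b, v) \<subseteq> UNIV \<times> circle N a d v"
    by (rule orb_least) (use that ad.circle_closed[OF that] middle_end in \<open>auto simp: outer_def W_iff\<close>)
  have inv: "invol_on W (middle (cups c))" using invol_middle by simp
  have bv: "(b, v) \<in> W" using that by (simp add: W_iff)
  note cl = orb_closed[OF invol_outer inv bv]
  have opp: "(b', x) \<in> orbD (cups c) (b, v)" if "(b'', x) \<in> orbD (cups c) (b, v)" for b' b'' x
  proof (cases "b' = b''")
    case False
    have "x \<in> verts N" using cl(1)[OF that] by (simp add: W_iff)
    then have "middle (cups c) (b'', x) = (b', x)" using middle_end False by simp
    then show ?thesis using cl(3)[OF that] by simp
  qed (use that in simp)
  have "orb (verts N) (mate a) (mate d) v \<subseteq> {k. \<forall>b'. (b', k) \<in> orbD (cups c) (b, v)}"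
  proof (rule orb_least)
    show "v \<in> {k. \<forall>b'. (b', k) \<in> orbD (cups c) (b, v)}" using opp[of b v] by simp
    fix x assume x: "x \<in> {k. \<forall>b'. (b', k) \<in> orbD (cups c) (b, v)}"
    have "(False, mate a x) \<in> orbD (cups c) (b, v)" "(True, mate d x) \<in> orbD (cups c) (b, v)"
      using cl(2)[of "(False, x)"] cl(2)[of "(True, x)"] x by (simp_all add: outer_def)
    then show "mate a x \<in> {k. \<forall>b'. (b', k) \<in> orbD (cups c) (b, v)} \<and> mate d x \<in> {k. \<forall>b'. (b', k) \<in> orbD (cups c) (b, v)}"
      using opp by blast
  qed
  then show "UNIV \<times> circle N a d v \<subseteq> orbD (cups c) (b, v)" unfolding circle_def by auto
qed

definition point :: "weight \<Rightarrow> state" where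
  "point \<kappa> v \<longleftrightarrow> v \<in> W \<and> pt \<kappa> (snd v)"

lemma point_end: "\<kappa> \<in> Ors N a d \<Longrightarrow> point \<kappa> \<in> stage (cups c)"
  unfolding stage_def point_def Ors_def
  using pt_flip[OF a, of \<kappa>] pt_flip[OF d, of \<kappa>] invol_onD(1)[OF invol_outer] invol_onD(1)[OF invol_middle[of "cups c"]]
  by (auto simp: outer_def middle_end W_iff)

text \<open>Origin of the support condition in the deformed product: a point of the glued diagram
  can be carried back to the uncut stack exactly if it also orients c.\<close>

lemma point_start: "\<kappa> \<in> Ors N a d \<Longrightarrow> point \<kappa> \<in> stage {} \<longleftrightarrow> \<kappa> \<in> Or N c"
proof -
  assume k: "\<kappa> \<in> Ors N a d"
  have ka: "\<kappa> \<in> Or N a" using k unfolding Ors_def by simp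
  have g: "middle {} w = (fst w, mate c (snd w))" for w unfolding middle_def endp_def by simp
  have outer: "point \<kappa> (outer v) = point \<kappa> v" if "v \<in> W" for v using point_end[OF k] that unfolding stage_def by simp
  have "point \<kappa> \<in> stage {} \<longleftrightarrow> (\<forall>v\<in>W. point \<kappa> (middle {} v) = point \<kappa> v)"
    unfolding stage_def using outer by (auto simp: point_def)
  also have "\<dots> \<longleftrightarrow> (\<forall>v\<in>verts N. pt \<kappa> (mate c v) = pt \<kappa> v)"
    unfolding W_def by (auto simp: point_def g W_def mate_verts[OF c])
  also have "\<dots> \<longleftrightarrow> flips (verts N) (mate c) (\<lambda>v. \<kappa> v = Up)"
    using parity_flips[OF c] unfolding flips_def pt_def by auto
  also have "\<dots> \<longleftrightarrow> \<kappa> \<in> Or N c"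
    unfolding Or_iff[OF c] using OrD(1,2)[OF a ka] by auto
  finally show ?thesis .
qed

lemma norb_end:
  assumes "\<kappa> \<in> Ors N a d"
  shows "norb W outer (middle (cups c)) {v \<in> W. point \<kappa> v = \<sigma>} = num_circles N a d \<kappa> \<sigma>"
proof -
  have s: "{v \<in> W. point \<kappa> v = \<sigma>} = UNIV \<times> sign_verts N \<kappa> \<sigma>" unfolding point_def sign_verts_def W_def by auto
  have "orbD (cups c) ` ((UNIV :: bool set) \<times> sign_verts N \<kappa> \<sigma>) = (\<lambda>w. (UNIV :: bool set) \<times> circle N a d (snd w)) ` ((UNIV :: bool set) \<times> sign_verts N \<kappa> \<sigma>)"
    by (rule image_cong[OF refl]) (auto simp: sign_verts_def orb_end)
  also have "\<dots> = (\<lambda>C. (UNIV :: bool set) \<times> C) ` (circle N a d ` (snd ` ((UNIV :: bool set) \<times> sign_verts N \<kappa> \<sigma>)))"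
    by (simp only: image_image)
  finally have "orbD (cups c) ` ((UNIV :: bool set) \<times> sign_verts N \<kappa> \<sigma>) = (\<lambda>C. (UNIV :: bool set) \<times> C) ` (circle N a d ` sign_verts N \<kappa> \<sigma>)"
    by simp
  moreover have "card ((\<lambda>C. (UNIV :: bool set) \<times> C) ` X) = card X" for X :: "int set set"
    by (intro card_image inj_times) simp
  ultimately have "norb W outer (middle (cups c)) {v \<in> W. point \<kappa> v = \<sigma>} = card (circle N a d ` sign_verts N \<kappa> \<sigma>)"
    unfolding norb_def s by simp
  also have "\<dots> = num_circles N a d \<kappa> \<sigma>" using ad.norb_num_circles[OF assms] unfolding norb_def circle_def .
  finally show ?thesis .
qed

lemma norb_start:
  assumes "\<kappa> \<in> Ors N a d" "\<kappa> \<in> Or N c"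
  shows "norb W outer (middle {}) {v \<in> W. point \<kappa> v = \<sigma>} = num_circles N a c \<kappa> \<sigma> + num_circles N c d \<kappa> \<sigma>"
proof -
  let ?A = "(\<lambda>C. {False} \<times> C) ` (circle N a c ` sign_verts N \<kappa> \<sigma>)" and ?B = "(\<lambda>C. {True} \<times> C) ` (circle N c d ` sign_verts N \<kappa> \<sigma>)"
  have s: "{v \<in> W. point \<kappa> v = \<sigma>} = Pair False ` sign_verts N \<kappa> \<sigma> \<union> Pair True ` sign_verts N \<kappa> \<sigma>" unfolding point_def sign_verts_def W_def by auto
  have "orbD {} ` (Pair False ` sign_verts N \<kappa> \<sigma>) = ?A" "orbD {} ` (Pair True ` sign_verts N \<kappa> \<sigma>) = ?B"
    unfolding image_image by (rule image_cong[OF refl], simp add: sign_verts_def orb_start)+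
  then have "norb W outer (middle {}) {v \<in> W. point \<kappa> v = \<sigma>} = card (?A \<union> ?B)" unfolding norb_def s by (simp add: image_Un)
  also have "\<dots> = card ?A + card ?B"
  proof (rule card_Un_disjoint)
    show "?A \<inter> ?B = {}"
    proof (rule ccontr)
      assume "?A \<inter> ?B \<noteq> {}"
      then obtain x y where "{False} \<times> circle N a c x = {True} \<times> circle N c d y" by auto
      then show False using ac.circle_self[of x] by (auto simp: times_eq_iff simp del: ac.circle_self)
    qed
  qed (simp_all add: sign_verts_def)
  also have "card ?A = card (circle N a c ` sign_verts N \<kappa> \<sigma>)" by (intro card_image inj_times) simp
  also have "card ?B = card (circle N c d ` sign_verts N \<kappa> \<sigma>)" by (intro card_image inj_times) simp
  finally show ?thesis using ac.norb_num_circles[of \<kappa> \<sigma>] cd.norb_num_circles[of \<kappa> \<sigma>] assms unfolding Ors_def norb_def circle_def by simp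
qed

text \<open>At both ends of the process the components are circles of the given diagrams, so the
  exponents found in \<open>iter_factor_eval\<close> are \<open>split_count\<close>, whatever the
  order of \<open>prs\<close>.\<close>

lemma iter_factor_euler:
  assumes "\<kappa> \<in> Ors N a d" "distinct prs" "set prs = cups c"
  shows "iter_factor {} prs F (point \<kappa>) = (if \<kappa> \<in> Or N c then F (point \<kappa>) * euler t N a c d \<kappa> else 0)"
    and "\<kappa> \<in> Or N c \<Longrightarrow> 2 * split_count N a c d \<kappa> \<sigma> + num_circles N a c \<kappa> \<sigma> + num_circles N c d \<kappa> \<sigma> = card (sign_verts N \<kappa> \<sigma>) div 2 + num_circles N a d \<kappa> \<sigma>"
proof -
  have "point \<kappa> \<in> stage ({} \<union> set prs)" using point_end[OF assms(1)] assms(3) by simp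
  from iter_factor_eval[OF _ _ assms(2) _ this, of F] assms(3)
  obtain s :: "bool \<Rightarrow> nat" where s: "iter_factor {} prs F (point \<kappa>) = (if point \<kappa> \<in> stage {} then F (point \<kappa>) * t ^ s True * (- t) ^ s False else 0)"
    "\<And>\<sigma>. point \<kappa> \<in> stage {} \<Longrightarrow> 2 * s \<sigma> + norb W outer (middle {}) {v \<in> W. point \<kappa> v = \<sigma>}
      = norb W outer (middle (cups c)) {v \<in> W. point \<kappa> v = \<sigma>} + card {pr \<in> cups c. point \<kappa> (False, fst pr) = \<sigma>}"
    by auto
  have e: "2 * s \<sigma> + (num_circles N a c \<kappa> \<sigma> + num_circles N c d \<kappa> \<sigma>) = card (sign_verts N \<kappa> \<sigma>) div 2 + num_circles N a d \<kappa> \<sigma>" if k: "\<kappa> \<in> Or N c" for \<sigma>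
  proof -
    have "{pr \<in> cups c. point \<kappa> (False, fst pr) = \<sigma>} = {pr \<in> cups c. pt \<kappa> (fst pr) = \<sigma>}"
      using cup_verts(1)[OF c] by (auto simp: point_def W_iff)
    then show ?thesis
      using s(2)[of \<sigma>] k point_start[OF assms(1)] card_sign_verts_even[OF c k, of \<sigma>]
      unfolding norb_end[OF assms(1)] norb_start[OF assms(1) k] by simp
  qed
  then have ex: "split_count N a c d \<kappa> \<sigma> = s \<sigma>" if "\<kappa> \<in> Or N c" for \<sigma>
    unfolding split_count_def e[OF that, symmetric] by simp
  show "iter_factor {} prs F (point \<kappa>) = (if \<kappa> \<in> Or N c then F (point \<kappa>) * euler t N a c d \<kappa> else 0)"
    using s(1) point_start[OF assms(1)] ex unfolding euler_def by auto
  show "\<kappa> \<in> Or N c \<Longrightarrow> 2 * split_count N a c d \<kappa> \<sigma> + num_circles N a c \<kappa> \<sigma> + num_circles N c d \<kappa> \<sigma> = card (sign_verts N \<kappa> \<sigma>) div 2 + num_circles N a d \<kappa> \<sigma>"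
    using e[of \<sigma>] ex[of \<sigma>] by linarith
qed

end

section \<open>Passing between monomials and the deformed basis\<close>

context triple
begin

lemma monomial_prod:
  assumes D: "D \<subseteq> cups c" and s: "s \<in> stage D"
  shows "monomial D s \<theta> = (\<Prod>C\<in>orbD D ` {v. s v}. t * of_bool (C \<subseteq> {v. \<theta> v}))"
proof (cases "{v. s v} \<subseteq> {v. \<theta> v}")
  case True
  have "orbD D v \<subseteq> {v. s v}" if "s v" for v
  proof -
    have "v \<in> W" using stage_W[OF s] that by blast
    then show ?thesis using stage_orb[OF s] that by blast
  qed
  then have "(\<Prod>C\<in>orbD D ` {v. s v}. t * of_bool (C \<subseteq> {v. \<theta> v})) = (\<Prod>C\<in>orbD D ` {v. s v}. t)"
    using True by (intro prod.cong refl) (auto simp del: of_bool_eq_1_iff)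
  then show ?thesis using True unfolding monomial_def norb_def by auto
next
  case False
  then obtain v where v: "s v" "\<not> \<theta> v" by auto
  then have "\<not> orbD D v \<subseteq> {v. \<theta> v}" using orb_self[of v W outer "middle D"] by blast
  then have z: "t * of_bool (orbD D v \<subseteq> {v. \<theta> v}) = 0" by simp
  have "finite (orbD D ` {v. s v})" using finite_subset[OF stage_W[OF s] finite_W] by simp
  moreover have "orbD D v \<in> orbD D ` {v. s v}" using v(1) by simp
  ultimately have "(\<Prod>C\<in>orbD D ` {v. s v}. t * of_bool (C \<subseteq> {v. \<theta> v})) = 0"
    using z by (intro prod_zero) blast+
  moreover have "\<not> (\<forall>v. s v \<longrightarrow> \<theta> v)" using v by blast
  then have "monomial D s \<theta> = 0" by (simp only: monomial_def if_False)
  ultimately show ?thesis by simp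
qed

text \<open>By \<open>prod_add_split\<close> a product of shifted variables differs from the
  monomial by t times monomials of smaller sets of components.\<close>

lemma shift_span:
  assumes D: "D \<subseteq> cups c" and s: "s \<in> stage D"
  shows "tspan D (\<lambda>\<theta>. (\<Prod>C\<in>orbD D ` {v. s v}. t * of_bool (C \<subseteq> {v. \<theta> v}) + t * e C) - monomial D s \<theta>)"
proof -
  let ?K = "orbD D ` {v. s v}" and ?f = "\<lambda>\<theta> C. t * of_bool (C \<subseteq> {v. \<theta> v})"
  have fin: "finite ?K" using finite_subset[OF stage_W[OF s] finite_W] by simp
  note inv = invol_outer invol_middle[OF D]
  define sB :: "vert set set \<Rightarrow> state" where "sB B v \<longleftrightarrow> v \<in> \<Union> B" for B v
  have sB: "sB B \<in> stage D" "orbD D ` {v. sB B v} = B" if B: "B \<subseteq> ?K" for B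
  proof -
    have C: "C \<subseteq> W" "\<And>x. x \<in> C \<Longrightarrow> outer x \<in> C" "\<And>x. x \<in> C \<Longrightarrow> middle D x \<in> C" "\<And>x. x \<in> C \<Longrightarrow> orbD D x = C" "C \<noteq> {}" if "C \<in> B" for C
    proof -
      obtain v where v: "s v" "C = orbD D v" using B \<open>C \<in> B\<close> by auto
      then have vW: "v \<in> W" using stage_W[OF s] by blast
      show "C \<subseteq> W" unfolding v using orb_closed(1)[OF inv vW] by blast
      show "outer x \<in> C" "middle D x \<in> C" "orbD D x = C" if "x \<in> C" for x
        using that orb_closed(2,3)[OF inv vW] orb_eq[OF inv] unfolding v by auto
      show "C \<noteq> {}" using v orb_self[of v W outer "middle D"] by blast
    qed
    have cl: "sB B v \<Longrightarrow> v \<in> W \<and> sB B (outer v) \<and> sB B (middle D v)" for v unfolding sB_def using C by blast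
    show "sB B \<in> stage D" unfolding stage_def
    proof (intro CollectI conjI allI impI ballI)
      show "\<not> sB B v" if "v \<notin> W" for v using cl that by blast
      fix v assume v: "v \<in> W"
      show "sB B (outer v) = sB B v" using cl[of v] cl[of "outer v"] invol_onD(2)[OF inv(1) v] by auto
      show "sB B (middle D v) = sB B v" using cl[of v] cl[of "middle D v"] invol_onD(2)[OF inv(2) v] by auto
    qed
    show "orbD D ` {v. sB B v} = B"
    proof (intro equalityI subsetI)
      fix C assume "C \<in> orbD D ` {v. sB B v}"
      then obtain v C' where "C' \<in> B" "v \<in> C'" "C = orbD D v" unfolding sB_def by auto
      then show "C \<in> B" using C(4) by simp
    next
      fix x assume x: "x \<in> B"
      then obtain v where v: "v \<in> x" using C(5) by blast
      then have "sB B v" "orbD D v = x" unfolding sB_def using x C(4) by auto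
      then show "x \<in> orbD D ` {v. sB B v}" by blast
    qed
  qed
  have X: "prod (?f \<theta>) B = monomial D (sB B) \<theta>" if "B \<subseteq> ?K" for B \<theta>
    using monomial_prod[OF D sB(1)[OF that], of \<theta>] sB(2)[OF that] by simp
  have "tspan D (\<lambda>\<theta>. \<Sum>B\<in>Pow ?K - {?K}. (t ^ (card (?K - B) - 1) * prod e (?K - B)) * (t * monomial D (sB B) \<theta>))"
    using fin sB(1) by (intro multiple_span_sum multiple_span_scale tspan_X) auto
  then show ?thesis
  proof (rule multiple_span_cong)
    fix \<theta>
    have "(\<Prod>C\<in>?K. ?f \<theta> C + t * e C) - monomial D s \<theta>
      = (\<Sum>B\<in>Pow ?K - {?K}. t * (t ^ (card (?K - B) - 1) * prod e (?K - B)) * prod (?f \<theta>) B)"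
      unfolding monomial_prod[OF D s] by (subst prod_add_split[OF fin]) simp
    also have "\<dots> = (\<Sum>B\<in>Pow ?K - {?K}. (t ^ (card (?K - B) - 1) * prod e (?K - B)) * (t * monomial D (sB B) \<theta>))"
      by (rule sum.cong[OF refl]) (use X in simp)
    finally show "(\<Prod>C\<in>?K. ?f \<theta> C + t * e C) - monomial D s \<theta>
      = (\<Sum>B\<in>Pow ?K - {?K}. (t ^ (card (?K - B) - 1) * prod e (?K - B)) * (t * monomial D (sB B) \<theta>))" .
  qed
qed

lemma st0_iff:
  assumes "la \<in> Ors N a c" "\<mu> \<in> Ors N c d"
  shows "st0 a c d la \<mu> (b, v) \<longleftrightarrow> v \<in> verts N \<and>
    (if b then \<mu> (Min (circle N c d v)) = Up else la (Min (circle N a c v)) = Up)"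
proof (cases "v \<in> verts N")
  case True
  have "snd ` ({b} \<times> C) = C" for C :: "int set" by simp
  then show ?thesis unfolding st0_def using True by (simp add: scomp_eq orb_start)
next
  case False
  then have "orbD {} (b, v) = {(b, v)}" by (intro orb_outside) (simp add: W_iff)
  moreover have "la v = Circ" "\<mu> v = Circ" using OrD(1)[OF c] False assms unfolding Ors_def by auto
  ultimately show ?thesis unfolding st0_def using False by (simp add: scomp_eq)
qed

lemma st0_stage:
  assumes "la \<in> Ors N a c" "\<mu> \<in> Ors N c d"
  shows "st0 a c d la \<mu> \<in> stage {}"
  unfolding stage_def
proof (intro CollectI conjI allI impI ballI)
  have g: "middle {} w = (fst w, mate c (snd w))" for w unfolding middle_def endp_def by simp
  fix v :: vert
  obtain b k where v: "v = (b, k)" by (metis surj_pair)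
  show "\<not> st0 a c d la \<mu> v" if "v \<notin> W" using that st0_iff[OF assms] v by (simp add: W_iff)
  assume "v \<in> W"
  then have k: "k \<in> verts N" using v by (simp add: W_iff)
  show "st0 a c d la \<mu> (outer v) = st0 a c d la \<mu> v" "st0 a c d la \<mu> (middle {} v) = st0 a c d la \<mu> v"
    unfolding v outer_def g using k st0_iff[OF assms] ac.circle_mate[OF k] cd.circle_mate[OF k]
      mate_verts[OF a k] mate_verts[OF c k] mate_verts[OF d k] by simp_all
qed

lemma subset_point:
  assumes "closed_cupd N x" "closed_cupd N y" "\<kappa> \<in> Ors N x y" "C \<in> circles N x y" "B \<noteq> {}"
  shows "B \<times> C \<subseteq> {v. point \<kappa> v} \<longleftrightarrow> pt \<kappa> (Min C)"
proof -
  interpret xy: two_cupd N x y by unfold_locales (rule assms)+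
  have "B \<times> C \<subseteq> {v. point \<kappa> v} \<longleftrightarrow> (\<forall>v\<in>C. pt \<kappa> v)"
    unfolding point_def W_def using xy.circles_props(3)[OF assms(4)] assms(5) by auto
  also have "\<dots> \<longleftrightarrow> pt \<kappa> (Min C)"
    using xy.pt_circle[OF assms(3,4)] xy.circles_props(4)[OF assms(4)] by blast
  finally show ?thesis .
qed

lemma cw_factor_eq: "cw_factor t \<kappa> C = t * of_bool (pt \<kappa> (Min C)) - t * of_bool (odd (Min C))"
  unfolding cw_factor_def pt_def by auto

text \<open>The uncut stack is a disjoint union of two circle diagrams, and the parity shift of each
  component is that of its leftmost vertex. So its shifted product splits into the two deformed
  basis vectors.\<close>

lemma start_prod:
  assumes l: "la \<in> Ors N a c" and m: "\<mu> \<in> Ors N c d" and k: "\<kappa> \<in> Ors N a d" "\<kappa> \<in> Or N c"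
  shows "(\<Prod>C\<in>orbD {} ` {v. st0 a c d la \<mu> v}. t * of_bool (C \<subseteq> {v. point \<kappa> v}) + t * - of_bool (odd (Min (snd ` C))))
    = dbasis t N a c la \<kappa> * dbasis t N c d \<mu> \<kappa>"
proof -
  let ?g = "\<lambda>C. t * of_bool (C \<subseteq> {v. point \<kappa> v}) + t * - of_bool (odd (Min (snd ` C)))"
  let ?A = "(\<lambda>C. {False} \<times> C) ` cw N a c la" and ?B = "(\<lambda>C. {True} \<times> C) ` cw N c d \<mu>"
  let ?FA = "{v \<in> verts N. la (Min (circle N a c v)) = Up}" and ?FB = "{v \<in> verts N. \<mu> (Min (circle N c d v)) = Up}"
  have s: "{v. st0 a c d la \<mu> v} = Pair False ` ?FA \<union> Pair True ` ?FB"
    using st0_iff[OF l m] by (auto split: if_splits)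
  have "orbD {} ` (Pair False ` ?FA) = (\<lambda>C. {False} \<times> C) ` (circle N a c ` ?FA)"
    "orbD {} ` (Pair True ` ?FB) = (\<lambda>C. {True} \<times> C) ` (circle N c d ` ?FB)"
    unfolding image_image by (rule image_cong[OF refl], simp add: orb_start)+
  moreover have "circle N a c ` ?FA = cw N a c la" "circle N c d ` ?FB = cw N c d \<mu>"
    unfolding cw_def circles_def by auto
  ultimately have K: "orbD {} ` {v. st0 a c d la \<mu> v} = ?A \<union> ?B" unfolding s by (simp add: image_Un)
  have disj: "?A \<inter> ?B = {}"
  proof (rule ccontr)
    assume "?A \<inter> ?B \<noteq> {}"
    then obtain C C' where "C \<in> cw N a c la" "{False} \<times> C = {True} \<times> C'" by auto
    then show False using ac.circles_props(2)[of C] unfolding cw_def by (auto simp: times_eq_iff)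
  qed
  have sn: "snd ` ({b} \<times> C) = C" for b :: bool and C :: "int set" by simp
  have kk: "\<kappa> \<in> Ors N a c" "\<kappa> \<in> Ors N c d" using k unfolding Ors_def by auto
  have "prod ?g (?A \<union> ?B) = prod ?g ?A * prod ?g ?B"
    by (rule prod.union_disjoint) (use disj in auto)
  also have "prod ?g ?A = dbasis t N a c la \<kappa>"
    unfolding dbasis_def
    by (subst prod.reindex[OF inj_times])
      (auto simp: sn cw_def cw_factor_eq subset_point[OF a c kk(1)] intro!: prod.cong)
  also have "prod ?g ?B = dbasis t N c d \<mu> \<kappa>"
    unfolding dbasis_def
    by (subst prod.reindex[OF inj_times])
      (auto simp: sn cw_def cw_factor_eq subset_point[OF c d kk(2)] intro!: prod.cong)
  finally show ?thesis unfolding K .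
qed

text \<open>\<open>nu\<close> is a definite description: existence comes from
  \<open>Or_exists\<close>, uniqueness from \<open>cw_inj\<close>.\<close>

lemma nu_cw:
  assumes s: "s \<in> stage (cups c)" and l: "la \<in> Ors N a c"
  shows "nu a c d la s \<in> Ors N a d" "cw N a d (nu a c d la s) = {C \<in> circles N a d. s (False, Min C)}"
proof -
  let ?S = "{C \<in> circles N a d. s (False, Min C)}"
  have fr: "free a k \<longleftrightarrow> k \<notin> verts N" for k by (rule closed_cupd_free[OF a])
  have lC: "la k = Circ" if "k \<notin> verts N" for k using l OrD(1)[OF a] that unfolding Ors_def by auto
  have sn: "snd ` (UNIV \<times> C) = C" for C :: "int set" by simp
  have mn: "Min (snd ` scomp a c d (cups c) (False, k)) = Min (circle N a d k)" if "k \<in> verts N" for k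
    using that by (simp add: scomp_eq orb_end sn)
  have sk: "s (False, k) = s (False, Min (circle N a d k))" if k: "k \<in> verts N" for k
  proof -
    have "(False, Min (circle N a d k)) \<in> orbD (cups c) (False, k)"
      using orb_end[OF k] ad.circles_props(4)[OF ad.circle_in[OF k]] by simp
    from stage_orb[OF s _ this] show ?thesis by (simp add: W_iff k)
  qed
  have P: "(oriented a n \<and> oriented d n \<and> (\<forall>k. free a k \<longrightarrow> n k = la k)
     \<and> (\<forall>k. \<not> free a k \<longrightarrow> (n (Min (snd ` scomp a c d (cups c) (False,k))) = Up \<longleftrightarrow> s (False,k))))
    \<longleftrightarrow> n \<in> Ors N a d \<and> cw N a d n = ?S" (is "?P n \<longleftrightarrow> ?Q n") for n
  proof -
    have "(\<forall>k. \<not> free a k \<longrightarrow> (n (Min (snd ` scomp a c d (cups c) (False,k))) = Up \<longleftrightarrow> s (False,k)))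
      \<longleftrightarrow> (\<forall>k\<in>verts N. n (Min (circle N a d k)) = Up \<longleftrightarrow> s (False, Min (circle N a d k)))"
      unfolding fr using mn sk by auto
    also have "\<dots> \<longleftrightarrow> cw N a d n = ?S" unfolding cw_def circles_def by auto
    finally show ?thesis unfolding fr Ors_def Or_def using lC by auto
  qed
  obtain n where n: "?Q n" using ad.Or_exists[of ?S] unfolding Ors_def by auto
  have "?Q (nu a c d la s)"
    unfolding nu_def P
  proof (rule theI[of ?Q, OF n])
    fix x assume x: "?Q x"
    then show "x = n" using n ad.cw_inj unfolding Ors_def by auto
  qed
  then show "nu a c d la s \<in> Ors N a d" "cw N a d (nu a c d la s) = ?S" by auto
qed

abbreviation "bspan \<equiv> multiple_span t (Ors N a d) (dbasis t N a d) (Ors N a d)"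

text \<open>The change of basis at the other end: on the points of the glued diagram a monomial
  differs from the deformed basis vector of its weight by t times deformed basis vectors.\<close>

lemma final_span:
  assumes s: "s \<in> stage (cups c)" and l: "la \<in> Ors N a c"
  shows "bspan (\<lambda>\<kappa>. monomial (cups c) s (point \<kappa>) - dbasis t N a d (nu a c d la s) \<kappa>)"
proof -
  let ?n = "nu a c d la s"
  let ?K = "cw N a d ?n"
  note n = nu_cw[OF s l]
  have sV: "v \<in> verts N" if "s (b, v)" for b v
  proof -
    have "(b, v) \<in> W" using stage_W[OF s] that by blast
    then show ?thesis by (simp add: W_iff)
  qed
  have sb: "s (b, v) = s (False, Min (circle N a d v))" if v: "v \<in> verts N" for b v
  proof -
    have "(False, Min (circle N a d v)) \<in> orbD (cups c) (b, v)"
      using orb_end[OF v] ad.circles_props(4)[OF ad.circle_in[OF v]] by simp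
    from stage_orb[OF s _ this] show ?thesis by (simp add: W_iff v)
  qed
  have K: "orbD (cups c) ` {v. s v} = (\<lambda>C. (UNIV :: bool set) \<times> C) ` ?K"
  proof (intro equalityI subsetI)
    fix E assume "E \<in> orbD (cups c) ` {v. s v}"
    then obtain b v where bv: "s (b, v)" "E = orbD (cups c) (b, v)" by auto
    have v: "v \<in> verts N" using sV bv by auto
    have "circle N a d v \<in> ?K" unfolding n(2) using sb[OF v] bv ad.circle_in[OF v] by auto
    then show "E \<in> (\<lambda>C. (UNIV :: bool set) \<times> C) ` ?K" using bv orb_end[OF v] by auto
  next
    fix E assume "E \<in> (\<lambda>C. (UNIV :: bool set) \<times> C) ` ?K"
    then obtain C where C: "C \<in> circles N a d" "s (False, Min C)" "E = UNIV \<times> C" unfolding n(2) by auto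
    have "orbD (cups c) (False, Min C) = E" using orb_end[of "Min C"] ad.circles_props[OF C(1)] C(3) by simp
    then show "E \<in> orbD (cups c) ` {v. s v}" using C(2) by blast
  qed
  have X: "monomial (cups c) s (point \<kappa>) = (\<Prod>C\<in>?K. cw_factor t \<kappa> C + t * of_bool (odd (Min C)))" if "\<kappa> \<in> Ors N a d" for \<kappa>
  proof -
    have "monomial (cups c) s (point \<kappa>) = (\<Prod>C\<in>(\<lambda>C. (UNIV :: bool set) \<times> C) ` ?K. t * of_bool (C \<subseteq> {v. point \<kappa> v}))"
      unfolding K[symmetric] by (rule monomial_prod[OF subset_refl s])
    also have "\<dots> = (\<Prod>C\<in>?K. t * of_bool ((UNIV :: bool set) \<times> C \<subseteq> {v. point \<kappa> v}))"
      by (subst prod.reindex[OF inj_times]) auto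
    also have "\<dots> = (\<Prod>C\<in>?K. cw_factor t \<kappa> C + t * of_bool (odd (Min C)))"
      by (intro prod.cong refl) (auto simp: cw_factor_eq cw_def subset_point[OF a d that])
    finally show ?thesis .
  qed
  have fin: "finite ?K" by simp
  have "\<exists>\<nu>. \<nu> \<in> Ors N a d \<and> cw N a d \<nu> = B" if "B \<subseteq> ?K" for B
  proof -
    have "B \<subseteq> circles N a d" using that unfolding cw_def by auto
    then show ?thesis using ad.Or_exists[of B] unfolding Ors_def by blast
  qed
  then obtain nB where nB: "\<And>B. B \<subseteq> ?K \<Longrightarrow> nB B \<in> Ors N a d" "\<And>B. B \<subseteq> ?K \<Longrightarrow> cw N a d (nB B) = B" by metis
  let ?e = "\<lambda>C. of_bool (odd (Min C)) :: int"
  have "bspan (\<lambda>\<kappa>. \<Sum>B\<in>Pow ?K - {?K}. (t ^ (card (?K - B) - 1) * prod ?e (?K - B)) * (t * dbasis t N a d (nB B) \<kappa>))"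
    using nB(1) by (intro multiple_span_sum multiple_span_scale multiple_span_basis) auto
  then show ?thesis
  proof (rule multiple_span_cong)
    fix \<kappa> assume k: "\<kappa> \<in> Ors N a d"
    have "monomial (cups c) s (point \<kappa>) - dbasis t N a d ?n \<kappa>
      = (\<Sum>B\<in>Pow ?K - {?K}. t * (t ^ (card (?K - B) - 1) * prod ?e (?K - B)) * prod (cw_factor t \<kappa>) B)"
      unfolding X[OF k] prod_add_split[OF fin] dbasis_def[of t N a d ?n] by simp
    also have "\<dots> = (\<Sum>B\<in>Pow ?K - {?K}. (t ^ (card (?K - B) - 1) * prod ?e (?K - B)) * (t * dbasis t N a d (nB B) \<kappa>))"
      by (rule sum.cong[OF refl]) (use nB(2) in \<open>simp add: dbasis_def\<close>)
    finally show "monomial (cups c) s (point \<kappa>) - dbasis t N a d ?n \<kappa>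
      = (\<Sum>B\<in>Pow ?K - {?K}. (t ^ (card (?K - B) - 1) * prod ?e (?K - B)) * (t * dbasis t N a d (nB B) \<kappa>))" .
  qed
qed

text \<open>Three congruences modulo t are chained: shifted products against monomials on the uncut
  stack, the surgeries, and monomials against basis vectors on the glued diagram. The total error is
  t times a combination of basis vectors, so it can be absorbed into the coefficients
  \<open>C\<close>, and the expansion becomes exact.\<close>

theorem hprod_deformed:
  assumes l: "la \<in> Ors N a c" and m: "\<mu> \<in> Ors N c d"
  obtains C where
    "\<And>\<kappa>. \<kappa> \<in> Ors N a d \<Longrightarrow> (\<Sum>\<nu>\<in>Ors N a d. C \<nu> * dbasis t N a d \<nu> \<kappa>)
      = (if \<kappa> \<in> Or N c then dbasis t N a c la \<kappa> * dbasis t N c d \<mu> \<kappa> * euler t N a c d \<kappa> else 0)"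
    "\<And>\<nu>. t dvd C \<nu> - diag_coeff (a, la, Cap c) (c, \<mu>, Cap d) (a, \<nu>, Cap d)"
proof -
  define prs where "prs = sorted_list_of_set (cups c)"
  have prs: "set prs = cups c" "distinct prs" unfolding prs_def using finite_cups[OF c] by auto
  define s0 where "s0 = st0 a c d la \<mu>"
  have s0: "s0 \<in> stage {}" unfolding s0_def by (rule st0_stage[OF l m])
  define Lf where "Lf = surg a c d {} prs [(1, s0)]"
  define F0 where "F0 \<theta> = (\<Prod>C\<in>orbD {} ` {v. s0 v}. t * of_bool (C \<subseteq> {v. \<theta> v}) + t * - of_bool (odd (Min (snd ` C))))" for \<theta>
  have "tspan {} (\<lambda>\<theta>. F0 \<theta> - monomial {} s0 \<theta>)" unfolding F0_def by (rule shift_span[OF _ s0]) simp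
  then have "tspan {} (\<lambda>\<theta>. F0 \<theta> - eval_list {} [(1, s0)] \<theta>)" by simp
  then have "(\<forall>(k, s)\<in>set Lf. s \<in> stage ({} \<union> set prs)) \<and>
    tspan ({} \<union> set prs) (\<lambda>\<theta>. iter_factor {} prs F0 \<theta> - eval_list ({} \<union> set prs) Lf \<theta>)"
    unfolding Lf_def using prs s0 by (intro surg_correct) auto
  then have Lst: "\<And>k s. (k, s) \<in> set Lf \<Longrightarrow> s \<in> stage (cups c)"
    and sp: "tspan (cups c) (\<lambda>\<theta>. iter_factor {} prs F0 \<theta> - eval_list (cups c) Lf \<theta>)" unfolding prs by auto
  obtain h where h: "\<And>\<theta>. \<theta> \<in> stage (cups c) \<Longrightarrow> iter_factor {} prs F0 \<theta> - eval_list (cups c) Lf \<theta> = t * (\<Sum>s\<in>stage (cups c). h s * monomial (cups c) s \<theta>)"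
    using sp unfolding multiple_span_def by auto
  let ?nu = "nu a c d la" and ?X = "\<lambda>s \<kappa>. monomial (cups c) s (point \<kappa>)" and ?b = "dbasis t N a d"
  have b1: "bspan (\<lambda>\<kappa>. t * ?X s \<kappa>)" if s: "s \<in> stage (cups c)" for s
  proof -
    have "bspan (\<lambda>\<kappa>. t * (?X s \<kappa> - ?b (?nu s) \<kappa>) + t * ?b (?nu s) \<kappa>)"
      using nu_cw(1)[OF s l] by (intro multiple_span_add multiple_span_scale final_span[OF s l] multiple_span_basis) simp_all
    then show ?thesis by (rule multiple_span_cong) (simp add: algebra_simps)
  qed
  have b2: "bspan (\<lambda>\<kappa>. iter_factor {} prs F0 (point \<kappa>) - eval_list (cups c) Lf (point \<kappa>))"
  proof (rule multiple_span_cong)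
    show "bspan (\<lambda>\<kappa>. \<Sum>s\<in>stage (cups c). h s * (t * ?X s \<kappa>))"
      by (intro multiple_span_sum multiple_span_scale b1 finite_stage)
  next
    fix \<kappa> assume "\<kappa> \<in> Ors N a d"
    then show "iter_factor {} prs F0 (point \<kappa>) - eval_list (cups c) Lf (point \<kappa>) = (\<Sum>s\<in>stage (cups c). h s * (t * ?X s \<kappa>))"
      using h[OF point_end] by (simp add: sum_distrib_left algebra_simps)
  qed
  define H where "H L \<nu> = sum_list (map (\<lambda>(k, s). if ?nu s = \<nu> then k else 0) L)" for L :: "(int \<times> state) list" and \<nu>
  have b3: "bspan (\<lambda>\<kappa>. eval_list (cups c) L (point \<kappa>) - (\<Sum>\<nu>\<in>Ors N a d. H L \<nu> * ?b \<nu> \<kappa>))"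
    if "\<And>k s. (k, s) \<in> set L \<Longrightarrow> s \<in> stage (cups c)" for L
    using that
  proof (induction L)
    case Nil
    then show ?case using multiple_span_0 by (simp add: H_def)
  next
    case (Cons x L)
    obtain k s where x: "x = (k, s)" by (metis surj_pair)
    have s: "s \<in> stage (cups c)" using Cons.prems x by auto
    have "bspan (\<lambda>\<kappa>. k * (?X s \<kappa> - ?b (?nu s) \<kappa>) + (eval_list (cups c) L (point \<kappa>) - (\<Sum>\<nu>\<in>Ors N a d. H L \<nu> * ?b \<nu> \<kappa>)))"
      using Cons.prems by (intro multiple_span_add multiple_span_scale final_span[OF s l] Cons.IH) auto
    then show ?case
    proof (rule multiple_span_cong)
      fix \<kappa>
      have "(\<Sum>\<nu>\<in>Ors N a d. H (x # L) \<nu> * ?b \<nu> \<kappa>) = (\<Sum>\<nu>\<in>Ors N a d. (if ?nu s = \<nu> then k * ?b \<nu> \<kappa> else 0) + H L \<nu> * ?b \<nu> \<kappa>)"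
        by (intro sum.cong refl) (simp add: H_def x distrib_right)
      also have "\<dots> = k * ?b (?nu s) \<kappa> + (\<Sum>\<nu>\<in>Ors N a d. H L \<nu> * ?b \<nu> \<kappa>)"
        using nu_cw(1)[OF s l] by (simp add: sum.distrib)
      finally show "eval_list (cups c) (x # L) (point \<kappa>) - (\<Sum>\<nu>\<in>Ors N a d. H (x # L) \<nu> * ?b \<nu> \<kappa>)
        = k * (?X s \<kappa> - ?b (?nu s) \<kappa>) + (eval_list (cups c) L (point \<kappa>) - (\<Sum>\<nu>\<in>Ors N a d. H L \<nu> * ?b \<nu> \<kappa>))"
        by (simp add: x algebra_simps)
    qed
  qed
  have "bspan (\<lambda>\<kappa>. (iter_factor {} prs F0 (point \<kappa>) - eval_list (cups c) Lf (point \<kappa>))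
      + (eval_list (cups c) Lf (point \<kappa>) - (\<Sum>\<nu>\<in>Ors N a d. H Lf \<nu> * ?b \<nu> \<kappa>)))"
    by (rule multiple_span_add[OF b2 b3[OF Lst]])
  then obtain h' where h': "\<And>\<kappa>. \<kappa> \<in> Ors N a d \<Longrightarrow> iter_factor {} prs F0 (point \<kappa>) - (\<Sum>\<nu>\<in>Ors N a d. H Lf \<nu> * ?b \<nu> \<kappa>)
      = t * (\<Sum>\<nu>\<in>Ors N a d. h' \<nu> * ?b \<nu> \<kappa>)"
    unfolding multiple_span_def by auto
  have Hh: "H Lf \<nu> = diag_coeff (a, la, Cap c) (c, \<mu>, Cap d) (a, \<nu>, Cap d)" for \<nu>
    unfolding diag_coeff_def hprod_def H_def Lf_def prs_def s0_def
    by (simp add: cap_star_def comp_def, rule arg_cong[where f = sum_list], rule map_cong[OF refl])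
      (auto cong: if_cong)
  show thesis
  proof (rule that[of "\<lambda>\<nu>. H Lf \<nu> + t * h' \<nu>"])
    fix \<kappa> assume k: "\<kappa> \<in> Ors N a d"
    have "(\<Sum>\<nu>\<in>Ors N a d. (H Lf \<nu> + t * h' \<nu>) * ?b \<nu> \<kappa>) = iter_factor {} prs F0 (point \<kappa>)"
      using h'[OF k] by (simp add: distrib_right sum.distrib sum_distrib_left algebra_simps)
    also have "\<dots> = (if \<kappa> \<in> Or N c then F0 (point \<kappa>) * euler t N a c d \<kappa> else 0)"
      by (rule iter_factor_euler(1)[OF k prs(2,1)])
    also have "\<dots> = (if \<kappa> \<in> Or N c then dbasis t N a c la \<kappa> * dbasis t N c d \<mu> \<kappa> * euler t N a c d \<kappa> else 0)"
      using start_prod[OF l m k] unfolding F0_def s0_def by simp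
    finally show "(\<Sum>\<nu>\<in>Ors N a d. (H Lf \<nu> + t * h' \<nu>) * ?b \<nu> \<kappa>)
      = (if \<kappa> \<in> Or N c then dbasis t N a c la \<kappa> * dbasis t N c d \<mu> \<kappa> * euler t N a c d \<kappa> else 0)" .
  next
    show "t dvd H Lf \<nu> + t * h' \<nu> - diag_coeff (a, la, Cap c) (c, \<mu>, Cap d) (a, \<nu>, Cap d)" for \<nu>
      unfolding Hh by simp
  qed
qed

end

section \<open>Structure constants\<close>

lemma int_zero_if_all_dvd:
  fixes x :: int
  assumes "\<And>t. t \<noteq> 0 \<Longrightarrow> t dvd x"
  shows "x = 0"
proof (rule ccontr)
  assume "x \<noteq> 0"
  have "\<bar>x\<bar> + 1 dvd x" by (rule assms) simp
  from dvd_imp_le_int[OF \<open>x \<noteq> 0\<close> this] show False by simp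
qed

lemma dvd_diff_trans:
  fixes t :: int
  assumes "t dvd z - x" "t dvd z - y"
  shows "t dvd x - y"
proof -
  have "x - y = (z - y) - (z - x)" by simp
  then show ?thesis using dvd_diff[OF assms(2,1)] by simp
qed

lemma int_eq_if_all_dvd:
  fixes x y :: int
  assumes "\<And>t. t \<noteq> 0 \<Longrightarrow> t dvd x - y"
  shows "x = y"
  using int_zero_if_all_dvd[of "x - y"] assms by simp

definition struct_const :: "cupd \<Rightarrow> cupd \<Rightarrow> cupd \<Rightarrow> weight \<Rightarrow> weight \<Rightarrow> weight \<Rightarrow> int" where
  "struct_const a c d la \<mu> \<nu> = diag_coeff (a, la, Cap c) (c, \<mu>, Cap d) (a, \<nu>, Cap d)"

text \<open>For t \<noteq> 0 the first clause determines \<open>C\<close> on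
  \<open>Ors N a d\<close> by independence of the basis; the second says that its reduction modulo t
  is Khovanov's coefficient.\<close>

definition deformed :: "int \<Rightarrow> int \<Rightarrow> cupd \<Rightarrow> cupd \<Rightarrow> cupd \<Rightarrow> weight \<Rightarrow> weight \<Rightarrow> (weight \<Rightarrow> int) \<Rightarrow> bool" where
  "deformed t N a c d la \<mu> C \<longleftrightarrow>
    (\<forall>\<kappa>\<in>Ors N a d. (\<Sum>\<nu>\<in>Ors N a d. C \<nu> * dbasis t N a d \<nu> \<kappa>)
      = (if \<kappa> \<in> Or N c then dbasis t N a c la \<kappa> * dbasis t N c d \<mu> \<kappa> * euler t N a c d \<kappa> else 0))
    \<and> (\<forall>\<nu>. t dvd C \<nu> - struct_const a c d la \<mu> \<nu>)"

lemma deformed_exists: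
  assumes "closed_cupd N a" "closed_cupd N c" "closed_cupd N d" "la \<in> Ors N a c" "\<mu> \<in> Ors N c d"
  obtains C where "deformed t N a c d la \<mu> C"
proof -
  interpret triple N a c d t by unfold_locales (rule assms)+
  show thesis by (rule hprod_deformed[OF assms(4,5)]) (use that in \<open>auto simp: deformed_def struct_const_def\<close>)
qed

lemma deformedD:
  assumes "deformed t N a c d la \<mu> C"
  shows "\<kappa> \<in> Ors N a d \<Longrightarrow> (\<Sum>\<nu>\<in>Ors N a d. C \<nu> * dbasis t N a d \<nu> \<kappa>)
      = (if \<kappa> \<in> Or N c then dbasis t N a c la \<kappa> * dbasis t N c d \<mu> \<kappa> * euler t N a c d \<kappa> else 0)"
    and "t dvd C \<nu> - struct_const a c d la \<mu> \<nu>"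
  using assms unfolding deformed_def by auto

text \<open>The subtraction and the halving in \<open>split_count\<close> are exact at points
  orienting all three diagrams. Later identities between exponents become linear arithmetic through
  this.\<close>

lemma split_count_eq:
  assumes "closed_cupd N a" "closed_cupd N c" "closed_cupd N d" "\<kappa> \<in> Or N a" "\<kappa> \<in> Or N c" "\<kappa> \<in> Or N d"
  shows "2 * split_count N a c d \<kappa> \<sigma> + num_circles N a c \<kappa> \<sigma> + num_circles N c d \<kappa> \<sigma> = card (sign_verts N \<kappa> \<sigma>) div 2 + num_circles N a d \<kappa> \<sigma>"
proof -
  interpret triple N a c d 1 by unfold_locales (rule assms)+
  show ?thesis
    by (rule iter_factor_euler(2)[of \<kappa> "sorted_list_of_set (cups c)"])
      (use assms finite_cups[OF assms(2)] in \<open>auto simp: Ors_def\<close>)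
qed

text \<open>The circle counts of the intermediate pair, a with c on the left and b with d on the
  right, cancel. Both sides retain the counts of a with d, a with b, b with c and c with d.\<close>

lemma euler_cocycle:
  assumes "closed_cupd N a" "closed_cupd N b" "closed_cupd N c" "closed_cupd N d"
    "\<kappa> \<in> Or N a" "\<kappa> \<in> Or N b" "\<kappa> \<in> Or N c" "\<kappa> \<in> Or N d"
  shows "euler t N a b c \<kappa> * euler t N a c d \<kappa> = euler t N b c d \<kappa> * euler t N a b d \<kappa>"
proof -
  have "split_count N a b c \<kappa> \<sigma> + split_count N a c d \<kappa> \<sigma> = split_count N b c d \<kappa> \<sigma> + split_count N a b d \<kappa> \<sigma>" for \<sigma>
    using split_count_eq[of N a b c \<kappa> \<sigma>] split_count_eq[of N a c d \<kappa> \<sigma>] split_count_eq[of N b c d \<kappa> \<sigma>] split_count_eq[of N a b d \<kappa> \<sigma>] assms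
    by simp
  then have "t ^ (split_count N a b c \<kappa> True + split_count N a c d \<kappa> True) * (- t) ^ (split_count N a b c \<kappa> False + split_count N a c d \<kappa> False)
    = t ^ (split_count N b c d \<kappa> True + split_count N a b d \<kappa> True) * (- t) ^ (split_count N b c d \<kappa> False + split_count N a b d \<kappa> False)" by simp
  then show ?thesis unfolding euler_def power_add by (simp only: mult_ac)
qed

lemma euler_rev: "euler t N d c a = euler t N a c d"
  unfolding euler_def split_count_def by (simp add: num_circles_commute[of N d] num_circles_commute[of N c a] add.commute fun_eq_iff)

text \<open>A nonzero coefficient at \<nu> forces a point below \<nu> at which the product function
  is nonzero. Lying in the support of both factors, that point is above \<open>la\<close> and
  \<mu>.\<close>

lemma deformed_support:
  assumes t: "t \<noteq> 0" and cl: "closed_cupd N a" "closed_cupd N c" "closed_cupd N d"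
    and l: "la \<in> Ors N a c" and m: "\<mu> \<in> Ors N c d" and n: "\<nu> \<in> Ors N a d"
    and C: "deformed t N a c d la \<mu> C" "C \<nu> \<noteq> 0"
  obtains \<kappa> where "\<kappa> \<in> Ors N a d" "bruhat_le la \<kappa>" "bruhat_le \<mu> \<kappa>" "bruhat_le \<kappa> \<nu>"
proof -
  interpret ad: two_cupd N a d by unfold_locales (rule cl)+
  interpret ac: two_cupd N a c by unfold_locales (rule cl)+
  interpret cd: two_cupd N c d by unfold_locales (rule cl)+
  obtain \<kappa> where k: "\<kappa> \<in> Ors N a d" "(\<Sum>\<mu>\<in>Ors N a d. C \<mu> * dbasis t N a d \<mu> \<kappa>) \<noteq> 0" "cw N a d \<kappa> \<subseteq> cw N a d \<nu>"
    by (rule ad.expansion_support[of t \<nu> C]) (use t n C in auto)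
  have kc: "\<kappa> \<in> Or N c" "dbasis t N a c la \<kappa> \<noteq> 0" "dbasis t N c d \<mu> \<kappa> \<noteq> 0"
    using k deformedD(1)[OF C(1) k(1)] by (auto split: if_splits)
  have "bruhat_le \<kappa> \<nu>" using ad.cw_mono_bruhat[of \<kappa> \<nu>] k n unfolding Ors_def by auto
  moreover have "bruhat_le la \<kappa>" using ac.cw_mono_bruhat[of la \<kappa>] ac.dbasis_nonzero[OF t] kc l k unfolding Ors_def by auto
  moreover have "bruhat_le \<mu> \<kappa>" using cd.cw_mono_bruhat[of \<mu> \<kappa>] cd.dbasis_nonzero[OF t] kc m k unfolding Ors_def by auto
  ultimately show thesis using that k by blast
qed

lemma struct_const_bruhat:
  assumes cl: "closed_cupd N a" "closed_cupd N c" "closed_cupd N d"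
    and l: "la \<in> Ors N a c" and m: "\<mu> \<in> Ors N c d" and n: "\<nu> \<in> Ors N a d"
    and nz: "struct_const a c d la \<mu> \<nu> \<noteq> 0"
  shows "bruhat_le la \<nu>" "bruhat_le \<mu> \<nu>"
proof -
  \<comment> \<open>Choosing t not to divide the constant keeps the deformed coefficient nonzero as
    well.\<close>
  obtain t where t: "t \<noteq> 0" "\<not> t dvd struct_const a c d la \<mu> \<nu>" using int_zero_if_all_dvd nz by blast
  obtain C where C: "deformed t N a c d la \<mu> C" using deformed_exists[OF cl l m] by blast
  have "C \<nu> \<noteq> 0" using deformedD(2)[OF C, of \<nu>] t(2) by auto
  from deformed_support[OF t(1) cl l m n C this]
  show "bruhat_le la \<nu>" "bruhat_le \<mu> \<nu>" using bruhat_le_trans by blast+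
qed

text \<open>The deformed product is a pointwise product and \<open>euler\<close> is symmetric under
  reversal, so both constants are reductions of coefficients of one function.\<close>

lemma struct_const_star:
  assumes cl: "closed_cupd N a" "closed_cupd N c" "closed_cupd N d"
    and l: "la \<in> Ors N a c" and m: "\<mu> \<in> Ors N c d" and n: "\<nu> \<in> Ors N a d"
  shows "struct_const a c d la \<mu> \<nu> = struct_const d c a \<mu> la \<nu>"
proof (rule int_eq_if_all_dvd)
  fix t :: int assume t: "t \<noteq> 0"
  interpret ad: two_cupd N a d by unfold_locales (rule cl)+
  obtain C where C: "deformed t N a c d la \<mu> C" using deformed_exists[OF cl l m] by blast
  have lm: "\<mu> \<in> Ors N d c" "la \<in> Ors N c a" using l m Ors_commute by auto
  obtain C' where C': "deformed t N d c a \<mu> la C'" using deformed_exists[OF cl(3,2,1) lm] by blast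
  have "C \<nu> = C' \<nu>"
  proof (rule ad.expansion_unique[OF t n])
    fix \<kappa> assume k: "\<kappa> \<in> Ors N a d"
    show "(\<Sum>\<mu>\<in>Ors N a d. C \<mu> * dbasis t N a d \<mu> \<kappa>) = (\<Sum>\<mu>\<in>Ors N a d. C' \<mu> * dbasis t N a d \<mu> \<kappa>)"
      using deformedD(1)[OF C k] deformedD(1)[OF C', of \<kappa>] k
      unfolding Ors_commute[of N d a] dbasis_commute[of t N d] dbasis_commute[of t N c a] euler_rev[of t N d] by (simp add: mult.commute)
  qed
  then show "t dvd struct_const a c d la \<mu> \<nu> - struct_const d c a \<mu> la \<nu>"
    using dvd_diff_trans[OF deformedD(2)[OF C, of \<nu>], of "struct_const d c a \<mu> la \<nu>"] deformedD(2)[OF C', of \<nu>] by simp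
qed

text \<open>Modulo t both sides are expansion coefficients of one function: the product of the three
  basis vectors on points orienting all four diagrams, times the factor that
  \<open>euler_cocycle\<close> shows to be the same for both bracketings.\<close>

lemma struct_const_assoc:
  assumes cl: "closed_cupd N a" "closed_cupd N b" "closed_cupd N c" "closed_cupd N d"
    and x: "x \<in> Ors N a b" and y: "y \<in> Ors N b c" and z: "z \<in> Ors N c d" and u: "u \<in> Ors N a d"
  shows "(\<Sum>w\<in>Ors N a c. struct_const a b c x y w * struct_const a c d w z u)
    = (\<Sum>w\<in>Ors N b d. struct_const b c d y z w * struct_const a b d x w u)"
proof (rule int_eq_if_all_dvd)
  fix t :: int assume t: "t \<noteq> 0"
  interpret ad: two_cupd N a d by unfold_locales (rule cl)+
  obtain C where C: "deformed t N a b c x y C" using deformed_exists[OF cl(1-3) x y] by blast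
  obtain C' where C': "deformed t N b c d y z C'" using deformed_exists[OF cl(2-4) y z] by blast
  have "\<exists>D. \<forall>w\<in>Ors N a c. deformed t N a c d w z (D w)"
  proof (intro bchoice ballI)
    fix w assume w: "w \<in> Ors N a c"
    show "\<exists>D. deformed t N a c d w z D" by (rule deformed_exists[OF cl(1,3,4) w z]) blast
  qed
  then obtain D where D: "\<And>w. w \<in> Ors N a c \<Longrightarrow> deformed t N a c d w z (D w)" by blast
  have "\<exists>D'. \<forall>w\<in>Ors N b d. deformed t N a b d x w (D' w)"
  proof (intro bchoice ballI)
    fix w assume w: "w \<in> Ors N b d"
    show "\<exists>D. deformed t N a b d x w D" by (rule deformed_exists[OF cl(1,2,4) x w]) blast
  qed
  then obtain D' where D': "\<And>w. w \<in> Ors N b d \<Longrightarrow> deformed t N a b d x w (D' w)" by blast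
  have e: "(\<Sum>w\<in>Ors N a c. C w * D w u) = (\<Sum>w\<in>Ors N b d. C' w * D' w u)"
  proof (rule ad.expansion_unique[OF t u, of "\<lambda>u. \<Sum>w\<in>Ors N a c. C w * D w u" "\<lambda>u. \<Sum>w\<in>Ors N b d. C' w * D' w u"])
    fix \<kappa> assume k: "\<kappa> \<in> Ors N a d"
    have kad: "\<kappa> \<in> Or N a" "\<kappa> \<in> Or N d" using k unfolding Ors_def by auto
    have "(\<Sum>u\<in>Ors N a d. (\<Sum>w\<in>Ors N a c. C w * D w u) * dbasis t N a d u \<kappa>)
      = (\<Sum>w\<in>Ors N a c. C w * (\<Sum>u\<in>Ors N a d. D w u * dbasis t N a d u \<kappa>))"
      unfolding sum_distrib_right sum_distrib_left by (subst sum.swap) (simp add: mult.assoc)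
    also have "\<dots> = (if \<kappa> \<in> Or N c then (\<Sum>w\<in>Ors N a c. C w * dbasis t N a c w \<kappa>) * (dbasis t N c d z \<kappa> * euler t N a c d \<kappa>) else 0)"
      using deformedD(1)[OF D k] by (simp add: sum_distrib_right mult.assoc)
    also have "\<dots> = (if \<kappa> \<in> Or N c \<and> \<kappa> \<in> Or N b then dbasis t N a b x \<kappa> * dbasis t N b c y \<kappa> * dbasis t N c d z \<kappa> * (euler t N a b c \<kappa> * euler t N a c d \<kappa>) else 0)"
      using deformedD(1)[OF C, of \<kappa>] kad unfolding Ors_def by simp
    finally have 1: "(\<Sum>u\<in>Ors N a d. (\<Sum>w\<in>Ors N a c. C w * D w u) * dbasis t N a d u \<kappa>)
      = (if \<kappa> \<in> Or N c \<and> \<kappa> \<in> Or N b then dbasis t N a b x \<kappa> * dbasis t N b c y \<kappa> * dbasis t N c d z \<kappa> * (euler t N a b c \<kappa> * euler t N a c d \<kappa>) else 0)" .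
    have "(\<Sum>u\<in>Ors N a d. (\<Sum>w\<in>Ors N b d. C' w * D' w u) * dbasis t N a d u \<kappa>)
      = (\<Sum>w\<in>Ors N b d. C' w * (\<Sum>u\<in>Ors N a d. D' w u * dbasis t N a d u \<kappa>))"
      unfolding sum_distrib_right sum_distrib_left by (subst sum.swap) (simp add: mult.assoc)
    also have "\<dots> = (if \<kappa> \<in> Or N b then (\<Sum>w\<in>Ors N b d. C' w * dbasis t N b d w \<kappa>) * (dbasis t N a b x \<kappa> * euler t N a b d \<kappa>) else 0)"
      using deformedD(1)[OF D' k] by (simp add: sum_distrib_left sum_distrib_right mult_ac)
    also have "\<dots> = (if \<kappa> \<in> Or N c \<and> \<kappa> \<in> Or N b then dbasis t N a b x \<kappa> * dbasis t N b c y \<kappa> * dbasis t N c d z \<kappa> * (euler t N b c d \<kappa> * euler t N a b d \<kappa>) else 0)"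
      using deformedD(1)[OF C', of \<kappa>] kad unfolding Ors_def by simp
    finally show "(\<Sum>u\<in>Ors N a d. (\<Sum>w\<in>Ors N a c. C w * D w u) * dbasis t N a d u \<kappa>)
      = (\<Sum>u\<in>Ors N a d. (\<Sum>w\<in>Ors N b d. C' w * D' w u) * dbasis t N a d u \<kappa>)"
      using 1 euler_cocycle[OF cl kad(1) _ _ kad(2)] by simp
  qed
  have cong: "t dvd p * q - p' * q'" if "t dvd p - p'" "t dvd q - q'" for p q p' q' :: int
  proof -
    have "p * q - p' * q' = (p - p') * q + p' * (q - q')" by (simp add: algebra_simps)
    then show ?thesis using that by simp
  qed
  have "t dvd (\<Sum>w\<in>Ors N a c. C w * D w u - struct_const a b c x y w * struct_const a c d w z u)"
    using deformedD(2)[OF C] deformedD(2)[OF D] by (intro dvd_sum cong) auto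
  moreover have "t dvd (\<Sum>w\<in>Ors N b d. C' w * D' w u - struct_const b c d y z w * struct_const a b d x w u)"
    using deformedD(2)[OF C'] deformedD(2)[OF D'] by (intro dvd_sum cong) auto
  ultimately show "t dvd (\<Sum>w\<in>Ors N a c. struct_const a b c x y w * struct_const a c d w z u)
      - (\<Sum>w\<in>Ors N b d. struct_const b c d y z w * struct_const a b d x w u)"
    unfolding sum_subtractf e by (rule dvd_diff_trans)
qed

lemma circles_diag:
  assumes "closed_cupd N a" "C \<in> circles N a a"
  shows "card C = 2" "Min C < mate a (Min C)"
proof -
  interpret aa: two_cupd N a a by unfold_locales (rule assms)+
  let ?m = "Min C"
  note p = aa.circles_props[OF assms(2)]
  have mm: "mate a (mate a ?m) = ?m" "mate a ?m \<noteq> ?m" using mate_mate[OF assms(1) p(5)] mate_neq[OF assms(1) p(5)] by auto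
  have "circle N a a ?m \<subseteq> {?m, mate a ?m}"
    unfolding circle_def by (rule orb_least) (use mm in auto)
  then have "C = {?m, mate a ?m}" using p(4,6,7) by blast
  then show "card C = 2" using mm by (metis card_2_iff)
  have "?m \<le> mate a ?m" using p(1) p(7)[OF p(4)] by simp
  then show "Min C < mate a (Min C)" using mm by simp
qed

text \<open>\<open>al\<close> orients every circle of a with its mirror image anticlockwise, so its
  deformed vector is the constant 1, and the gluing involves no split.\<close>

lemma struct_const_unit:
  assumes cl: "closed_cupd N a" "closed_cupd N d"
    and al: "al \<in> Or N a" "\<And>i j. (i, j) \<in> cups a \<Longrightarrow> al i = Dn"
    and m: "\<mu> \<in> Ors N a d" and n: "\<nu> \<in> Ors N a d"
  shows "struct_const a a d al \<mu> \<nu> = (if \<nu> = \<mu> then 1 else 0)"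
proof (rule int_eq_if_all_dvd)
  fix t :: int assume t: "t \<noteq> 0"
  interpret ad: two_cupd N a d by unfold_locales (rule cl)+
  interpret aa: two_cupd N a a by unfold_locales (rule cl)+
  have alO: "al \<in> Ors N a a" using al unfolding Ors_def by simp
  obtain C where C: "deformed t N a a d al \<mu> C" using deformed_exists[OF cl(1,1,2) alO m] by blast
  have "C \<nu> = (\<lambda>\<nu>. if \<nu> = \<mu> then 1 else 0) \<nu>"
  proof (rule ad.expansion_unique[OF t n])
    fix \<kappa> assume k: "\<kappa> \<in> Ors N a d"
    have kad: "\<kappa> \<in> Or N a" "\<kappa> \<in> Or N d" using k unfolding Ors_def by auto
    have "cw N a a al = {}"
    proof -
      have "al (Min C) = Dn" if "C \<in> circles N a a" for C
        using circles_diag(2)[OF cl(1) that] mate_less_cup[OF cl(1) aa.circles_props(5)[OF that]] al(2) by blast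
      then show ?thesis unfolding cw_def by auto
    qed
    then have b: "dbasis t N a a al \<kappa> = 1" unfolding dbasis_def by simp
    have "split_count N a a d \<kappa> \<sigma> = 0" for \<sigma>
    proof -
      have kaa: "\<kappa> \<in> Ors N a a" using kad unfolding Ors_def by simp
      have "card (sign_verts N \<kappa> \<sigma>) = (\<Sum>C | C \<in> circles N a a \<and> pt \<kappa> (Min C) = \<sigma>. card {v \<in> C. True})"
        using aa.card_sign_verts_circles[OF kaa, of \<sigma> "\<lambda>_. True"] by simp
      also have "\<dots> = (\<Sum>C | C \<in> circles N a a \<and> pt \<kappa> (Min C) = \<sigma>. 2)"
        by (intro sum.cong refl) (use circles_diag(1)[OF cl(1)] in auto)
      also have "\<dots> = 2 * num_circles N a a \<kappa> \<sigma>" unfolding num_circles_def by simp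
      finally show ?thesis using split_count_eq[OF cl(1,1,2) kad(1,1,2), of \<sigma>] by simp
    qed
    then have "euler t N a a d \<kappa> = 1" unfolding euler_def by simp
    then have "(\<Sum>\<nu>\<in>Ors N a d. C \<nu> * dbasis t N a d \<nu> \<kappa>) = dbasis t N a d \<mu> \<kappa>"
      using deformedD(1)[OF C k] kad b by simp
    also have "\<dots> = (\<Sum>\<nu>\<in>Ors N a d. (if \<nu> = \<mu> then 1 else 0) * dbasis t N a d \<nu> \<kappa>)"
      using m by (simp add: if_distrib[of "\<lambda>x. x * _"] sum.delta cong: if_cong)
    finally show "(\<Sum>\<nu>\<in>Ors N a d. C \<nu> * dbasis t N a d \<nu> \<kappa>)
      = (\<Sum>\<nu>\<in>Ors N a d. (if \<nu> = \<mu> then 1 else 0) * dbasis t N a d \<nu> \<kappa>)" .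
  qed
  then show "t dvd struct_const a a d al \<mu> \<nu> - (if \<nu> = \<mu> then 1 else 0)"
    using deformedD(2)[OF C, of \<nu>] by (simp add: dvd_diff_commute)
qed

text \<open>The arithmetic of \<open>struct_const_cell\<close>. The letters g stand for clockwise
  arc counts, those beginning with n and c for circle and clockwise circle counts of pairs, e and e'
  for split counts; the bare n is the number of vertices with the given value and h is half of
  it.\<close>

lemma balance:
  fixes ga gb gd gd' n h :: nat
  assumes "2 * (ga + gd) + 2 * nad = n + 4 * cad" "2 * (ga + gd') + 2 * nad' = n + 4 * cad'"
    "2 * (gb + gd) + 2 * nbd = n + 4 * cbd" "2 * (gb + gd') + 2 * nbd' = n + 4 * cbd'"
    "2 * e + nab + nbd = h + nad" "2 * e' + nab + nbd' = h + nad'"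
  shows "cad + (cbd' + e') = cad' + (cbd + e)"
proof -
  have "gd + nad + 2 * cad' = gd' + nad' + 2 * cad" using assms(1,2) unfolding distrib_left by linarith
  moreover have "gd + nbd + 2 * cbd' = gd' + nbd' + 2 * cbd" using assms(3,4) unfolding distrib_left by linarith
  moreover have "2 * e' + nad + nbd' = 2 * e + nad' + nbd" using assms(5,6) by linarith
  ultimately show ?thesis by linarith
qed

text \<open>The leading coefficient is read off at the point \<open>\<mu>\<close>; by the degree formula the power of
  \<open>\<plusminus>t\<close> appearing there does not depend on \<open>d\<close>.\<close>

lemma struct_const_cell:
  assumes cl: "closed_cupd N a" "closed_cupd N b" "closed_cupd N d" "closed_cupd N d'"
    and l: "la \<in> Ors N a b" and m: "\<mu> \<in> Or N a" "\<mu> \<in> Or N b" "\<mu> \<in> Or N d" "\<mu> \<in> Or N d'"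
  shows "struct_const a b d la \<mu> \<mu> = struct_const a b d' la \<mu> \<mu>"
proof (rule int_eq_if_all_dvd)
  fix t :: int assume t: "t \<noteq> 0"
  \<comment> \<open>At the point \<mu> the expansion reduces to its term at \<mu>: a basis vector
    that is nonzero there has its index below \<mu>, whereas a nonzero coefficient has its index
    above \<mu>.\<close>
  have diag: "C \<mu> * dbasis t N a x \<mu> \<mu> = dbasis t N a b la \<mu> * dbasis t N b x \<mu> \<mu> * euler t N a b x \<mu>"
    if x: "closed_cupd N x" "\<mu> \<in> Or N x" and C: "deformed t N a b x la \<mu> C" for x C
  proof -
    interpret ax: two_cupd N a x by unfold_locales (rule cl x)+
    have mO: "\<mu> \<in> Ors N a x" "\<mu> \<in> Ors N b x" using m x unfolding Ors_def by auto
    have "(\<Sum>\<nu>\<in>Ors N a x. C \<nu> * dbasis t N a x \<nu> \<mu>) = C \<mu> * dbasis t N a x \<mu> \<mu>"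
    proof (rule sum_eq_single[OF ax.finite_Ors mO(1)])
      fix \<nu> assume n: "\<nu> \<in> Ors N a x" "\<nu> \<noteq> \<mu>"
      show "C \<nu> * dbasis t N a x \<nu> \<mu> = 0"
      proof (rule ccontr)
        assume "C \<nu> * dbasis t N a x \<nu> \<mu> \<noteq> 0"
        then have nz: "C \<nu> \<noteq> 0" "cw N a x \<nu> \<subseteq> cw N a x \<mu>" using ax.dbasis_nonzero[OF t] by auto
        have le: "bruhat_le \<nu> \<mu>" using ax.cw_mono_bruhat[of \<nu> \<mu>] n nz mO unfolding Ors_def by auto
        obtain \<kappa> where "bruhat_le \<mu> \<kappa>" "bruhat_le \<kappa> \<nu>"
          using deformed_support[OF t cl(1,2) x(1) l mO(2) n(1) C nz(1)] by blast
        then have "bruhat_le \<mu> \<nu>" using bruhat_le_trans by blast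
        then show False using bruhat_le_antisym[OF le] n by simp
      qed
    qed
    then show ?thesis using deformedD(1)[OF C mO(1)] m by simp
  qed
  have mO: "\<mu> \<in> Ors N b d" "\<mu> \<in> Ors N b d'" using m unfolding Ors_def by auto
  obtain C where C: "deformed t N a b d la \<mu> C" using deformed_exists[OF cl(1-3) l mO(1)] by blast
  obtain C' where C': "deformed t N a b d' la \<mu> C'" using deformed_exists[OF cl(1,2,4) l mO(2)] by blast
  define P where "P f = t ^ f True * (- t) ^ f False" for f :: "bool \<Rightarrow> nat"
  have Padd: "P f * P g = P (\<lambda>\<sigma>. f \<sigma> + g \<sigma>)" for f g unfolding P_def power_add by (simp add: mult_ac)
  have Pnz: "P f \<noteq> 0" for f unfolding P_def using t by simp
  have dbasis_P: "dbasis t N x y \<mu> \<mu> = P (num_cw N x y \<mu>)" if "closed_cupd N x" "closed_cupd N y" for x y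
  proof -
    interpret two_cupd N x y by unfold_locales (rule that)+
    show ?thesis unfolding P_def by (rule dbasis_diag)
  qed
  have euler_P: "euler t N a b x \<mu> = P (split_count N a b x \<mu>)" for x unfolding euler_def P_def by simp
  have deg: "2 * (cw_arcs N x \<mu> \<sigma> + cw_arcs N y \<mu> \<sigma>) + 2 * num_circles N x y \<mu> \<sigma> = card (sign_verts N \<mu> \<sigma>) + 4 * num_cw N x y \<mu> \<sigma>"
    if "closed_cupd N x" "closed_cupd N y" "\<mu> \<in> Or N x" "\<mu> \<in> Or N y" for x y \<sigma>
  proof -
    interpret two_cupd N x y by unfold_locales (rule that)+
    show ?thesis by (rule degree_formula) (use that in \<open>simp add: Ors_def\<close>)
  qed
  have bal: "num_cw N a d \<mu> \<sigma> + (num_cw N b d' \<mu> \<sigma> + split_count N a b d' \<mu> \<sigma>)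
    = num_cw N a d' \<mu> \<sigma> + (num_cw N b d \<mu> \<sigma> + split_count N a b d \<mu> \<sigma>)" for \<sigma>
    using deg[OF cl(1,3) m(1,3), of \<sigma>] deg[OF cl(1,4) m(1,4), of \<sigma>] deg[OF cl(2,3) m(2,3), of \<sigma>] deg[OF cl(2,4) m(2,4), of \<sigma>]
      split_count_eq[OF cl(1-3) m(1-3), of \<sigma>] split_count_eq[OF cl(1,2,4) m(1,2,4), of \<sigma>] by (rule balance)
  let ?K = "dbasis t N a b la \<mu>"
  let ?A = "num_cw N a d \<mu>" and ?A' = "num_cw N a d' \<mu>"
  let ?B = "\<lambda>\<sigma>. num_cw N b d \<mu> \<sigma> + split_count N a b d \<mu> \<sigma>" and ?B' = "\<lambda>\<sigma>. num_cw N b d' \<mu> \<sigma> + split_count N a b d' \<mu> \<sigma>"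
  have 1: "C \<mu> * P ?A = ?K * P ?B"
    using diag[OF cl(3) m(3) C] unfolding dbasis_P[OF cl(1,3)] dbasis_P[OF cl(2,3)] euler_P by (simp add: mult.assoc Padd)
  have 2: "C' \<mu> * P ?A' = ?K * P ?B'"
    using diag[OF cl(4) m(4) C'] unfolding dbasis_P[OF cl(1,4)] dbasis_P[OF cl(2,4)] euler_P by (simp add: mult.assoc Padd)
  have "C \<mu> * (P ?A * P ?B') = (C \<mu> * P ?A) * P ?B'" by (simp only: mult.assoc)
  also have "\<dots> = (?K * P ?B) * P ?B'" by (simp only: 1)
  also have "\<dots> = (?K * P ?B') * P ?B" by (simp only: mult.assoc mult.commute[of "P ?B"])
  also have "\<dots> = (C' \<mu> * P ?A') * P ?B" by (simp only: 2)
  also have "\<dots> = C' \<mu> * (P ?A' * P ?B)" by (simp only: mult.assoc)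
  also have "P ?A' * P ?B = P ?A * P ?B'" unfolding Padd bal by simp
  finally have "C \<mu> = C' \<mu>" using Pnz by simp
  then show "t dvd struct_const a b d la \<mu> \<mu> - struct_const a b d' la \<mu> \<mu>"
    using dvd_diff_trans[OF deformedD(2)[OF C, of \<mu>], of "struct_const a b d' la \<mu> \<mu>"] deformedD(2)[OF C', of \<mu>] by simp
qed

section \<open>Closures of weights\<close>

definition label_val :: "lab \<Rightarrow> int" where
  "label_val x = (if x = Dn then 1 else if x = Up then -1 else 0)"

definition height :: "weight \<Rightarrow> int \<Rightarrow> int \<Rightarrow> int" where
  "height la i j = (\<Sum>k\<in>{i..j}. label_val (la k))"

text \<open>Bracket matching, \<open>Dn\<close> opening and \<open>Up\<close> closing. Heights are
  tested at labelled vertices only, so that the condition transfers to the reindexed closure;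
  \<open>matchedD\<close> recovers it at all vertices.\<close>

definition matched :: "weight \<Rightarrow> (int \<times> int) set" where
  "matched la = {(i, j). i < j \<and> la i = Dn \<and> la j = Up
     \<and> (\<forall>k. i \<le> k \<and> k < j \<and> la k \<in> {Dn, Up} \<longrightarrow> 1 \<le> height la i k) \<and> height la i j = 0}"

text \<open>The explicit form of \<open>underline\<close>, by \<open>underline_eq\<close>, when
  finitely many pairs are matched.\<close>

definition matched_cupd :: "weight \<Rightarrow> cupd" where
  "matched_cupd la = \<lparr>cups = matched la, rays = {k. la k \<in> {Dn, Up} \<and> (\<forall>(i, j)\<in>matched la. k \<noteq> i \<and> k \<noteq> j)}\<rparr>"

lemma height_split: "i \<le> k + 1 \<Longrightarrow> k \<le> j \<Longrightarrow> height la i j = height la i k + height la (k + 1) j"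
proof -
  assume "i \<le> k + 1" "k \<le> j"
  then have "{i..j} = {i..k} \<union> {k + 1..j}" by auto
  then show ?thesis unfolding height_def by (simp add: sum.union_disjoint)
qed

lemma height_self [simp]: "height la i i = label_val (la i)"
  unfolding height_def by simp

lemma height_card: "height la i j = int (card {k\<in>{i..j}. la k = Dn}) - int (card {k\<in>{i..j}. la k = Up})"
proof -
  have "label_val (la k) = (if la k = Dn then 1 else 0) - (if la k = Up then 1 else 0)" for k unfolding label_val_def by simp
  then have "height la i j = (\<Sum>k\<in>{i..j}. if la k = Dn then 1 else 0) - (\<Sum>k\<in>{i..j}. if la k = Up then 1 else 0)"
    unfolding height_def by (simp add: sum_subtractf)
  then show ?thesis by (simp add: sum.inter_filter[symmetric])
qed

lemma matchedD:
  assumes "(i, j) \<in> matched la"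
  shows "i < j" "la i = Dn" "la j = Up" "height la i j = 0" "\<And>k. i \<le> k \<Longrightarrow> k < j \<Longrightarrow> 1 \<le> height la i k"
proof -
  note m = assms[unfolded matched_def, simplified]
  show ij: "i < j" "la i = Dn" "la j = Up" "height la i j = 0" using m by auto
  show "1 \<le> height la i k" if "i \<le> k" "k < j" for k
    using that
  proof (induction k rule: int_ge_induct)
    case base
    then show ?case using ij by (simp add: label_val_def)
  next
    case (step k)
    show ?case
    proof (cases "la (k + 1) \<in> {Dn, Up}")
      case True
      then show ?thesis using m step by auto
    next
      case False
      then have "label_val (la (k + 1)) = 0" by (simp add: label_val_def)
      then show ?thesis using step height_split[of i k "k + 1" la] by simp
    qed
  qed
qed

lemma matchedI:
  assumes "i < j" "la i = Dn" "la j = Up" "height la i j = 0" "\<And>k. i \<le> k \<Longrightarrow> k < j \<Longrightarrow> 1 \<le> height la i k"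
  shows "(i, j) \<in> matched la"
  using assms unfolding matched_def by auto

text \<open>The partner is the first vertex at which the height counted from i is no longer
  positive; heights change by at most one, so it is 0 there.\<close>

lemma match_right:
  assumes "la i = Dn" "i \<le> j" "height la i j \<le> 0"
  obtains j' where "j' \<le> j" "(i, j') \<in> matched la"
proof -
  define n where "n = (LEAST n::nat. height la i (i + int n) \<le> 0)"
  have ex: "height la i (i + int (nat (j - i))) \<le> 0" using assms by simp
  have n: "height la i (i + int n) \<le> 0" unfolding n_def by (rule LeastI) (rule ex)
  have least: "\<not> height la i (i + int m) \<le> 0" if "m < n" for m using that not_less_Least unfolding n_def by blast
  have "n \<noteq> 0"
  proof
    assume "n = 0"
    then have "height la i i \<le> 0" using n by simp
    then show False using assms(1) by (simp add: label_val_def)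
  qed
  then obtain m where m: "n = Suc m" by (cases n) auto
  let ?j = "i + int n"
  have "height la i ?j = height la i (i + int m) + label_val (la ?j)" using height_split[of i "i + int m" ?j la] m by (simp add: algebra_simps)
  moreover have "1 \<le> height la i (i + int m)" using least[of m] m by simp
  ultimately have "label_val (la ?j) = -1" "height la i ?j = 0" using n unfolding label_val_def by (auto split: if_splits)
  moreover have "la ?j = Up" using calculation(1) unfolding label_val_def by (auto split: if_splits)
  moreover have "1 \<le> height la i k" if "i \<le> k" "k < ?j" for k
  proof -
    have "nat (k - i) < n" using that by linarith
    then show ?thesis using least[of "nat (k - i)"] that(1) by simp
  qed
  ultimately have "(i, ?j) \<in> matched la" using assms(1) m by (intro matchedI) auto
  moreover have "n \<le> nat (j - i)" unfolding n_def by (rule Least_le) (rule ex)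
  then have "?j \<le> j" using assms(2) by linarith
  ultimately show thesis using that by blast
qed

text \<open>The mirror argument, walking left from j until the height of the interval first becomes
  nonnegative.\<close>

lemma match_left:
  assumes "la j = Up" "i \<le> j" "0 \<le> height la i j"
  obtains i' where "i \<le> i'" "(i', j) \<in> matched la"
proof -
  define n where "n = (LEAST n::nat. 0 \<le> height la (j - int n) j)"
  have ex: "0 \<le> height la (j - int (nat (j - i))) j" using assms by simp
  have n: "0 \<le> height la (j - int n) j" unfolding n_def by (rule LeastI) (rule ex)
  have least: "\<not> 0 \<le> height la (j - int m) j" if "m < n" for m using that not_less_Least unfolding n_def by blast
  have "n \<noteq> 0"
  proof
    assume "n = 0"
    then have "0 \<le> height la j j" using n by simp
    then show False using assms(1) by (simp add: label_val_def)
  qed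
  then obtain m where m: "n = Suc m" by (cases n) auto
  let ?i = "j - int n"
  have "height la ?i j = label_val (la ?i) + height la (j - int m) j" using height_split[of ?i ?i j la] m by (simp add: algebra_simps)
  moreover have "height la (j - int m) j \<le> -1" using least[of m] m by simp
  ultimately have l: "label_val (la ?i) = 1" and h: "height la ?i j = 0" using n unfolding label_val_def by (auto split: if_splits)
  have d: "la ?i = Dn" using l unfolding label_val_def by (auto split: if_splits)
  have "1 \<le> height la ?i k" if "?i \<le> k" "k < j" for k
  proof -
    have "height la ?i j = height la ?i k + height la (k + 1) j" using that by (intro height_split) auto
    moreover have "\<not> 0 \<le> height la (j - int (nat (j - (k + 1)))) j" using that by (intro least) auto
    ultimately show ?thesis using h that by simp
  qed
  then have "(?i, j) \<in> matched la" using assms(1) m d h by (intro matchedI) auto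
  moreover have "n \<le> nat (j - i)" unfolding n_def by (rule Least_le) (rule ex)
  then have "i \<le> ?i" using assms(2) by linarith
  ultimately show thesis using that by blast
qed

lemma matched_unique_right: "(i, j) \<in> matched la \<Longrightarrow> (i, j') \<in> matched la \<Longrightarrow> j = j'"
proof (induction j j' rule: linorder_wlog)
  case (le j j')
  show ?case
  proof (rule ccontr)
    assume "j \<noteq> j'"
    then have "1 \<le> height la i j" using le matchedD(5)[OF le(3)] matchedD(1)[OF le(2)] by simp
    then show False using matchedD(4)[OF le(2)] by simp
  qed
qed auto

lemma matched_unique_left: "(i, j) \<in> matched la \<Longrightarrow> (i', j) \<in> matched la \<Longrightarrow> i = i'"
proof (induction i i' rule: linorder_wlog)
  case (le i i')
  show ?case
  proof (rule ccontr)
    assume "i \<noteq> i'"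
    then have lt: "i < i'" using le by simp
    note D = matchedD[OF le(2)] and D' = matchedD[OF le(3)]
    have "1 \<le> height la i (i' - 1)" using D(5)[of "i' - 1"] lt D'(1) by simp
    moreover have "height la i j = height la i (i' - 1) + height la i' j" using height_split[of i "i' - 1" j la] lt D'(1) by simp
    ultimately show False using D(4) D'(4) by simp
  qed
qed auto

lemma matched_inside:
  assumes ij: "(i, j) \<in> matched la" and k: "i < k" "k < j" "la k \<in> {Dn, Up}"
  shows "\<exists>(x, y)\<in>matched la. k = x \<or> k = y"
proof -
  note D = matchedD[OF ij]
  consider "la k = Dn" | "la k = Up" using k by auto
  then show ?thesis
  proof cases
    case 1
    have "height la i j = height la i (k - 1) + height la k j" using height_split[of i "k - 1" j la] k by simp
    then have "height la k j \<le> 0" using D(4) D(5)[of "k - 1"] k by simp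
    then obtain j' where "(k, j') \<in> matched la" using match_right[of la k j] 1 k by auto
    then show ?thesis by blast
  next
    case 2
    have "0 \<le> height la i k" using D(5)[of k] k by simp
    then obtain i' where "(i', k) \<in> matched la" using match_left[of la k i] 2 k by auto
    then show ?thesis by blast
  qed
qed

lemma matched_cupd_sel [simp]:
  "cups (matched_cupd la) = matched la"
  "k \<in> rays (matched_cupd la) \<longleftrightarrow> la k \<in> {Dn, Up} \<and> (\<forall>(i, j)\<in>matched la. k \<noteq> i \<and> k \<noteq> j)"
  unfolding matched_cupd_def by simp_all

lemma matched_cupd_oriented:
  assumes "finite (matched la)"
  shows "oriented (matched_cupd la) la" "degree (matched_cupd la) la = 0"
proof -
  let ?M = "matched la" and ?c = "matched_cupd la"
  have "{i, j} \<inter> {k, l} = {}" if e: "(i, j) \<in> ?M" "(k, l) \<in> ?M" "(i, j) \<noteq> (k, l)" for i j k l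
    using matchedD(2,3)[OF e(1)] matchedD(2,3)[OF e(2)] matched_unique_right[OF e(1), of l]
      matched_unique_left[OF e(1), of k] e by auto
  moreover have "\<not> (i < k \<and> k < j \<and> j < l)" if e: "(i, j) \<in> ?M" "(k, l) \<in> ?M" for i j k l
  proof
    assume lt: "i < k \<and> k < j \<and> j < l"
    then have "height la i j = height la i (k - 1) + height la k j" using height_split[of i "k - 1" j la] by simp
    then show False using matchedD(4)[OF e(1)] matchedD(5)[OF e(1), of "k - 1"] matchedD(5)[OF e(2), of j] lt by simp
  qed
  moreover have "\<not> (i < k \<and> k < j)" if "(i, j) \<in> ?M" "k \<in> rays ?c" for i j k
    using matched_inside[OF that(1), of k] that(2) by auto
  ultimately have "valid_cupd ?c"
    unfolding valid_cupd_def using assms matchedD(1) by auto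
  moreover have "la k \<in> {Circ, Cross}" if "free ?c k" for k
    using that unfolding free_def by (cases "la k") auto
  moreover have "\<not> (la k = Dn \<and> la l = Up)" if r: "k \<in> rays ?c" "l \<in> rays ?c" "k < l" for k l
  proof
    assume lab: "la k = Dn \<and> la l = Up"
    show False
    \<comment> \<open>According to the sign of the height between them, k has a partner to its right
      or l has one to its left; neither is possible for rays.\<close>
    proof (cases "height la k l \<le> 0")
      case True
      then obtain j where "(k, j) \<in> ?M" using match_right[of la k l] lab r(3) by auto
      then show False using r(1) by auto
    next
      case False
      then obtain i where "(i, l) \<in> ?M" using match_left[of la l k] lab r(3) by auto
      then show False using r(2) by auto
    qed
  qed
  moreover have "\<forall>(i, j)\<in>cups ?c. {la i, la j} = {Dn, Up}" by (auto dest: matchedD(2,3))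
  moreover have "\<forall>k\<in>rays ?c. la k \<in> {Dn, Up}" by simp
  ultimately show "oriented ?c la" unfolding oriented_def by blast
  show "degree ?c la = 0"
  proof -
    have "{(i, j) \<in> cups ?c. la i = Up} = {}" by (auto dest: matchedD(2))
    then show ?thesis unfolding degree_def by (simp only: card.empty)
  qed
qed

text \<open>Every labelled vertex under a cup of c lies on a cup nested inside it. Sending each
  \<open>Up\<close> to its left partner shows that the height stays positive under the cup, and
  sending each \<open>Dn\<close> to its right partner shows that it ends at 0.\<close>

lemma matched_cupd_unique:
  assumes o: "oriented c la" and deg: "degree c la = 0"
  shows "c = matched_cupd la"
proof -
  have v: "valid_cupd c" using o unfolding oriented_def by simp
  have fin: "finite (cups c)" using v unfolding valid_cupd_def by simp
  have lt: "i < j" if "(i, j) \<in> cups c" for i j using v that unfolding valid_cupd_def by blast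
  have disj: "i = k \<and> j = l" if e: "(i, j) \<in> cups c" "(k, l) \<in> cups c" and m: "{i, j} \<inter> {k, l} \<noteq> {}" for i j k l
  proof -
    have "\<forall>(i,j)\<in>cups c. \<forall>(k,l)\<in>cups c. (i,j) \<noteq> (k,l) \<longrightarrow> {i,j} \<inter> {k,l} = {}" using v unfolding valid_cupd_def by simp
    from case_prodD[OF bspec[OF case_prodD[OF bspec[OF this e(1)]] e(2)]] m show ?thesis by blast
  qed
  have nc: "\<not> (i < k \<and> k < j \<and> j < l)" if e: "(i, j) \<in> cups c" "(k, l) \<in> cups c" for i j k l
  proof -
    have "\<forall>(i,j)\<in>cups c. \<forall>(k,l)\<in>cups c. \<not> (i < k \<and> k < j \<and> j < l)" using v unfolding valid_cupd_def by simp
    from case_prodD[OF bspec[OF case_prodD[OF bspec[OF this e(1)]] e(2)]] show ?thesis .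
  qed
  have cr: "i \<notin> rays c \<and> j \<notin> rays c" if e: "(i, j) \<in> cups c" for i j
  proof -
    have "\<forall>(i,j)\<in>cups c. i \<notin> rays c \<and> j \<notin> rays c" using v unfolding valid_cupd_def by simp
    from case_prodD[OF bspec[OF this e]] show ?thesis .
  qed
  have nr: "\<not> (i < k \<and> k < j)" if e: "(i, j) \<in> cups c" "k \<in> rays c" for i j k
  proof -
    have "\<forall>(i,j)\<in>cups c. \<forall>k\<in>rays c. \<not> (i < k \<and> k < j)" using v unfolding valid_cupd_def by simp
    from bspec[OF case_prodD[OF bspec[OF this e(1)]] e(2)] show ?thesis .
  qed
  have lab: "la i = Dn \<and> la j = Up" if e: "(i, j) \<in> cups c" for i j
  proof -
    have "finite {(i, j) \<in> cups c. la i = Up}" using fin by (rule finite_subset[rotated]) auto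
    then have "{(i, j) \<in> cups c. la i = Up} = {}" using deg unfolding degree_def by simp
    then have "la i \<noteq> Up" using e by auto
    moreover have "\<forall>(i,j)\<in>cups c. {la i, la j} = {Dn, Up}" using o unfolding oriented_def by simp
    from case_prodD[OF bspec[OF this e]] have "{la i, la j} = {Dn, Up}" .
    ultimately show ?thesis by (auto simp: doubleton_eq_iff)
  qed
  have cov: "(\<exists>j. (k, j) \<in> cups c) \<or> (\<exists>i. (i, k) \<in> cups c) \<or> k \<in> rays c" if "la k \<in> {Dn, Up}" for k
  proof (rule ccontr)
    assume "\<not> ?thesis"
    then have "free c k" unfolding free_def by blast
    then have "la k \<in> {Circ, Cross}" using o unfolding oriented_def by simp
    then show False using that by auto
  qed
  define R where "R k = (SOME j. (k, j) \<in> cups c)" for k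
  define L where "L k = (SOME i. (i, k) \<in> cups c)" for k
  have Req: "R i = j" and Leq: "L j = i" if "(i, j) \<in> cups c" for i j
  proof -
    have "(i, R i) \<in> cups c" unfolding R_def by (rule someI) (rule that)
    then show "R i = j" using disj[OF that, of i "R i"] by simp
    have "(L j, j) \<in> cups c" unfolding L_def by (rule someI) (rule that)
    then show "L j = i" using disj[OF that, of "L j" j] by simp
  qed
  have inner: "(k, R k) \<in> cups c \<and> i < R k \<and> R k < j"
    if e: "(i, j) \<in> cups c" and k: "i < k" "k < j" "la k = Dn" for i j k
  proof -
    have "k \<notin> rays c" using nr[OF e] k by blast
    then obtain l where l: "(k, l) \<in> cups c" using cov[of k] k lab[of _ k] by auto
    have "l \<noteq> j" using disj[OF e l] k by auto
    then have "l < j" using nc[OF e l] k by auto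
    then show ?thesis using l Req[OF l] lt[OF l] k by auto
  qed
  have outer: "(L k, k) \<in> cups c \<and> i < L k \<and> L k < k"
    if e: "(i, j) \<in> cups c" and k: "i < k" "k < j" "la k = Up" for i j k
  proof -
    have "k \<notin> rays c" using nr[OF e] k by blast
    then obtain l where l: "(l, k) \<in> cups c" using cov[of k] k lab[of k] by auto
    have "l \<noteq> i" using disj[OF e l] k by auto
    moreover have "\<not> l < i" using nc[OF l e] k by auto
    ultimately show ?thesis using l Leq[OF l] lt[OF l] k by auto
  qed
  have sub: "(i, j) \<in> matched la" if e: "(i, j) \<in> cups c" for i j
  proof (rule matchedI)
    show ij: "i < j" and "la i = Dn" "la j = Up" using lt[OF e] lab[OF e] by auto
    have U: "card {k\<in>{i+1..x}. la k = Up} \<le> card {k\<in>{i+1..x}. la k = Dn}" if "x < j" for x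
    proof (rule card_inj_on_le[of L])
      show "inj_on L {k\<in>{i+1..x}. la k = Up}"
      proof (rule inj_onI)
        fix k k' assume kk: "k \<in> {k\<in>{i+1..x}. la k = Up}" "k' \<in> {k\<in>{i+1..x}. la k = Up}" "L k = L k'"
        have "(L k, k) \<in> cups c" "(L k, k') \<in> cups c"
          using outer[OF e, of k] outer[OF e, of k'] kk \<open>x < j\<close> by auto
        then show "k = k'" using disj[of "L k" k "L k" k'] by simp
      qed
      show "L ` {k\<in>{i+1..x}. la k = Up} \<subseteq> {k\<in>{i+1..x}. la k = Dn}"
      proof
        fix y assume "y \<in> L ` {k\<in>{i+1..x}. la k = Up}"
        then obtain k where k: "y = L k" "i < k" "k \<le> x" "la k = Up" by auto
        then have "(L k, k) \<in> cups c" "i < L k" "L k < k" using outer[OF e, of k] \<open>x < j\<close> by auto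
        then show "y \<in> {k\<in>{i+1..x}. la k = Dn}" using k lab by auto
      qed
    qed (rule finite_subset[of _ "{i+1..x}"], auto)
    have D: "card {k\<in>{i+1..j-1}. la k = Dn} \<le> card {k\<in>{i+1..j-1}. la k = Up}"
    proof (rule card_inj_on_le[of R])
      show "inj_on R {k\<in>{i+1..j-1}. la k = Dn}"
      proof (rule inj_onI)
        fix k k' assume kk: "k \<in> {k\<in>{i+1..j-1}. la k = Dn}" "k' \<in> {k\<in>{i+1..j-1}. la k = Dn}" "R k = R k'"
        have "(k, R k) \<in> cups c" "(k', R k) \<in> cups c"
          using inner[OF e, of k] inner[OF e, of k'] kk by auto
        then show "k = k'" using disj[of k "R k" k' "R k"] by simp
      qed
      show "R ` {k\<in>{i+1..j-1}. la k = Dn} \<subseteq> {k\<in>{i+1..j-1}. la k = Up}"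
      proof
        fix y assume "y \<in> R ` {k\<in>{i+1..j-1}. la k = Dn}"
        then obtain k where k: "y = R k" "i < k" "k < j" "la k = Dn" by auto
        then have "(k, R k) \<in> cups c" "i < R k" "R k < j" using inner[OF e, of k] by auto
        then show "y \<in> {k\<in>{i+1..j-1}. la k = Up}" using k lab by auto
      qed
    qed (rule finite_subset[of _ "{i+1..j-1}"], auto)
    have h: "height la i x = 1 + height la (i + 1) x" if "i \<le> x" for x
      using height_split[of i i x la] that lab[OF e] by (simp add: label_val_def)
    show "1 \<le> height la i k" if "i \<le> k" "k < j" for k
      using h[OF that(1)] U[OF that(2)] unfolding height_card[of la "i + 1" k] by simp
    have "height la (i + 1) (j - 1) = 0" unfolding height_card[of la "i + 1" "j - 1"] using D U[of "j - 1"] by simp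
    then have "height la i (j - 1) = 1" using h[of "j - 1"] ij by simp
    then show "height la i j = 0" using height_split[of i "j - 1" j la] ij lab[OF e] by (simp add: label_val_def)
  qed
  have M: "cups c = matched la"
  proof (intro equalityI subsetI)
    fix x assume "x \<in> cups c" then show "x \<in> matched la" using sub by (cases x) auto
  next
    fix x assume x: "x \<in> matched la"
    obtain i j where ij: "x = (i, j)" by (metis surj_pair)
    note D = matchedD[OF x[unfolded ij]]
    have "(i, j) \<in> cups c"
    proof (rule ccontr)
      assume n: "(i, j) \<notin> cups c"
      \<comment> \<open>Otherwise both ends would be rays, labelled \<open>Dn\<close> and
        \<open>Up\<close> in this order, which an orientation excludes.\<close>
      have "i \<in> rays c"
      proof -
        have "(i, j') \<notin> cups c" for j' using sub[of i j'] matched_unique_right[OF x[unfolded ij], of j'] n by auto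
        then show ?thesis using cov[of i] D(2) lab[of _ i] by auto
      qed
      moreover have "j \<in> rays c"
      proof -
        have "(i', j) \<notin> cups c" for i' using sub[of i' j] matched_unique_left[OF x[unfolded ij], of i'] n by auto
        then show ?thesis using cov[of j] D(3) lab[of j] by auto
      qed
      moreover have "\<forall>k\<in>rays c. \<forall>l\<in>rays c. k < l \<longrightarrow> \<not> (la k = Dn \<and> la l = Up)"
        using o unfolding oriented_def by simp
      ultimately show False using D(1-3) by blast
    qed
    then show "x \<in> cups c" using ij by simp
  qed
  have "rays c = rays (matched_cupd la)"
  proof (intro equalityI subsetI)
    fix k assume k: "k \<in> rays c"
    moreover have "\<forall>k\<in>rays c. la k \<in> {Dn, Up}" using o unfolding oriented_def by simp
    ultimately have "la k \<in> {Dn, Up}" by blast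
    moreover have "k \<noteq> i \<and> k \<noteq> j" if "(i, j) \<in> matched la" for i j using cr[of i j] that k unfolding M by auto
    ultimately show "k \<in> rays (matched_cupd la)" by auto
  next
    fix k assume "k \<in> rays (matched_cupd la)"
    then show "k \<in> rays c" using cov[of k] unfolding M by auto
  qed
  then show ?thesis using M by (intro cupd.equality) simp_all
qed

lemma underline_eq:
  assumes "finite (matched la)"
  shows "underline la = matched_cupd la"
  unfolding underline_def
proof (rule the_equality)
  show "oriented (matched_cupd la) la \<and> degree (matched_cupd la) la = 0"
    using matched_cupd_oriented[OF assms] by simp
  show "c = matched_cupd la" if "oriented c la \<and> degree c la = 0" for c
    using that by (intro matched_cupd_unique) simp_all
qed

section \<open>Blocks of weights\<close>

lemma same_block_refl: "same_block la la"
  unfolding same_block_def by (intro exI[of _ id]) simp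

lemma same_block_labels:
  assumes "same_block la \<mu>"
  shows "\<mu> k \<in> {Circ, Cross} \<or> la k \<in> {Circ, Cross} \<Longrightarrow> \<mu> k = la k"
proof -
  obtain \<sigma> where s: "bij \<sigma>" "\<And>i. la i \<in> {Circ, Cross} \<Longrightarrow> \<sigma> i = i" "\<mu> = la \<circ> \<sigma>"
    using assms unfolding same_block_def by blast
  assume "\<mu> k \<in> {Circ, Cross} \<or> la k \<in> {Circ, Cross}"
  then show "\<mu> k = la k"
  proof
    assume "\<mu> k \<in> {Circ, Cross}"
    then have "\<sigma> (\<sigma> k) = \<sigma> k" using s by simp
    then have "\<sigma> k = k" using bij_is_inj[OF s(1)] by (simp add: inj_eq)
    then show ?thesis using s by simp
  qed (use s in simp)
qed

lemma same_block_trans_sym: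
  assumes "same_block la \<mu>" "same_block la \<nu>"
  shows "same_block \<mu> \<nu>"
proof -
  obtain \<sigma> where s: "bij \<sigma>" "finite {i. \<sigma> i \<noteq> i}" "\<And>i. la i \<in> {Circ, Cross} \<Longrightarrow> \<sigma> i = i" "\<mu> = la \<circ> \<sigma>"
    using assms(1) unfolding same_block_def by blast
  obtain \<tau> where t: "bij \<tau>" "finite {i. \<tau> i \<noteq> i}" "\<And>i. la i \<in> {Circ, Cross} \<Longrightarrow> \<tau> i = i" "\<nu> = la \<circ> \<tau>"
    using assms(2) unfolding same_block_def by blast
  let ?\<rho> = "inv \<sigma> \<circ> \<tau>"
  have "inv \<sigma> i = i" if "\<sigma> i = i" for i using that s(1) by (metis bij_inv_eq_iff)
  then have fix1: "?\<rho> i = i" if "\<sigma> i = i" "\<tau> i = i" for i using that by simp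
  then have "{i. ?\<rho> i \<noteq> i} \<subseteq> {i. \<sigma> i \<noteq> i} \<union> {i. \<tau> i \<noteq> i}" by blast
  then have "finite {i. ?\<rho> i \<noteq> i}" by (rule finite_subset) (use s t in simp)
  moreover have "bij ?\<rho>" using s t by (simp add: bij_comp bij_imp_bij_inv)
  moreover have "?\<rho> i = i" if "\<mu> i \<in> {Circ, Cross}" for i
  proof -
    have "la i \<in> {Circ, Cross}" using same_block_labels[OF assms(1), of i] that by auto
    then show ?thesis using fix1[of i] s t by simp
  qed
  moreover have "\<nu> = \<mu> \<circ> ?\<rho>"
    using s(1,4) t(4) by (auto simp: fun_eq_iff bij_is_surj surj_f_inv_f)
  ultimately show ?thesis unfolding same_block_def by blast
qed

lemma same_block_swap:
  assumes "same_block la \<nu>" "\<nu> i \<in> {Dn, Up}" "\<nu> j \<in> {Dn, Up}"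
  shows "same_block la (\<nu>(i := \<nu> j, j := \<nu> i))"
proof -
  obtain \<sigma> where s: "bij \<sigma>" "finite {i. \<sigma> i \<noteq> i}" "\<And>i. la i \<in> {Circ, Cross} \<Longrightarrow> \<sigma> i = i" "\<nu> = la \<circ> \<sigma>"
    using assms(1) unfolding same_block_def by blast
  define \<tau> where "\<tau> = id(i := j, j := i)"
  have tt: "\<tau> (\<tau> k) = k" for k unfolding \<tau>_def by auto
  then have "bij \<tau>" by (intro o_bij[of \<tau>]) (auto simp: fun_eq_iff)
  then have "bij (\<sigma> \<circ> \<tau>)" using s by (simp add: bij_comp)
  moreover have "{k. (\<sigma> \<circ> \<tau>) k \<noteq> k} \<subseteq> {k. \<sigma> k \<noteq> k} \<union> {i, j}" unfolding \<tau>_def by auto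
  then have "finite {k. (\<sigma> \<circ> \<tau>) k \<noteq> k}" by (rule finite_subset) (use s in simp)
  moreover have "(\<sigma> \<circ> \<tau>) k = k" if "la k \<in> {Circ, Cross}" for k
  proof -
    have "\<nu> k \<in> {Circ, Cross}" using same_block_labels[OF assms(1), of k] that by auto
    then have "k \<noteq> i" "k \<noteq> j" using assms by auto
    then show ?thesis using s(3)[OF that] unfolding \<tau>_def by simp
  qed
  moreover have "\<nu>(i := \<nu> j, j := \<nu> i) = la \<circ> (\<sigma> \<circ> \<tau>)" using s(4) unfolding \<tau>_def by (auto simp: fun_eq_iff)
  ultimately show ?thesis unfolding same_block_def by blast
qed

lemma is_weight_cong_finite:
  assumes "is_weight la" "finite {k. \<mu> k \<noteq> la k}"
  shows "is_weight \<mu>"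
proof -
  obtain F where F: "finite F" "\<And>i j. i < j \<Longrightarrow> i \<notin> F \<Longrightarrow> j \<notin> F \<Longrightarrow> \<not> (la i = Dn \<and> la j = Up)"
    using assms(1) unfolding is_weight_def by blast
  show ?thesis unfolding is_weight_def
  proof (intro exI conjI allI impI)
    show "finite (F \<union> {k. \<mu> k \<noteq> la k})" using F assms by simp
    fix i j assume ij: "i < j \<and> i \<notin> F \<union> {k. \<mu> k \<noteq> la k} \<and> j \<notin> F \<union> {k. \<mu> k \<noteq> la k}"
    then have "\<mu> i = la i" "\<mu> j = la j" by simp_all
    then show "\<not> (\<mu> i = Dn \<and> \<mu> j = Up)" using F(2)[of i j] ij by simp
  qed
qed

locale finite_block =
  fixes L :: "weight set" and la0 :: weight
  assumes wt: "is_weight la0" and L: "L = {mu. is_weight mu \<and> same_block la0 mu}" and fin: "finite L"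
begin

definition S :: "int set" where "S = {k. la0 k \<in> {Dn, Up}}"

lemma la0_L: "la0 \<in> L" using wt same_block_refl unfolding L by simp

lemma L_block: "la \<in> L \<Longrightarrow> \<mu> \<in> L \<Longrightarrow> same_block la \<mu>"
  using same_block_trans_sym unfolding L by blast

lemma S_iff: "la \<in> L \<Longrightarrow> k \<in> S \<longleftrightarrow> la k \<in> {Dn, Up}"
proof -
  assume "la \<in> L"
  then have "la k \<in> {Circ, Cross} \<or> la0 k \<in> {Circ, Cross} \<Longrightarrow> la k = la0 k"
    using same_block_labels[of la0 la k] unfolding L by simp
  then show ?thesis unfolding S_def by (cases "la k"; cases "la0 k") auto
qed

lemma off_S: "la \<in> L \<Longrightarrow> \<mu> \<in> L \<Longrightarrow> k \<notin> S \<Longrightarrow> la k = \<mu> k"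
proof -
  assume l: "la \<in> L" "\<mu> \<in> L" and k: "k \<notin> S"
  have "la k \<in> {Circ, Cross}" using k S_iff[OF l(1)] by (cases "la k") auto
  then show "la k = \<mu> k" using same_block_labels[OF L_block[OF l], of k] by simp
qed

lemma vaS_eq: "vaS L = S"
  unfolding vaS_def using S_iff la0_L by auto

lemma swap_L:
  assumes "\<nu> \<in> L" "i \<in> S" "j \<in> S"
  shows "\<nu>(i := \<nu> j, j := \<nu> i) \<in> L"
proof -
  have "is_weight (\<nu>(i := \<nu> j, j := \<nu> i))"
  proof (rule is_weight_cong_finite)
    show "is_weight \<nu>" using assms unfolding L by simp
    show "finite {k. (\<nu>(i := \<nu> j, j := \<nu> i)) k \<noteq> \<nu> k}"
      by (rule finite_subset[of _ "{i, j}"]) auto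
  qed
  moreover have "same_block la0 (\<nu>(i := \<nu> j, j := \<nu> i))"
    using assms S_iff[OF assms(1)] by (intro same_block_swap) (auto simp: L)
  ultimately show ?thesis unfolding L by simp
qed

lemma card_label:
  assumes "la \<in> L" "\<mu> \<in> L"
  shows "card {k \<in> S. la k = x} = card {k \<in> S. \<mu> k = x}"
proof -
  obtain \<sigma> where s: "bij \<sigma>" "\<mu> = la \<circ> \<sigma>" using L_block[OF assms] unfolding same_block_def by blast
  have "bij_betw \<sigma> {k \<in> S. \<mu> k = x} {k \<in> S. la k = x}"
  proof (rule bij_betw_imageI)
    show "inj_on \<sigma> {k \<in> S. \<mu> k = x}" using bij_is_inj[OF s(1)] by (rule inj_on_subset) simp
    have "\<sigma> k \<in> S \<longleftrightarrow> k \<in> S" for k using S_iff[OF assms(1), of "\<sigma> k"] S_iff[OF assms(2), of k] s(2) by simp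
    moreover have "\<exists>k. y = \<sigma> k" for y using bij_is_surj[OF s(1)] by blast
    ultimately show "\<sigma> ` {k \<in> S. \<mu> k = x} = {k \<in> S. la k = x}" using s(2) by (auto simp: image_iff) (metis)
  qed
  then show ?thesis by (simp add: bij_betw_same_card)
qed

lemma pB_eq: "la \<in> L \<Longrightarrow> pB L = card {k \<in> S. la k = Up}"
  unfolding pB_def vaS_eq using card_label[of "SOME la. la \<in> L" la Up] la0_L by (metis someI)

lemma qB_eq: "la \<in> L \<Longrightarrow> qB L = card {k \<in> S. la k = Dn}"
  unfolding qB_def vaS_eq using card_label[of "SOME la. la \<in> L" la Dn] la0_L by (metis someI)

text \<open>If infinitely many vertices carry \<open>\<or>\<close> or \<open>\<and>\<close> then all these labels agree (otherwise the block
  would be infinite), so the block has a single weight; its closure in \<open>clw\<close> is the empty diagram.\<close>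

lemma infinite_S_labels:
  assumes "infinite S" "x \<in> S" "y \<in> S"
  shows "la0 x = la0 y"
proof (rule ccontr)
  assume ne: "la0 x \<noteq> la0 y"
  \<comment> \<open>Interchanging the label at u with each of infinitely many different labels gives
    infinitely many weights of the block.\<close>
  have *: False if u: "u \<in> S" "la0 u \<noteq> l" and inf: "infinite {k \<in> S. la0 k = l}" for u l
  proof -
    let ?f = "\<lambda>z. la0(u := la0 z, z := la0 u)"
    have "?f ` {k \<in> S. la0 k = l} \<subseteq> L" using swap_L[OF la0_L u(1)] by auto
    moreover have "inj_on ?f {k \<in> S. la0 k = l}"
    proof (rule inj_onI)
      fix z z' assume z: "z \<in> {k \<in> S. la0 k = l}" "z' \<in> {k \<in> S. la0 k = l}" "?f z = ?f z'"
      show "z = z'"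
      proof (rule ccontr)
        assume "z \<noteq> z'"
        have "la0 u = ?f z z" by simp
        also have "\<dots> = ?f z' z" by (simp only: z(3))
        also have "\<dots> = la0 z" using \<open>z \<noteq> z'\<close> z u by auto
        finally show False using z u by simp
      qed
    qed
    ultimately show False using fin inf finite_imageD finite_subset by blast
  qed
  have "S = {k \<in> S. la0 k = la0 x} \<union> {k \<in> S. la0 k = la0 y}"
    using assms(2,3) ne unfolding S_def by auto
  then have "infinite {k \<in> S. la0 k = la0 x} \<or> infinite {k \<in> S. la0 k = la0 y}" using assms(1) by (metis finite_UnI)
  then show False using *[of y "la0 x"] *[of x "la0 y"] assms ne by auto
qed

end

text \<open>The interface between weights and closed diagrams used in the final section.
  \<open>lower\<close> says that the closed weights form a down-set, the property behind I_Lambda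
  being an ideal.\<close>

locale closed_block =
  fixes L :: "weight set" and N :: int
  assumes closed: "\<And>al. al \<in> L \<Longrightarrow> closed_cupd N (underline (clw L al))"
    and self: "\<And>al. al \<in> L \<Longrightarrow> clw L al \<in> Or N (underline (clw L al))"
    and anticlockwise: "\<And>al i j. al \<in> L \<Longrightarrow> (i, j) \<in> cups (underline (clw L al)) \<Longrightarrow> clw L al i = Dn"
    and clw_inj: "inj_on (clw L) L"
    and subw_iff: "\<And>al la. al \<in> L \<Longrightarrow> la \<in> L \<Longrightarrow> subw al la \<longleftrightarrow> clw L la \<in> Or N (underline (clw L al))"
    and lower: "\<And>\<kappa> \<nu>. \<nu> \<in> L \<Longrightarrow> bruhat_le \<kappa> (clw L \<nu>) \<Longrightarrow> \<exists>\<mu>\<in>L. \<kappa> = clw L \<mu> \<and> bruhat_le \<mu> \<nu>"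

context finite_block
begin

lemma closed_block_infinite:
  assumes inf: "infinite S"
  shows "closed_block L 0"
proof -
  have single: "L = {la0}"
  proof -
    have "la = la0" if la: "la \<in> L" for la
    proof
      fix k
      obtain \<sigma> where s: "la = la0 \<circ> \<sigma>" using L_block[OF la0_L la] unfolding same_block_def by blast
      show "la k = la0 k"
      proof (cases "k \<in> S")
        case True
        then have "\<sigma> k \<in> S" using S_iff[OF la, of k] s unfolding S_def by simp
        then show ?thesis using infinite_S_labels[OF inf _ True] s by simp
      next
        case False then show ?thesis using off_S[OF la la0_L] by simp
      qed
    qed
    then show ?thesis using la0_L by blast
  qed
  \<comment> \<open>\<open>card\<close> of an infinite set is 0, so \<open>pB\<close> and
    \<open>qB\<close> vanish even when the labels occur infinitely often.\<close>
  have zero: "card {k \<in> S. la0 k = x} = 0" for x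
  proof (cases "\<exists>y\<in>S. la0 y = x")
    case True
    then obtain y where y: "y \<in> S" "la0 y = x" by blast
    have "{k \<in> S. la0 k = x} = S" using infinite_S_labels[OF inf _ y(1)] y(2) by auto
    then show ?thesis using inf by simp
  next
    case False
    then have "{k \<in> S. la0 k = x} = {}" by auto
    then show ?thesis by (simp only: card.empty)
  qed
  have cl: "clw L la0 = (\<lambda>_. Circ)"
    unfolding clw_def Let_def pB_eq[OF la0_L] qB_eq[OF la0_L] vaS_eq zero using inf by (auto simp: fun_eq_iff)
  let ?o = "(\<lambda>_. Circ) :: weight"
  have m0: "matched ?o = {}" unfolding matched_def by auto
  have u0: "underline ?o = matched_cupd ?o" by (rule underline_eq) (simp add: m0)
  have m1: "matched la0 = {}"
  proof -
    have "\<not> (la0 i = Dn \<and> la0 j = Up)" for i j using infinite_S_labels[OF inf, of i j] unfolding S_def by auto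
    then show ?thesis unfolding matched_def by auto
  qed
  then have f1: "finite (matched la0)" by simp
  have c0: "closed_cupd 0 (underline ?o)"
    unfolding closed_cupd_def u0 valid_cupd_def by (auto simp: m0 verts_def)
  have o0: "?o \<in> Or 0 (underline ?o)" unfolding Or_iff[OF c0] by (auto simp: verts_def flips_def)
  have "\<kappa> = ?o" if "bruhat_le \<kappa> ?o" for \<kappa>
    using that unfolding bruhat_le_def
  proof (cases rule: rtranclp.cases)
    case (rtrancl_into_rtrancl b)
    then obtain i j where "?o = b(i := Up, j := Dn)" unfolding bruhat_step_def by blast
    then have "?o j = Dn" by (metis fun_upd_same)
    then show ?thesis by simp
  qed simp
  moreover have "subw la0 la0"
    unfolding subw_def underline_eq[OF f1] using same_block_refl matched_cupd_oriented[OF f1] by simp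
  ultimately show ?thesis
    unfolding closed_block_def single using c0 o0 cl[unfolded single]
    by (auto simp: u0 m0 bruhat_le_refl)
qed

end

section \<open>Closures when finitely many vertices are labelled\<close>

locale finite_vertices = finite_block +
  assumes finS: "finite S"
begin

definition p where "p = int (pB L)"
definition n where "n = int (card S)"
definition q where "q = int (qB L)"
definition N where "N = p + n + q"
definition pos where "pos k = sorted_list_of_set S ! nat (k - p)"

abbreviation "mid \<equiv> {p..<p + n}"

lemma pqn: "p \<ge> 0" "q \<ge> 0" "n \<ge> 0" "p + q = n"
proof -
  have "S = {k \<in> S. la0 k = Up} \<union> {k \<in> S. la0 k = Dn}" unfolding S_def by auto
  moreover have "card ({k \<in> S. la0 k = Up} \<union> {k \<in> S. la0 k = Dn}) = card {k \<in> S. la0 k = Up} + card {k \<in> S. la0 k = Dn}"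
    using finS by (intro card_Un_disjoint) auto
  ultimately have "card S = pB L + qB L" unfolding pB_eq[OF la0_L] qB_eq[OF la0_L] by simp
  then show "p + q = n" unfolding p_def q_def n_def by simp
qed (simp_all add: p_def q_def n_def)

lemma clw_eq: "clw L la k = (if 0 \<le> k \<and> k < p then Dn else if k \<in> mid then la (pos k)
    else if p + n \<le> k \<and> k < N then Up else Circ)"
  unfolding clw_def Let_def vaS_eq p_def[symmetric] n_def[symmetric] q_def[symmetric] N_def pos_def by simp

lemma pos_mono: "k \<in> mid \<Longrightarrow> l \<in> mid \<Longrightarrow> k < l \<Longrightarrow> pos k < pos l"
proof -
  assume kl: "k \<in> mid" "l \<in> mid" "k < l"
  have "sorted_wrt (<) (sorted_list_of_set S)" by (rule strict_sorted_list_of_set)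
  moreover have "nat (k - p) < nat (l - p)" "nat (l - p) < length (sorted_list_of_set S)"
    using kl unfolding n_def by (auto simp: finS)
  ultimately show ?thesis unfolding pos_def by (simp add: sorted_wrt_nth_less)
qed

lemma pos_less_iff: "k \<in> mid \<Longrightarrow> l \<in> mid \<Longrightarrow> pos k < pos l \<longleftrightarrow> k < l"
  using pos_mono[of k l] pos_mono[of l k] by (cases k l rule: linorder_cases) auto

lemma pos_eq_iff: "k \<in> mid \<Longrightarrow> l \<in> mid \<Longrightarrow> pos k = pos l \<longleftrightarrow> k = l"
  using pos_mono[of k l] pos_mono[of l k] by (cases k l rule: linorder_cases) auto

lemma pos_S: "k \<in> mid \<Longrightarrow> pos k \<in> S"
proof -
  assume k: "k \<in> mid"
  then have "nat (k - p) < length (sorted_list_of_set S)" unfolding n_def by (auto simp: finS)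
  then have "pos k \<in> set (sorted_list_of_set S)" unfolding pos_def by (rule nth_mem)
  then show ?thesis by (simp add: finS)
qed

lemma S_pos: "x \<in> S \<Longrightarrow> \<exists>k\<in>mid. x = pos k"
proof -
  assume "x \<in> S"
  then have "x \<in> set (sorted_list_of_set S)" by (simp add: finS)
  then obtain m where "m < length (sorted_list_of_set S)" "x = sorted_list_of_set S ! m" by (metis in_set_conv_nth)
  then show ?thesis unfolding pos_def n_def by (intro bexI[of _ "p + int m"]) (auto simp: finS)
qed

lemma clw_inj: "inj_on (clw L) L"
proof (rule inj_onI)
  fix la \<mu> assume l: "la \<in> L" "\<mu> \<in> L" "clw L la = clw L \<mu>"
  show "la = \<mu>"
  proof
    fix x show "la x = \<mu> x"
    proof (cases "x \<in> S")
      case True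
      then obtain k where k: "k \<in> mid" "x = pos k" using S_pos by blast
      have "clw L la k = clw L \<mu> k" using l by simp
      then show ?thesis using k unfolding clw_eq by auto
    next
      case False then show ?thesis using off_S l by simp
    qed
  qed
qed

lemma clw_labels: "la \<in> L \<Longrightarrow> clw L la k \<in> {Dn, Up} \<longleftrightarrow> k \<in> verts N"
  unfolding clw_eq verts_def using pqn pos_S[of k] S_iff[of la "pos k"] N_def by auto

lemma clw_outside: "k \<notin> verts N \<Longrightarrow> clw L la k = Circ"
  unfolding clw_eq verts_def using pqn N_def by auto

lemma height_clw:
  assumes "la \<in> L" "k \<in> mid" "l \<in> mid"
  shows "height (clw L la) k l = height la (pos k) (pos l)"
proof -
  have "height (clw L la) k l = (\<Sum>m\<in>{k..l}. label_val (la (pos m)))"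
    unfolding height_def by (rule sum.cong) (use assms in \<open>auto simp: clw_eq\<close>)
  also have "\<dots> = (\<Sum>x\<in>pos ` {k..l}. label_val (la x))"
    by (rule sum.reindex_cong[symmetric, of pos]) (use assms pos_eq_iff in \<open>auto simp: inj_on_def\<close>)
  also have "\<dots> = (\<Sum>x\<in>{pos k..pos l}. label_val (la x))"
  proof (rule sum.mono_neutral_left)
    have le: "pos m \<le> pos m'" if "m \<in> mid" "m' \<in> mid" "m \<le> m'" for m m' using pos_mono[of m m'] that by (cases "m = m'") auto
    show "pos ` {k..l} \<subseteq> {pos k..pos l}" using assms by (auto intro!: le)
    show "\<forall>x\<in>{pos k..pos l} - pos ` {k..l}. label_val (la x) = 0"
    proof
      fix x assume x: "x \<in> {pos k..pos l} - pos ` {k..l}"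
      have "x \<notin> S"
      proof
        assume "x \<in> S"
        then obtain m where m: "m \<in> mid" "x = pos m" using S_pos by blast
        then have "k \<le> m \<and> m \<le> l" using x pos_less_iff[OF m(1) assms(2)] pos_less_iff[OF assms(3) m(1)] by auto
        then show False using x m by auto
      qed
      then show "label_val (la x) = 0" using S_iff[OF assms(1), of x] unfolding label_val_def by auto
    qed
  qed simp
  finally show ?thesis unfolding height_def .
qed

text \<open>\<open>pos\<close> enumerates the labelled vertices in increasing order, and the
  vertices that it skips do not change heights.\<close>

lemma matched_clw:
  assumes la: "la \<in> L" and k: "k \<in> mid" and l: "l \<in> mid"
  shows "(k, l) \<in> matched (clw L la) \<longleftrightarrow> (pos k, pos l) \<in> matched la"
proof -
  have "(\<forall>m. k \<le> m \<and> m < l \<and> clw L la m \<in> {Dn, Up} \<longrightarrow> 1 \<le> height (clw L la) k m)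
    \<longleftrightarrow> (\<forall>x. pos k \<le> x \<and> x < pos l \<and> la x \<in> {Dn, Up} \<longrightarrow> 1 \<le> height la (pos k) x)" (is "?A \<longleftrightarrow> ?B")
  proof
    assume A: ?A
    show ?B
    proof (intro allI impI)
      fix x assume x: "pos k \<le> x \<and> x < pos l \<and> la x \<in> {Dn, Up}"
      then obtain m where m: "m \<in> mid" "x = pos m" using S_iff[OF la] S_pos by blast
      then have "k \<le> m" "m < l" using x pos_less_iff[OF m(1) k] pos_less_iff[OF m(1) l] by auto
      moreover have "clw L la m \<in> {Dn, Up}" using x m by (simp add: clw_eq)
      ultimately show "1 \<le> height la (pos k) x" using A height_clw[OF la k m(1)] m by auto
    qed
  next
    assume B: ?B
    show ?A
    proof (intro allI impI)
      fix m assume m: "k \<le> m \<and> m < l \<and> clw L la m \<in> {Dn, Up}"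
      then have mm: "m \<in> mid" using k l by auto
      then have "pos k \<le> pos m" "pos m < pos l" using m pos_less_iff[OF mm k] pos_less_iff[OF mm l] by auto
      moreover have "la (pos m) \<in> {Dn, Up}" using pos_S[OF mm] S_iff[OF la] by simp
      ultimately show "1 \<le> height (clw L la) k m" using B height_clw[OF la k mm] by auto
    qed
  qed
  moreover have "clw L la k = la (pos k)" "clw L la l = la (pos l)" using k l by (simp_all add: clw_eq)
  ultimately show ?thesis
    unfolding matched_def using pos_less_iff[OF k l] height_clw[OF la k l] by simp
qed

end

section \<open>Cup diagrams and orientations of the closure\<close>

context finite_vertices
begin

lemma finite_matched: "la \<in> L \<Longrightarrow> finite (matched la)"
proof -
  assume l: "la \<in> L"
  have "matched la \<subseteq> S \<times> S" using matchedD(2,3)[of _ _ la] S_iff[OF l] by auto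
  then show ?thesis by (rule finite_subset) (use finS in simp)
qed

lemma finite_matched_clw: "la \<in> L \<Longrightarrow> finite (matched (clw L la))"
proof -
  assume l: "la \<in> L"
  have "i \<in> verts N \<and> j \<in> verts N" if "(i, j) \<in> matched (clw L la)" for i j
    using matchedD(2,3)[OF that] clw_labels[OF l, of i] clw_labels[OF l, of j] by simp
  then have "matched (clw L la) \<subseteq> verts N \<times> verts N" by auto
  then show ?thesis by (rule finite_subset) simp
qed

lemma underline_L: "la \<in> L \<Longrightarrow> underline la = matched_cupd la"
  by (rule underline_eq[OF finite_matched])

lemma underline_clw: "la \<in> L \<Longrightarrow> underline (clw L la) = matched_cupd (clw L la)"
  by (rule underline_eq[OF finite_matched_clw])

lemma card_mid: "card {k \<in> mid. la (pos k) = x} = card {y \<in> S. la y = x}"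
proof -
  have "bij_betw pos {k \<in> mid. la (pos k) = x} {y \<in> S. la y = x}"
  proof (rule bij_betw_imageI)
    show "inj_on pos {k \<in> mid. la (pos k) = x}" using pos_eq_iff by (intro inj_onI) auto
    show "pos ` {k \<in> mid. la (pos k) = x} = {y \<in> S. la y = x}"
    proof (intro equalityI subsetI)
      fix y assume "y \<in> pos ` {k \<in> mid. la (pos k) = x}"
      then show "y \<in> {y \<in> S. la y = x}" using pos_S by blast
    next
      fix y assume y: "y \<in> {y \<in> S. la y = x}"
      then obtain k where "k \<in> mid" "y = pos k" using S_pos by blast
      then show "y \<in> pos ` {k \<in> mid. la (pos k) = x}" using y by blast
    qed
  qed
  then show ?thesis by (rule bij_betw_same_card)
qed

lemma card_clw:
  assumes "la \<in> L"
  shows "int (card {k. clw L la k = Dn}) = n" "int (card {k. clw L la k = Up}) = n"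
    "int (card {k \<in> mid. la (pos k) = Up}) = p"
proof -
  have D: "{k. clw L la k = Dn} = {0..<p} \<union> {k \<in> mid. la (pos k) = Dn}" using pqn by (auto simp: clw_eq)
  have U: "{k. clw L la k = Up} = {k \<in> mid. la (pos k) = Up} \<union> {p + n..<N}" using pqn by (auto simp: clw_eq)
  have fm: "finite {k \<in> mid. la (pos k) = x}" for x by (rule finite_subset[of _ mid]) auto
  have "card ({0..<p} \<union> {k \<in> mid. la (pos k) = Dn}) = card {0..<p} + card {k \<in> mid. la (pos k) = Dn}"
    by (rule card_Un_disjoint[OF _ fm]) auto
  then have "card {k. clw L la k = Dn} = nat p + qB L"
    unfolding D card_mid qB_eq[OF assms] by simp
  then show "int (card {k. clw L la k = Dn}) = n" using pqn q_def by simp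
  have "card ({k \<in> mid. la (pos k) = Up} \<union> {p + n..<N}) = card {k \<in> mid. la (pos k) = Up} + card {p + n..<N}"
    by (rule card_Un_disjoint[OF fm]) auto
  then have "card {k. clw L la k = Up} = pB L + nat q"
    unfolding U card_mid pB_eq[OF assms] by (simp add: N_def)
  then show "int (card {k. clw L la k = Up}) = n" using pqn p_def by simp
  have "card {k \<in> mid. la (pos k) = Up} = pB L" unfolding card_mid pB_eq[OF assms] ..
  from arg_cong[OF this, of int] show "int (card {k \<in> mid. la (pos k) = Up}) = p" unfolding p_def[symmetric] .
qed

lemma finite_clw_label: "la \<in> L \<Longrightarrow> x \<in> {Dn, Up} \<Longrightarrow> finite {k. clw L la k = x}"
  by (rule finite_subset[of _ "verts N"]) (use clw_labels in auto)

text \<open>The p leading \<open>Dn\<close> outweigh the p labels \<open>Up\<close> of the middle;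
  once the trailing \<open>Up\<close> begin, every \<open>Dn\<close> has been passed and the totals
  are equal.\<close>

lemma prefix_nonneg:
  assumes la: "la \<in> L" shows "0 \<le> height (clw L la) 0 x"
proof -
  let ?D = "{k \<in> {0..x}. clw L la k = Dn}" and ?U = "{k \<in> {0..x}. clw L la k = Up}"
  have fU: "finite ?U" "finite ?D" by (rule finite_subset[of _ "{0..x}"]; auto)+
  have "card ?U \<le> card ?D"
  proof (cases "x < p + n")
    case True
    show ?thesis
    proof (cases "x < p")
      case True
      then have "?U = {}" by (auto simp: clw_eq)
      then show ?thesis by (simp only: card.empty)
    next
      case False
      have "?U \<subseteq> {k \<in> mid. la (pos k) = Up}" using True by (auto simp: clw_eq split: if_splits)
      then have "card ?U \<le> card {k \<in> mid. la (pos k) = Up}" by (intro card_mono) (auto intro: finite_subset[of _ mid])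
      also have "\<dots> = nat p" using card_clw(3)[OF la] by linarith
      also have "\<dots> = card {0..<p}" by simp
      also have "\<dots> \<le> card ?D"
      proof (rule card_mono[OF fU(2)])
        show "{0..<p} \<subseteq> ?D"
        proof
          fix k assume "k \<in> {0..<p}"
          then show "k \<in> ?D" using False by (simp add: clw_eq)
        qed
      qed
      finally show ?thesis .
    qed
  next
    case False
    have "card ?U \<le> card {k. clw L la k = Up}" using finite_clw_label[OF la] by (intro card_mono) auto
    also have "\<dots> = card {k. clw L la k = Dn}" using card_clw[OF la] by simp
    also have "{k. clw L la k = Dn} = ?D" using False pqn by (auto simp: clw_eq split: if_splits)
    finally show ?thesis .
  qed
  then show ?thesis unfolding height_card by simp
qed

lemma total_zero:
  assumes la: "la \<in> L" shows "height (clw L la) 0 (N - 1) = 0"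
proof -
  have "k \<in> {0..N - 1}" if "clw L la k = x" "x \<in> {Dn, Up}" for k x
    using clw_labels[OF la, of k] that unfolding verts_def by auto
  then have "{k \<in> {0..N - 1}. clw L la k = Dn} = {k. clw L la k = Dn}"
    "{k \<in> {0..N - 1}. clw L la k = Up} = {k. clw L la k = Up}" by blast+
  then show ?thesis unfolding height_card using card_clw[OF la] by simp
qed

text \<open>Nonnegative prefixes and total height 0 form the ballot condition, under which every
  bracket has a partner. This is why closures have no rays.\<close>

lemma all_matched:
  assumes la: "la \<in> L" and k: "k \<in> verts N"
  shows "\<exists>(i, j)\<in>matched (clw L la). k = i \<or> k = j"
proof -
  have kN: "0 \<le> k" "k \<le> N - 1" using k unfolding verts_def by auto
  consider "clw L la k = Dn" | "clw L la k = Up" using clw_labels[OF la, of k] k by auto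
  then show ?thesis
  proof cases
    case 1
    have "height (clw L la) 0 (N - 1) = height (clw L la) 0 (k - 1) + height (clw L la) k (N - 1)"
      using height_split[of 0 "k - 1" "N - 1" "clw L la"] kN by simp
    then have "height (clw L la) k (N - 1) \<le> 0" using prefix_nonneg[OF la, of "k - 1"] total_zero[OF la] by simp
    then obtain j where "(k, j) \<in> matched (clw L la)" using match_right[of "clw L la" k "N - 1"] 1 kN by auto
    then show ?thesis by blast
  next
    case 2
    obtain i where "(i, k) \<in> matched (clw L la)"
      using match_left[of "clw L la" k 0] 2 kN prefix_nonneg[OF la, of k] by auto
    then show ?thesis by blast
  qed
qed

lemma closed_clw:
  assumes la: "la \<in> L" shows "closed_cupd N (matched_cupd (clw L la))"
proof -
  have v: "valid_cupd (matched_cupd (clw L la))"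
    using matched_cupd_oriented(1)[OF finite_matched_clw[OF la]] unfolding oriented_def by simp
  have "k \<in> verts N" if "(i, j) \<in> matched (clw L la)" "k = i \<or> k = j" for i j k
    using that matchedD(2,3)[OF that(1)] clw_labels[OF la, of k] by auto
  then have ends: "k \<in> verts N \<longleftrightarrow> (\<exists>(i, j)\<in>matched (clw L la). k = i \<or> k = j)" for k
    using all_matched[OF la, of k] by blast
  have "k \<notin> rays (matched_cupd (clw L la))" for k
  proof
    assume k: "k \<in> rays (matched_cupd (clw L la))"
    then have "k \<in> verts N" using clw_labels[OF la, of k] by simp
    then show False using all_matched[OF la, of k] k by auto
  qed
  then have "rays (matched_cupd (clw L la)) = {}" by blast
  then show ?thesis unfolding closed_cupd_def using v ends by simp
qed

lemma Or_arcs: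
  assumes al: "al \<in> L" and la: "la \<in> L"
  shows "clw L la \<in> Or N (matched_cupd (clw L al)) \<longleftrightarrow>
    (\<forall>(k, l)\<in>matched (clw L al). {clw L la k, clw L la l} = {Dn, Up})"
proof -
  note c = closed_clw[OF al]
  have "rays (matched_cupd (clw L al)) = {}" "valid_cupd (matched_cupd (clw L al))" using c unfolding closed_cupd_def by auto
  then show ?thesis unfolding Or_def oriented_def closed_cupd_free[OF c]
    using clw_outside by auto
qed

lemma oriented_L:
  assumes al: "al \<in> L" and la: "la \<in> L"
  shows "oriented (matched_cupd al) la \<longleftrightarrow> (\<forall>(i, j)\<in>matched al. {la i, la j} = {Dn, Up}) \<and>
    (\<forall>k\<in>rays (matched_cupd al). \<forall>l\<in>rays (matched_cupd al). k < l \<longrightarrow> \<not> (la k = Dn \<and> la l = Up))"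
proof -
  have "valid_cupd (matched_cupd al)"
    using matched_cupd_oriented(1)[OF finite_matched[OF al]] unfolding oriented_def by simp
  moreover have "la k \<in> {Circ, Cross}" if "free (matched_cupd al) k" for k
  proof -
    have "al k \<notin> {Dn, Up}" using that unfolding free_def by auto
    then have "la k \<notin> {Dn, Up}" using S_iff[OF al] S_iff[OF la] by simp
    then show ?thesis by (cases "la k") auto
  qed
  moreover have "la k \<in> {Dn, Up}" if "k \<in> rays (matched_cupd al)" for k
    using that S_iff[OF al, of k] S_iff[OF la, of k] by simp
  ultimately show ?thesis unfolding oriented_def by auto
qed

definition ends :: "weight \<Rightarrow> int set" where
  "ends al = {x. \<exists>(i, j)\<in>matched al. x = i \<or> x = j}"

lemma card_ends_Up:
  assumes "\<And>i j. (i, j) \<in> matched al \<Longrightarrow> {\<mu> i, \<mu> j} = {Dn, Up}"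
  shows "card {x \<in> ends al. \<mu> x = Up} = card (matched al)"
proof -
  let ?h = "\<lambda>(i, j). if \<mu> i = Up then i else j"
  have lab: "(\<mu> i = Up \<and> \<mu> j = Dn) \<or> (\<mu> i = Dn \<and> \<mu> j = Up)" if "(i, j) \<in> matched al" for i j
    using assms[OF that] by (auto simp: doubleton_eq_iff)
  have disj: "i = k \<and> j = l" if m: "(i, j) \<in> matched al" "(k, l) \<in> matched al" and x: "x \<in> {i, j}" "x \<in> {k, l}" for i j k l x
  proof -
    have "al i = Dn" "al j = Up" "al k = Dn" "al l = Up" using matchedD(2,3)[OF m(1)] matchedD(2,3)[OF m(2)] by auto
    then consider "i = k" | "j = l" using x by fastforce
    then show ?thesis
    proof cases
      case 1
      then show ?thesis using matched_unique_right[OF m(1), of l] m(2) by simp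
    next
      case 2
      then show ?thesis using matched_unique_left[OF m(1), of k] m(2) by simp
    qed
  qed
  have "bij_betw ?h (matched al) {x \<in> ends al. \<mu> x = Up}"
  proof (rule bij_betw_imageI)
    show "inj_on ?h (matched al)"
    proof (rule inj_onI, clarify)
      fix i j k l assume e: "(i, j) \<in> matched al" "(k, l) \<in> matched al"
        "(if \<mu> i = Up then i else j) = (if \<mu> k = Up then k else l)"
      show "i = k \<and> j = l"
        by (rule disj[OF e(1,2), of "if \<mu> i = Up then i else j"]) (simp, unfold e(3), simp)
    qed
    show "?h ` matched al = {x \<in> ends al. \<mu> x = Up}"
    proof (intro equalityI subsetI)
      fix x assume "x \<in> ?h ` matched al"
      then obtain i j where "(i, j) \<in> matched al" "x = (if \<mu> i = Up then i else j)" by auto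
      then show "x \<in> {x \<in> ends al. \<mu> x = Up}" using lab[of i j] unfolding ends_def by auto
    next
      fix x assume "x \<in> {x \<in> ends al. \<mu> x = Up}"
      then obtain i j where ij: "(i, j) \<in> matched al" "x = i \<or> x = j" "\<mu> x = Up" unfolding ends_def by auto
      then have "x = ?h (i, j)" using lab[OF ij(1)] by auto
      then show "x \<in> ?h ` matched al" using ij(1) by blast
    qed
  qed
  then show ?thesis by (simp add: bij_betw_same_card)
qed

text \<open>In an orientation the \<open>Up\<close> rays form an initial segment of the rays. Its
  length is fixed, because the block fixes the number of labels \<open>Up\<close> and each cup takes
  exactly one of them.\<close>

lemma rays_agree:
  assumes al: "al \<in> L" and la: "la \<in> L" and o: "oriented (matched_cupd al) la" and x: "x \<in> S" "x \<notin> ends al"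
  shows "la x = al x"
proof -
  define R where "R = S - ends al"
  have R: "R = rays (matched_cupd al)"
  proof (rule set_eqI)
    fix k
    have "k \<notin> ends al \<longleftrightarrow> (\<forall>(i, j)\<in>matched al. k \<noteq> i \<and> k \<noteq> j)" unfolding ends_def by auto
    then show "k \<in> R \<longleftrightarrow> k \<in> rays (matched_cupd al)" unfolding R_def matched_cupd_sel(2) using S_iff[OF al, of k] by blast
  qed
  have fR: "finite R" unfolding R_def using finS by simp
  have eS: "ends al \<subseteq> S" unfolding ends_def using matchedD(2,3)[of _ _ al] S_iff[OF al] by auto
  have oal: "oriented (matched_cupd al) al" by (rule matched_cupd_oriented(1)[OF finite_matched[OF al]])
  define U where "U \<mu> = {x \<in> R. \<mu> x = Up}" for \<mu> :: weight
  have cU: "card (U \<mu>) + card (matched al) = pB L" if m: "\<mu> \<in> L" "oriented (matched_cupd al) \<mu>" for \<mu>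
  proof -
    have "card {x \<in> ends al. \<mu> x = Up} = card (matched al)"
      by (rule card_ends_Up) (use m oriented_L[OF al m(1)] in auto)
    moreover have "{x \<in> S. \<mu> x = Up} = U \<mu> \<union> {x \<in> ends al. \<mu> x = Up}" unfolding U_def R_def using eS by auto
    moreover have "card (U \<mu> \<union> {x \<in> ends al. \<mu> x = Up}) = card (U \<mu>) + card {x \<in> ends al. \<mu> x = Up}"
      using fR finite_subset[OF eS finS] by (intro card_Un_disjoint) (auto simp: U_def R_def)
    ultimately show ?thesis using pB_eq[OF m(1)] by simp
  qed
  have down: "y \<in> U \<mu>" if m: "\<mu> \<in> L" "oriented (matched_cupd al) \<mu>" and y: "z \<in> U \<mu>" "y \<in> R" "y < z" for \<mu> y z
  proof -
    have "\<not> (\<mu> y = Dn \<and> \<mu> z = Up)" using m(2) y unfolding oriented_L[OF al m(1)] R[symmetric] U_def by blast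
    moreover have "\<mu> y \<in> {Dn, Up}" using y(2) S_iff[OF m(1), of y] unfolding R_def by simp
    ultimately show ?thesis using y unfolding U_def by auto
  qed
  have "U la \<subseteq> U al \<or> U al \<subseteq> U la"
  proof (rule ccontr)
    assume "\<not> ?thesis"
    then obtain y z where yz: "y \<in> U la" "y \<notin> U al" "z \<in> U al" "z \<notin> U la" by blast
    then have "y \<in> R" "z \<in> R" "y \<noteq> z" unfolding U_def by auto
    then show False using down[OF la o yz(1)] down[OF al oal yz(3)] yz by (metis linorder_neqE_linordered_idom)
  qed
  moreover have "card (U la) = card (U al)" using cU[OF la o] cU[OF al oal] by simp
  moreover have "finite (U la)" "finite (U al)" unfolding U_def using fR by auto
  ultimately have "U la = U al" by (metis card_subset_eq)
  then have "la x = Up \<longleftrightarrow> al x = Up" using x unfolding U_def R_def by blast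
  then show ?thesis using S_iff[OF al, of x] S_iff[OF la, of x] x(1) by auto
qed

lemma mid_ends:
  assumes al: "al \<in> L" and k: "k \<in> mid"
  shows "pos k \<in> ends al \<longleftrightarrow> (\<exists>l\<in>mid. (k, l) \<in> matched (clw L al) \<or> (l, k) \<in> matched (clw L al))"
proof
  assume "pos k \<in> ends al"
  then obtain i j where ij: "(i, j) \<in> matched al" "pos k = i \<or> pos k = j" unfolding ends_def by auto
  then have "i \<in> S" "j \<in> S" using matchedD(2,3)[OF ij(1)] S_iff[OF al] by auto
  then obtain k' l' where kl: "k' \<in> mid" "l' \<in> mid" "i = pos k'" "j = pos l'" using S_pos by metis
  then have "(k', l') \<in> matched (clw L al)" using matched_clw[OF al kl(1,2)] ij(1) by simp
  then show "\<exists>l\<in>mid. (k, l) \<in> matched (clw L al) \<or> (l, k) \<in> matched (clw L al)"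
    using ij(2) kl pos_eq_iff[OF k kl(1)] pos_eq_iff[OF k kl(2)] by auto
next
  assume "\<exists>l\<in>mid. (k, l) \<in> matched (clw L al) \<or> (l, k) \<in> matched (clw L al)"
  then obtain l where "l \<in> mid" "(k, l) \<in> matched (clw L al) \<or> (l, k) \<in> matched (clw L al)" by blast
  then have "(pos k, pos l) \<in> matched al \<or> (pos l, pos k) \<in> matched al" using matched_clw[OF al] k by blast
  then show "pos k \<in> ends al" unfolding ends_def by auto
qed

text \<open>The rays of \<open>underline al\<close> become the arcs of the closure ending at the added vertices: rays
  labelled \<open>\<and>\<close> go to the left, rays labelled \<open>\<or>\<close> to the right.\<close>

lemma oriented_clw:
  assumes al: "al \<in> L" and la: "la \<in> L"
  shows "oriented (matched_cupd al) la \<longleftrightarrow> clw L la \<in> Or N (matched_cupd (clw L al))"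
proof
  assume o: "oriented (matched_cupd al) la"
  have "{clw L la k, clw L la l} = {Dn, Up}" if kl: "(k, l) \<in> matched (clw L al)" for k l
  proof -
    note D = matchedD[OF kl]
    have vk: "k \<in> verts N" "l \<in> verts N" using D(2,3) clw_labels[OF al] by auto
    have k: "k < p \<or> k \<in> mid" using D(2) vk(1) unfolding verts_def by (auto simp: clw_eq split: if_splits)
    have l: "l \<in> mid \<or> p + n \<le> l" using D(3) vk(2) unfolding verts_def by (auto simp: clw_eq split: if_splits)
    have k1: "clw L la k = Dn" if "k < p" using that vk(1) unfolding verts_def by (simp add: clw_eq)
    have l1: "clw L la l = Up" if "p + n \<le> l" using that vk(2) pqn unfolding verts_def by (simp add: clw_eq)
    \<comment> \<open>Here \<open>pos k\<close> lies on a ray of \<open>underline al\<close>, where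
      \<open>la\<close> and \<open>al\<close> agree.\<close>
    have k2: "clw L la k = Dn" if km: "k \<in> mid" "l \<notin> mid"
    proof -
      have "pos k \<notin> ends al"
      proof
        assume "pos k \<in> ends al"
        then obtain l' where l': "l' \<in> mid" "(k, l') \<in> matched (clw L al) \<or> (l', k) \<in> matched (clw L al)"
          using mid_ends[OF al km(1)] by blast
        then show False using matched_unique_right[OF kl, of l'] matchedD(3)[of l' k "clw L al"] D(2) km by auto
      qed
      then have "la (pos k) = al (pos k)" by (rule rays_agree[OF al la o pos_S[OF km(1)]])
      then show ?thesis using D(2) km by (simp add: clw_eq)
    qed
    have l2: "clw L la l = Up" if lm: "l \<in> mid" "k \<notin> mid"
    proof -
      have "pos l \<notin> ends al"
      proof
        assume "pos l \<in> ends al"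
        then obtain k' where k': "k' \<in> mid" "(l, k') \<in> matched (clw L al) \<or> (k', l) \<in> matched (clw L al)"
          using mid_ends[OF al lm(1)] by blast
        then show False using matched_unique_left[OF kl, of k'] matchedD(2)[of l k' "clw L al"] D(3) lm by auto
      qed
      then have "la (pos l) = al (pos l)" by (rule rays_agree[OF al la o pos_S[OF lm(1)]])
      then show ?thesis using D(3) lm by (simp add: clw_eq)
    qed
    show ?thesis
    proof (cases "k \<in> mid \<and> l \<in> mid")
      case True
      then have "(pos k, pos l) \<in> matched al" using matched_clw[OF al] kl by blast
      then have "{la (pos k), la (pos l)} = {Dn, Up}" using o unfolding oriented_L[OF al la] by blast
      then show ?thesis using True by (simp add: clw_eq)
    next
      case False
      then have "clw L la k = Dn" "clw L la l = Up" using k l k1 k2 l1 l2 by auto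
      then show ?thesis by simp
    qed
  qed
  then show "clw L la \<in> Or N (matched_cupd (clw L al))" unfolding Or_arcs[OF al la] by blast
next
  assume o: "clw L la \<in> Or N (matched_cupd (clw L al))"
  then have arcs: "\<And>k l. (k, l) \<in> matched (clw L al) \<Longrightarrow> {clw L la k, clw L la l} = {Dn, Up}"
    unfolding Or_arcs[OF al la] by blast
  note c = closed_clw[OF al]
  show "oriented (matched_cupd al) la"
    unfolding oriented_L[OF al la]
  proof (intro conjI ballI impI)
    fix e assume e: "e \<in> matched al"
    obtain i j where ij: "e = (i, j)" by (metis surj_pair)
    then have "i \<in> S" "j \<in> S" using matchedD(2,3)[of i j al] e S_iff[OF al] by auto
    then obtain k l where kl: "k \<in> mid" "l \<in> mid" "i = pos k" "j = pos l" using S_pos by metis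
    then have "(k, l) \<in> matched (clw L al)" using matched_clw[OF al kl(1,2)] e ij by simp
    then have "{clw L la k, clw L la l} = {Dn, Up}" by (rule arcs)
    then show "case e of (i, j) \<Rightarrow> {la i, la j} = {Dn, Up}" using kl ij by (simp add: clw_eq)
  next
    fix x y assume xy: "x \<in> rays (matched_cupd al)" "y \<in> rays (matched_cupd al)" "x < y"
    then have S: "x \<in> S" "y \<in> S" and ne: "x \<notin> ends al" "y \<notin> ends al"
      using S_iff[OF al] unfolding ends_def by auto
    obtain k l where kl: "k \<in> mid" "l \<in> mid" "x = pos k" "y = pos l" using S S_pos by metis
    then have lt: "k < l" using pos_less_iff xy(3) by simp
    show "\<not> (la x = Dn \<and> la y = Up)"
    proof
      assume lab: "la x = Dn \<and> la y = Up"
      have V: "k \<in> verts N" "l \<in> verts N" using kl pqn unfolding verts_def N_def by auto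
      obtain k' where k': "(k, k') \<in> matched (clw L al) \<or> (k', k) \<in> matched (clw L al)"
        using all_matched[OF al V(1)] by auto
      obtain l' where l': "(l, l') \<in> matched (clw L al) \<or> (l', l) \<in> matched (clw L al)"
        using all_matched[OF al V(2)] by auto
      have nm: "k' \<notin> mid" "l' \<notin> mid" using mid_ends[OF al kl(1)] mid_ends[OF al kl(2)] ne kl k' l' by auto
      have ck: "clw L la k = Dn" "clw L la l = Up" using lab kl by (simp_all add: clw_eq)
      \<comment> \<open>The partners of k and l lie outside the middle and carry the opposite
        labels, so k is joined to the right end and l to the left end. For k < l these two arcs
        would cross.\<close>
      have cu: "clw L la k' = Up"
        using k' arcs[of k k'] arcs[of k' k] ck(1) by (auto simp: doubleton_eq_iff)
      have cd: "clw L la l' = Dn"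
        using l' arcs[of l l'] arcs[of l' l] ck(2) by (auto simp: doubleton_eq_iff)
      have b1: "p + n \<le> k'" using cu nm(1) by (auto simp: clw_eq split: if_splits)
      have b2: "l' < p" using cd nm(2) by (auto simp: clw_eq split: if_splits)
      have e1: "(k, k') \<in> matched (clw L al)" using k' matchedD(1)[of k' k] b1 kl by auto
      have e2: "(l', l) \<in> matched (clw L al)" using l' matchedD(1)[of l l'] b2 kl by auto
      have "\<not> (l' < k \<and> k < l \<and> l < k')"
        by (rule cup_noncrossing[OF c]) (use e1 e2 in simp_all)
      then show False using b1 b2 kl lt by auto
    qed
  qed
qed

text \<open>Undoing a step interchanges an \<open>Up\<close> with a \<open>Dn\<close> to its right.
  The added \<open>Dn\<close> are leftmost and the added \<open>Up\<close> are rightmost, so both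
  vertices are in the middle and the step lifts to the block.\<close>

lemma clw_lower:
  assumes nu: "\<nu> \<in> L" and le: "bruhat_le \<kappa> (clw L \<nu>)"
  shows "\<exists>\<mu>\<in>L. \<kappa> = clw L \<mu> \<and> bruhat_le \<mu> \<nu>"
  using le unfolding bruhat_le_def
proof (induction rule: converse_rtranclp_induct)
  case base
  then show ?case using nu by blast
next
  case (step \<kappa> \<kappa>')
  then obtain \<mu> where m: "\<mu> \<in> L" "\<kappa>' = clw L \<mu>" "bruhat_step\<^sup>*\<^sup>* \<mu> \<nu>" by blast
  obtain i j where ij: "i < j" "\<kappa> i = Dn" "\<kappa> j = Up" "\<kappa>' = \<kappa>(i := Up, j := Dn)"
    using step(1) unfolding bruhat_step_def by blast
  have "clw L \<mu> i = Up" "clw L \<mu> j = Dn" using ij m(2) by (metis fun_upd_apply less_irrefl)+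
  then have mid: "i \<in> mid" "j \<in> mid" using ij(1) pqn by (auto simp: clw_eq split: if_splits)
  have lab: "\<mu> (pos i) = Up" "\<mu> (pos j) = Dn"
    using \<open>clw L \<mu> i = Up\<close> \<open>clw L \<mu> j = Dn\<close> mid by (simp_all add: clw_eq)
  define \<mu>' where "\<mu>' = \<mu>(pos i := \<mu> (pos j), pos j := \<mu> (pos i))"
  have m': "\<mu>' \<in> L" unfolding \<mu>'_def using m(1) pos_S mid by (intro swap_L) auto
  have ne: "pos i < pos j" using pos_less_iff[OF mid] ij(1) by simp
  have "\<kappa> = clw L \<mu>'"
  proof
    fix k
    have "\<kappa> k = (if k = i then Dn else if k = j then Up else \<kappa>' k)" using ij by auto
    moreover have "clw L \<mu>' k = (if k = i then Dn else if k = j then Up else clw L \<mu> k)"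
    proof (cases "k \<in> mid")
      case True
      then show ?thesis using pos_eq_iff[OF True mid(1)] pos_eq_iff[OF True mid(2)] lab ne ij(1)
        unfolding \<mu>'_def by (simp add: clw_eq)
    next
      case False
      then have "k \<noteq> i" "k \<noteq> j" using mid by auto
      then show ?thesis using False by (auto simp: clw_eq)
    qed
    ultimately show "\<kappa> k = clw L \<mu>' k" using m(2) by simp
  qed
  moreover have "bruhat_step \<mu>' \<mu>"
    unfolding bruhat_step_def
    by (intro exI[of _ "pos i"] exI[of _ "pos j"]) (use ne lab in \<open>auto simp: \<mu>'_def fun_eq_iff\<close>)
  then have "bruhat_step\<^sup>*\<^sup>* \<mu>' \<nu>" using m(3) by (rule converse_rtranclp_into_rtranclp)
  ultimately show ?case using m' by blast
qed

lemma closed_block_finite: "closed_block L N"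
proof
  fix al assume al: "al \<in> L"
  show "closed_cupd N (underline (clw L al))" unfolding underline_clw[OF al] by (rule closed_clw[OF al])
  show "clw L al \<in> Or N (underline (clw L al))"
    unfolding underline_clw[OF al] Or_arcs[OF al al] by (auto dest: matchedD(2,3))
  show "clw L al i = Dn" if "(i, j) \<in> cups (underline (clw L al))" for i j
    using that unfolding underline_clw[OF al] by (auto dest: matchedD(2))
next
  show "inj_on (clw L) L" by (rule clw_inj)
next
  fix al la assume l: "al \<in> L" "la \<in> L"
  show "subw al la \<longleftrightarrow> clw L la \<in> Or N (underline (clw L al))"
    unfolding subw_def underline_clw[OF l(1)] underline_L[OF l(1)] using L_block[OF l] oriented_clw[OF l] by simp
next
  show "\<nu> \<in> L \<Longrightarrow> bruhat_le \<kappa> (clw L \<nu>) \<Longrightarrow> \<exists>\<mu>\<in>L. \<kappa> = clw L \<mu> \<and> bruhat_le \<mu> \<nu>" for \<kappa> \<nu>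
    by (rule clw_lower)
qed

end

lemma closed_block_exists:
  assumes "is_block L" "finite L"
  obtains N where "closed_block L N"
proof -
  obtain la0 where l: "is_weight la0" "L = {mu. is_weight mu \<and> same_block la0 mu}"
    using assms(1) unfolding is_block_def by blast
  interpret finite_block L la0 by unfold_locales (use l assms in auto)
  show thesis
  proof (cases "finite S")
    case True
    then interpret finite_vertices L la0 by unfold_locales
    show thesis by (rule that[OF closed_block_finite])
  next
    case False
    then show thesis by (intro that[OF closed_block_infinite])
  qed
qed

section \<open>Cellularity\<close>

lemma sum_swap3: "(\<Sum>z\<in>A. \<Sum>x\<in>B. \<Sum>y\<in>C. F z x y) = (\<Sum>x\<in>B. \<Sum>y\<in>C. \<Sum>z\<in>A. F z x y)"
proof -
  have "(\<Sum>z\<in>A. \<Sum>x\<in>B. \<Sum>y\<in>C. F z x y) = (\<Sum>x\<in>B. \<Sum>z\<in>A. \<Sum>y\<in>C. F z x y)" by (rule sum.swap)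
  also have "\<dots> = (\<Sum>x\<in>B. \<Sum>y\<in>C. \<Sum>z\<in>A. F z x y)" by (intro sum.cong refl sum.swap)
  finally show ?thesis .
qed

lemma structure_constants_assoc:
  fixes c :: "'b \<Rightarrow> 'b \<Rightarrow> 'b \<Rightarrow> 'k::comm_ring_1"
  assumes "\<And>x y z. x \<in> H \<Longrightarrow> y \<in> H \<Longrightarrow> z \<in> H \<Longrightarrow> (\<Sum>w\<in>H. c x y w * c w z u) = (\<Sum>w\<in>H. c y z w * c x w u)"
  shows "(\<Sum>w\<in>H. \<Sum>z\<in>H. (\<Sum>x\<in>H. \<Sum>y\<in>H. f x * g y * c x y w) * h z * c w z u)
    = (\<Sum>x\<in>H. \<Sum>w\<in>H. f x * (\<Sum>y\<in>H. \<Sum>z\<in>H. g y * h z * c y z w) * c x w u)"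
proof -
  have "(\<Sum>w\<in>H. \<Sum>z\<in>H. (\<Sum>x\<in>H. \<Sum>y\<in>H. f x * g y * c x y w) * h z * c w z u)
    = (\<Sum>w\<in>H. \<Sum>z\<in>H. \<Sum>x\<in>H. \<Sum>y\<in>H. f x * g y * h z * (c x y w * c w z u))"
    by (simp add: sum_distrib_left sum_distrib_right mult_ac)
  also have "\<dots> = (\<Sum>w\<in>H. \<Sum>x\<in>H. \<Sum>y\<in>H. \<Sum>z\<in>H. f x * g y * h z * (c x y w * c w z u))"
    by (intro sum.cong refl sum_swap3)
  also have "\<dots> = (\<Sum>x\<in>H. \<Sum>y\<in>H. \<Sum>w\<in>H. \<Sum>z\<in>H. f x * g y * h z * (c x y w * c w z u))"
    by (rule sum_swap3)
  also have "\<dots> = (\<Sum>x\<in>H. \<Sum>y\<in>H. \<Sum>z\<in>H. \<Sum>w\<in>H. f x * g y * h z * (c x y w * c w z u))"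
    by (intro sum.cong refl sum.swap)
  also have "\<dots> = (\<Sum>x\<in>H. \<Sum>y\<in>H. \<Sum>z\<in>H. \<Sum>w\<in>H. f x * g y * h z * (c y z w * c x w u))"
    unfolding sum_distrib_left[symmetric] using assms by (intro sum.cong refl) simp
  also have "\<dots> = (\<Sum>x\<in>H. \<Sum>w\<in>H. \<Sum>y\<in>H. \<Sum>z\<in>H. f x * g y * h z * (c y z w * c x w u))"
    by (intro sum.cong refl sum_swap3[symmetric])
  also have "\<dots> = (\<Sum>x\<in>H. \<Sum>w\<in>H. f x * (\<Sum>y\<in>H. \<Sum>z\<in>H. g y * h z * c y z w) * c x w u)"
    by (simp add: sum_distrib_left sum_distrib_right mult_ac)
  finally show ?thesis .
qed

section \<open>Structure constants of the generalised Khovanov algebra\<close>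

definition rev3 :: "weight \<times> weight \<times> weight \<Rightarrow> weight \<times> weight \<times> weight" where
  "rev3 z = (case z of (al, la, be) \<Rightarrow> (be, la, al))"

lemma rev3_simps [simp]: "rev3 (al, la, be) = (be, la, al)" "rev3 (rev3 z) = z"
  unfolding rev3_def by (simp_all add: case_prod_beta)

lemma hstar_eq: "hstar f z = f (rev3 z)"
  unfolding hstar_def rev3_def by (simp add: case_prod_beta)

lemma rev3_HB [simp]: "rev3 z \<in> HB L \<longleftrightarrow> z \<in> HB L"
  unfolding HB_def rev3_def by (auto simp: case_prod_beta)

locale finite_closed_block = closed_block +
  assumes finL: "finite L"
begin

abbreviation "cl \<equiv> clw L"
abbreviation "ud al \<equiv> underline (clw L al)"

lemma circB_L: "al \<in> circB L \<Longrightarrow> al \<in> L"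
  unfolding circB_def by simp

lemma finite_HB: "finite (HB L)"
proof -
  have "HB L \<subseteq> L \<times> L \<times> L" unfolding HB_def using circB_L by auto
  then show ?thesis by (rule finite_subset) (use finL in simp)
qed

lemma HB_Ors: "(al, la, be) \<in> HB L \<Longrightarrow> cl la \<in> Ors N (ud al) (ud be)"
  unfolding HB_def Ors_def using subw_iff circB_L by auto

lemma HB_L: "(al, la, be) \<in> HB L \<Longrightarrow> al \<in> circB L \<and> al \<in> L \<and> la \<in> L \<and> be \<in> circB L \<and> be \<in> L"
  unfolding HB_def using circB_L by auto

text \<open>The weight is recovered from its diagram: left ends of cups carry \<open>Dn\<close> and
  right ends carry \<open>Up\<close>.\<close>

lemma ud_inj: "al \<in> L \<Longrightarrow> be \<in> L \<Longrightarrow> ud al = ud be \<Longrightarrow> al = be"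
proof -
  assume l: "al \<in> L" "be \<in> L" and e: "ud al = ud be"
  note c = closed[OF l(1)]
  have o: "cl al \<in> Or N (ud al)" "cl be \<in> Or N (ud al)" using self[OF l(1)] self[OF l(2)] e by auto
  have "cl al k = cl be k" for k
  proof (cases "k \<in> verts N")
    case True
    have up: "cl x k = (if (k, mate (ud al) k) \<in> cups (ud al) then Dn else Up)"
      if x: "x \<in> L" "ud x = ud al" "cl x \<in> Or N (ud al)" for x
    proof (cases "(k, mate (ud al) k) \<in> cups (ud al)")
      case True
      then show ?thesis using anticlockwise[OF x(1)] x(2) by simp
    next
      case False
      then have "(mate (ud al) k, k) \<in> cups (ud al)" using mate_cups[OF c True] by simp
      then have "cl x (mate (ud al) k) = Dn" using anticlockwise[OF x(1)] x(2) by simp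
      moreover have "cl x (mate (ud al) k) = Up \<longleftrightarrow> \<not> cl x k = Up"
        using bspec[OF OrD(3)[OF c x(3), unfolded flips_def] True] .
      ultimately have "cl x k = Up" by simp
      then show ?thesis using False by simp
    qed
    show ?thesis using up[OF l(1) refl o(1)] up[OF l(2) e[symmetric] o(2)] by simp
  next
    case False
    then show ?thesis using OrD(1)[OF c o(1)] OrD(1)[OF c o(2)] by simp
  qed
  then have "cl al = cl be" by auto
  then show "al = be" using clw_inj l unfolding inj_on_def by blast
qed

lemma hcoeff_eq:
  assumes "x3 \<in> L" "y1 \<in> L" "x1 \<in> L" "z1 \<in> L" "y3 \<in> L" "z3 \<in> L"
  shows "hcoeff L (x1, x2, x3) (y1, y2, y3) (z1, z2, z3) =
    (if x3 = y1 \<and> z1 = x1 \<and> z3 = y3 then struct_const (ud x1) (ud x3) (ud y3) (cl x2) (cl y2) (cl z2) else 0)"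
proof (cases "x3 = y1")
  case False
  then have "ud x3 \<noteq> ud y1" using ud_inj assms by auto
  then show ?thesis using False
    unfolding hcoeff_def cl_diag_def hprod_def overline_def cup_star_def cap_star_def by simp
next
  case True
  show ?thesis
  proof (cases "z1 = x1 \<and> z3 = y3")
    case True
    then show ?thesis using \<open>x3 = y1\<close>
      unfolding hcoeff_def struct_const_def diag_coeff_def cl_diag_def overline_def cup_star_def by simp
  next
    case False
    then have "ud z1 \<noteq> ud x1 \<or> ud z3 \<noteq> ud y3" using ud_inj assms by auto
    then have "sum_list (map (\<lambda>(k, D). if D = (ud z1, cl z2, Cap (ud z3)) then k else 0)
        (map (\<lambda>(k, s). (k, (ud x1, nu (ud x1) (ud y1) (ud y3) (cl x2) s, Cap (ud y3)))) Ls)) = 0" for Ls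
      by (induction Ls) auto
    then have "hcoeff L (x1, x2, x3) (y1, y2, y3) (z1, z2, z3) = 0"
      using \<open>x3 = y1\<close> unfolding hcoeff_def cl_diag_def hprod_def overline_def cup_star_def cap_star_def by simp
    then show ?thesis using False by auto
  qed
qed

lemma hcoeff_HB:
  assumes "(x1, x2, x3) \<in> HB L" "(y1, y2, y3) \<in> HB L" "(z1, z2, z3) \<in> HB L"
  shows "hcoeff L (x1, x2, x3) (y1, y2, y3) (z1, z2, z3) =
    (if x3 = y1 \<and> z1 = x1 \<and> z3 = y3 then struct_const (ud x1) (ud x3) (ud y3) (cl x2) (cl y2) (cl z2) else 0)"
  using HB_L[OF assms(1)] HB_L[OF assms(2)] HB_L[OF assms(3)] by (intro hcoeff_eq) simp_all

lemma bruhat_clw: "la \<in> L \<Longrightarrow> \<mu> \<in> L \<Longrightarrow> bruhat_le (cl la) (cl \<mu>) \<Longrightarrow> bruhat_le la \<mu>"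
  using lower[of \<mu> "cl la"] clw_inj unfolding inj_on_def by blast

text \<open>Weights outside the closure are not below any weight of the closure (\<open>lower\<close>), so they do not
  contribute: \<open>I\<^sub>\<Lambda>\<close> is an ideal.\<close>

lemma sum_HB:
  fixes F :: "weight \<Rightarrow> int"
  assumes "al \<in> circB L" "be \<in> circB L" "u \<in> L"
    and G: "\<And>w2. (al, w2, be) \<in> HB L \<Longrightarrow> G (al, w2, be) = F (cl w2)"
    and G0: "\<And>w1 w2 w3. (w1, w2, w3) \<in> HB L \<Longrightarrow> w1 \<noteq> al \<or> w3 \<noteq> be \<Longrightarrow> G (w1, w2, w3) = 0"
    and F: "\<And>\<omega>. \<omega> \<in> Ors N (ud al) (ud be) \<Longrightarrow> F \<omega> \<noteq> 0 \<Longrightarrow> bruhat_le \<omega> (cl u)"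
  shows "(\<Sum>w\<in>HB L. G w) = (\<Sum>\<omega>\<in>Ors N (ud al) (ud be). F \<omega>)"
proof -
  interpret two_cupd N "ud al" "ud be" by unfold_locales (use assms circB_L closed in auto)
  define T where "T = {w2 \<in> L. subw al w2 \<and> subw be w2}"
  have TH: "w2 \<in> T \<longleftrightarrow> (al, w2, be) \<in> HB L" for w2 unfolding T_def HB_def using assms by auto
  have "(\<Sum>w\<in>HB L. G w) = (\<Sum>w\<in>(\<lambda>w2. (al, w2, be)) ` T. G w)"
  proof (rule sum.mono_neutral_right[OF finite_HB])
    show "(\<lambda>w2. (al, w2, be)) ` T \<subseteq> HB L" using TH by auto
    show "\<forall>w\<in>HB L - (\<lambda>w2. (al, w2, be)) ` T. G w = 0"
    proof
      fix w assume w: "w \<in> HB L - (\<lambda>w2. (al, w2, be)) ` T"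
      obtain w1 w2 w3 where e: "w = (w1, w2, w3)" by (metis prod_cases3)
      have "w1 \<noteq> al \<or> w3 \<noteq> be" using w TH[of w2] unfolding e by auto
      then show "G w = 0" using G0 w unfolding e by blast
    qed
  qed
  also have "\<dots> = (\<Sum>w2\<in>T. G (al, w2, be))" by (subst sum.reindex) (auto simp: inj_on_def)
  also have "\<dots> = (\<Sum>w2\<in>T. F (cl w2))" using G TH by (intro sum.cong) auto
  also have "\<dots> = (\<Sum>\<omega>\<in>cl ` T. F \<omega>)"
    by (subst sum.reindex) (use inj_on_subset[OF clw_inj, of T] in \<open>auto simp: T_def\<close>)
  also have "\<dots> = (\<Sum>\<omega>\<in>Ors N (ud al) (ud be). F \<omega>)"
  proof (rule sum.mono_neutral_left)
    show "cl ` T \<subseteq> Ors N (ud al) (ud be)" using HB_Ors TH by auto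
    show "\<forall>\<omega>\<in>Ors N (ud al) (ud be) - cl ` T. F \<omega> = 0"
    proof (rule ballI, rule ccontr)
      fix \<omega> assume o: "\<omega> \<in> Ors N (ud al) (ud be) - cl ` T" and nz: "F \<omega> \<noteq> 0"
      then obtain w2 where w: "w2 \<in> L" "\<omega> = cl w2" using lower[OF assms(3)] F by blast
      then have "w2 \<in> T" using o subw_iff circB_L assms(1,2) unfolding T_def Ors_def by auto
      then show False using o w by auto
    qed
  qed simp
  finally show ?thesis .
qed

text \<open>By \<open>sum_HB\<close> the sums over basis vectors become sums over all orientations
  of closed diagrams, where \<open>struct_const_assoc\<close> applies.\<close>

lemma hcoeff_assoc:
  assumes x: "x \<in> HB L" and y: "y \<in> HB L" and z: "z \<in> HB L" and u: "u \<in> HB L"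
  shows "(\<Sum>w\<in>HB L. hcoeff L x y w * hcoeff L w z u) = (\<Sum>w\<in>HB L. hcoeff L y z w * hcoeff L x w u)"
proof -
  obtain x1 x2 x3 where xe: "x = (x1, x2, x3)" by (metis prod_cases3)
  obtain y1 y2 y3 where ye: "y = (y1, y2, y3)" by (metis prod_cases3)
  obtain z1 z2 z3 where ze: "z = (z1, z2, z3)" by (metis prod_cases3)
  obtain u1 u2 u3 where ue: "u = (u1, u2, u3)" by (metis prod_cases3)
  note H = x[unfolded xe] y[unfolded ye] z[unfolded ze] u[unfolded ue]
  note HL = HB_L[OF H(1)] HB_L[OF H(2)] HB_L[OF H(3)] HB_L[OF H(4)]
  have c1: "hcoeff L x y (w1, w2, w3) = (if x3 = y1 \<and> w1 = x1 \<and> w3 = y3 then struct_const (ud x1) (ud x3) (ud y3) (cl x2) (cl y2) (cl w2) else 0)"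
    "hcoeff L (w1, w2, w3) z u = (if w3 = z1 \<and> u1 = w1 \<and> u3 = z3 then struct_const (ud w1) (ud w3) (ud z3) (cl w2) (cl z2) (cl u2) else 0)"
    "hcoeff L y z (w1, w2, w3) = (if y3 = z1 \<and> w1 = y1 \<and> w3 = z3 then struct_const (ud y1) (ud y3) (ud z3) (cl y2) (cl z2) (cl w2) else 0)"
    "hcoeff L x (w1, w2, w3) u = (if x3 = w1 \<and> u1 = x1 \<and> u3 = w3 then struct_const (ud x1) (ud x3) (ud w3) (cl x2) (cl w2) (cl u2) else 0)"
    if "(w1, w2, w3) \<in> HB L" for w1 w2 w3
    unfolding xe ye ze ue using hcoeff_HB H that by blast+
  show ?thesis
  proof (cases "x3 = y1 \<and> y3 = z1 \<and> u1 = x1 \<and> u3 = z3")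
    case False
    have "hcoeff L x y w * hcoeff L w z u = 0" "hcoeff L y z w * hcoeff L x w u = 0" if "w \<in> HB L" for w
      using that c1[of "fst w" "fst (snd w)" "snd (snd w)"] False by auto
    then show ?thesis by (simp only: sum.neutral_const cong: sum.cong)
  next
    case True
    have L4: "x1 \<in> L" "y1 \<in> L" "y3 \<in> L" "z3 \<in> L" using HL by auto
    have C: "closed_cupd N (ud x1)" "closed_cupd N (ud y1)" "closed_cupd N (ud y3)" "closed_cupd N (ud z3)"
      using L4 closed by auto
    have O: "cl x2 \<in> Ors N (ud x1) (ud y1)" "cl y2 \<in> Ors N (ud y1) (ud y3)" "cl z2 \<in> Ors N (ud y3) (ud z3)" "cl u2 \<in> Ors N (ud x1) (ud z3)"
      using HB_Ors[OF H(1)] HB_Ors[OF H(2)] HB_Ors[OF H(3)] HB_Ors[OF H(4)] True by auto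
    have "(\<Sum>w\<in>HB L. hcoeff L x y w * hcoeff L w z u)
      = (\<Sum>\<omega>\<in>Ors N (ud x1) (ud y3). struct_const (ud x1) (ud y1) (ud y3) (cl x2) (cl y2) \<omega> * struct_const (ud x1) (ud y3) (ud z3) \<omega> (cl z2) (cl u2))"
    proof (rule sum_HB)
      show "x1 \<in> circB L" "y3 \<in> circB L" "u2 \<in> L" using HL by auto
      show "bruhat_le \<omega> (cl u2)" if o: "\<omega> \<in> Ors N (ud x1) (ud y3)"
        "struct_const (ud x1) (ud y1) (ud y3) (cl x2) (cl y2) \<omega> * struct_const (ud x1) (ud y3) (ud z3) \<omega> (cl z2) (cl u2) \<noteq> 0" for \<omega>
        by (rule struct_const_bruhat(1)[OF C(1,3,4) o(1) O(3,4)]) (use o(2) in auto)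
    qed (use c1 True in auto)
    also have "\<dots> = (\<Sum>\<omega>\<in>Ors N (ud y1) (ud z3). struct_const (ud y1) (ud y3) (ud z3) (cl y2) (cl z2) \<omega> * struct_const (ud x1) (ud y1) (ud z3) (cl x2) \<omega> (cl u2))"
      by (rule struct_const_assoc[OF C O])
    also have "\<dots> = (\<Sum>w\<in>HB L. hcoeff L y z w * hcoeff L x w u)"
    proof (rule sum_HB[symmetric])
      show "y1 \<in> circB L" "z3 \<in> circB L" "u2 \<in> L" using HL by auto
      show "bruhat_le \<omega> (cl u2)" if o: "\<omega> \<in> Ors N (ud y1) (ud z3)"
        "struct_const (ud y1) (ud y3) (ud z3) (cl y2) (cl z2) \<omega> * struct_const (ud x1) (ud y1) (ud z3) (cl x2) \<omega> (cl u2) \<noteq> 0" for \<omega>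
        by (rule struct_const_bruhat(2)[OF C(1,2,4) O(1) o(1) O(4)]) (use o(2) in auto)
    qed (use c1 True in auto)
    finally show ?thesis .
  qed
qed

lemma hcoeff_star:
  assumes "x \<in> HB L" "y \<in> HB L" "z \<in> HB L"
  shows "hcoeff L (rev3 y) (rev3 x) (rev3 z) = hcoeff L x y z"
proof -
  obtain x1 x2 x3 where xe: "x = (x1, x2, x3)" by (metis prod_cases3)
  obtain y1 y2 y3 where ye: "y = (y1, y2, y3)" by (metis prod_cases3)
  obtain z1 z2 z3 where ze: "z = (z1, z2, z3)" by (metis prod_cases3)
  note H = assms[unfolded xe ye ze]
  have H': "(x3, x2, x1) \<in> HB L" "(y3, y2, y1) \<in> HB L" "(z3, z2, z1) \<in> HB L"
    using H rev3_HB[of "(x1, x2, x3)" L] rev3_HB[of "(y1, y2, y3)" L] rev3_HB[of "(z1, z2, z3)" L] by simp_all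
  show ?thesis
  proof (cases "x3 = y1 \<and> z1 = x1 \<and> z3 = y3")
    case True
    have "closed_cupd N (ud x1)" "closed_cupd N (ud x3)" "closed_cupd N (ud y3)"
      using closed HB_L[OF H(1)] HB_L[OF H(2)] by auto
    then have "struct_const (ud x1) (ud x3) (ud y3) (cl x2) (cl y2) (cl z2) = struct_const (ud y3) (ud x3) (ud x1) (cl y2) (cl x2) (cl z2)"
      by (rule struct_const_star) (use HB_Ors[OF H(1)] HB_Ors[OF H(2)] HB_Ors[OF H(3)] True in auto)
    then show ?thesis unfolding xe ye ze using hcoeff_HB[OF H] hcoeff_HB[OF H'(2,1,3)] True by simp
  next
    case False
    then show ?thesis unfolding xe ye ze using hcoeff_HB[OF H] hcoeff_HB[OF H'(2,1,3)] by auto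
  qed
qed

lemma self_HB: "al \<in> circB L \<Longrightarrow> (al, al, al) \<in> HB L"
  unfolding HB_def using circB_L subw_iff self by auto

lemma hcoeff_unit:
  assumes "al \<in> circB L" "y \<in> HB L" "z \<in> HB L"
  shows "hcoeff L (al, al, al) y z = (if y = z \<and> fst z = al then 1 else 0)"
proof -
  obtain y1 y2 y3 where ye: "y = (y1, y2, y3)" by (metis prod_cases3)
  obtain z1 z2 z3 where ze: "z = (z1, z2, z3)" by (metis prod_cases3)
  note H = assms(2,3)[unfolded ye ze]
  show ?thesis
  proof (cases "al = y1 \<and> z1 = al \<and> z3 = y3")
    case True
    have "struct_const (ud al) (ud al) (ud y3) (cl al) (cl y2) (cl z2) = (if cl z2 = cl y2 then 1 else 0)"
      using closed self anticlockwise HB_L[OF H(1)] HB_Ors[OF H(1)] HB_Ors[OF H(2)] True circB_L[OF assms(1)]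
      by (intro struct_const_unit[of N]) auto
    moreover have "cl z2 = cl y2 \<longleftrightarrow> z2 = y2" using clw_inj HB_L[OF H(1)] HB_L[OF H(2)] unfolding inj_on_def by blast
    ultimately show ?thesis unfolding ye ze using hcoeff_HB[OF self_HB[OF assms(1)] H] True by auto
  next
    case False
    then show ?thesis unfolding ye ze using hcoeff_HB[OF self_HB[OF assms(1)] H] by auto
  qed
qed

lemma hcoeff_bruhat:
  assumes "x \<in> HB L" "(g, \<mu>, dl) \<in> HB L" "(al, \<nu>, be) \<in> HB L" "hcoeff L x (g, \<mu>, dl) (al, \<nu>, be) \<noteq> 0"
  shows "be = dl" "bruhat_le \<mu> \<nu>"
proof -
  obtain x1 x2 x3 where xe: "x = (x1, x2, x3)" by (metis prod_cases3)
  note H = assms(1-3)[unfolded xe]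
  have e: "x3 = g \<and> al = x1 \<and> be = dl" "struct_const (ud x1) (ud x3) (ud dl) (cl x2) (cl \<mu>) (cl \<nu>) \<noteq> 0"
    using assms(4) hcoeff_HB[OF H] unfolding xe by (auto split: if_splits)
  then show "be = dl" by simp
  have "closed_cupd N (ud x1)" "closed_cupd N (ud x3)" "closed_cupd N (ud dl)"
    using closed HB_L[OF H(1)] HB_L[OF H(2)] by auto
  then have "bruhat_le (cl \<mu>) (cl \<nu>)"
    by (rule struct_const_bruhat(2)[where la = "cl x2"]) (use HB_Ors[OF H(1)] HB_Ors[OF H(2)] HB_Ors[OF H(3)] e in auto)
  then show "bruhat_le \<mu> \<nu>" using bruhat_clw HB_L[OF H(2)] HB_L[OF H(3)] by blast
qed

text \<open>Comparing every dl with the single choice g yields coefficients of the cell rule that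
  are independent of dl.\<close>

lemma hcoeff_cell:
  assumes x: "x \<in> HB L" and m: "\<mu> \<in> L" "g \<in> Mset L \<mu>" "dl \<in> Mset L \<mu>" "al \<in> Mset L \<mu>"
  shows "hcoeff L x (g, \<mu>, dl) (al, \<mu>, dl) = hcoeff L x (g, \<mu>, g) (al, \<mu>, g)"
proof -
  obtain x1 x2 x3 where xe: "x = (x1, x2, x3)" by (metis prod_cases3)
  note X = x[unfolded xe]
  have H: "(p, \<mu>, q) \<in> HB L" if "p \<in> Mset L \<mu>" "q \<in> Mset L \<mu>" for p q
    using that m(1) unfolding HB_def Mset_def by auto
  show ?thesis
  proof (cases "x3 = g \<and> al = x1")
    case True
    have O: "cl \<mu> \<in> Or N (ud p)" "p \<in> L" if "p \<in> Mset L \<mu>" for p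
      using HB_Ors[OF H[OF that that]] HB_L[OF H[OF that that]] unfolding Ors_def by auto
    have "struct_const (ud al) (ud g) (ud dl) (cl x2) (cl \<mu>) (cl \<mu>) = struct_const (ud al) (ud g) (ud g) (cl x2) (cl \<mu>) (cl \<mu>)"
      by (rule struct_const_cell[of N]) (use closed O m HB_Ors[OF X] True in auto)
    then show ?thesis unfolding xe using True hcoeff_HB[OF X H[OF m(2,3)] H[OF m(4,3)]] hcoeff_HB[OF X H[OF m(2,2)] H[OF m(4,2)]] by simp
  next
    case False
    then show ?thesis unfolding xe using hcoeff_HB[OF X H[OF m(2,3)] H[OF m(4,3)]] hcoeff_HB[OF X H[OF m(2,2)] H[OF m(4,2)]] by auto
  qed
qed

end

definition delta :: "weight \<times> weight \<times> weight \<Rightarrow> weight \<times> weight \<times> weight \<Rightarrow> 'k::comm_ring_1" where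
  "delta z = (case z of (al, la, be) \<Rightarrow> Cbasis la al be)"

lemma delta_apply: "delta z i = (if i = z then 1 else 0)"
  unfolding delta_def Cbasis_def by (simp add: case_prod_beta)

lemma inj_delta: "inj_on (delta :: _ \<Rightarrow> _ \<Rightarrow> 'k::comm_ring_1) A"
proof (rule inj_onI)
  fix z w assume "(delta z :: _ \<Rightarrow> 'k) = delta w"
  then have "(delta z z :: 'k) = delta w z" by simp
  then show "z = w" unfolding delta_apply by (simp split: if_splits)
qed

lemma lspan_delta:
  fixes f :: "weight \<times> weight \<times> weight \<Rightarrow> 'k::comm_ring_1"
  assumes "finite T" "\<And>z. z \<notin> T \<Longrightarrow> f z = 0" "delta ` T \<subseteq> Q"
  shows "f \<in> lspan Q"
proof -
  \<comment> \<open>\<open>lspan\<close> indexes coefficients by the vectors themselves, so the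
    index has to be recovered from the vector.\<close>
  let ?c = "\<lambda>w. f (inv_into T delta w)"
  have f: "f = (\<lambda>i. \<Sum>w\<in>delta ` T. ?c w * w i)"
  proof
    fix i
    have "(\<Sum>w\<in>delta ` T. ?c w * w i) = (\<Sum>z\<in>T. f z * delta z i)"
      by (subst sum.reindex[OF inj_delta]) (simp add: inv_into_f_f[OF inj_delta])
    also have "\<dots> = f i" using assms(1,2) by (simp add: delta_apply if_distrib[of "\<lambda>x. _ * x"] sum.delta' cong: if_cong)
    finally show "f i = (\<Sum>w\<in>delta ` T. ?c w * w i)" by simp
  qed
  show ?thesis unfolding lspan_def
    by (intro CollectI exI[of _ "delta ` T"] exI[of _ ?c] conjI) (rule finite_imageI[OF assms(1)], rule assms(3), rule f)
qed

section \<open>The algebra and its cell datum\<close>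

context finite_closed_block
begin

lemma hmult_Hspace: "hmult L f g \<in> Hspace L"
  unfolding Hspace_def hmult_def by simp

lemma hmult_assoc:
  fixes f g h :: "weight \<times> weight \<times> weight \<Rightarrow> 'k::comm_ring_1"
  shows "hmult L (hmult L f g) h = hmult L f (hmult L g h)"
proof
  fix u
  let ?c = "\<lambda>x y z. of_int (hcoeff L x y z) :: 'k"
  show "hmult L (hmult L f g) h u = hmult L f (hmult L g h) u"
  proof (cases "u \<in> HB L")
    case u: True
    have "hmult L (hmult L f g) h u
      = (\<Sum>w\<in>HB L. \<Sum>z\<in>HB L. (\<Sum>x\<in>HB L. \<Sum>y\<in>HB L. f x * g y * ?c x y w) * h z * ?c w z u)"
      using u by (simp add: hmult_def)
    also have "\<dots> = (\<Sum>x\<in>HB L. \<Sum>w\<in>HB L. f x * (\<Sum>y\<in>HB L. \<Sum>z\<in>HB L. g y * h z * ?c y z w) * ?c x w u)"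
    proof (rule structure_constants_assoc)
      fix x y z assume xyz: "x \<in> HB L" "y \<in> HB L" "z \<in> HB L"
      have "(\<Sum>w\<in>HB L. ?c x y w * ?c w z u) = of_int (\<Sum>w\<in>HB L. hcoeff L x y w * hcoeff L w z u)" by simp
      also have "\<dots> = of_int (\<Sum>w\<in>HB L. hcoeff L y z w * hcoeff L x w u)" using hcoeff_assoc[OF xyz u] by simp
      finally show "(\<Sum>w\<in>HB L. ?c x y w * ?c w z u) = (\<Sum>w\<in>HB L. ?c y z w * ?c x w u)" by simp
    qed
    also have "\<dots> = hmult L f (hmult L g h) u" using u by (simp add: hmult_def)
    finally show ?thesis .
  qed (simp add: hmult_def)
qed

lemma Hspace_iff: "f \<in> Hspace L \<longleftrightarrow> (\<forall>z. z \<notin> HB L \<longrightarrow> f z = 0)"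
  unfolding Hspace_def by simp

lemma hstar_Hspace: "f \<in> Hspace L \<Longrightarrow> hstar f \<in> Hspace L"
  unfolding Hspace_iff hstar_eq using rev3_HB by metis

lemma hstar_hstar [simp]: "hstar (hstar f) = f"
  by (rule ext) (simp add: hstar_eq)

lemma hstar_hmult:
  fixes f g :: "weight \<times> weight \<times> weight \<Rightarrow> 'k::comm_ring_1"
  shows "hstar (hmult L f g) = hmult L (hstar g) (hstar f)"
proof
  fix z
  show "hstar (hmult L f g) z = hmult L (hstar g) (hstar f) z"
  proof (cases "z \<in> HB L")
    case z: True
    have re: "(\<Sum>x\<in>HB L. F (rev3 x)) = (\<Sum>x\<in>HB L. F x)" for F :: "_ \<Rightarrow> 'k"
      by (rule sum.reindex_bij_witness[of _ rev3 rev3]) auto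
    have "hmult L (hstar g) (hstar f) z
      = (\<Sum>x\<in>HB L. \<Sum>y\<in>HB L. g (rev3 x) * f (rev3 y) * of_int (hcoeff L x y z))"
      using z by (simp add: hmult_def hstar_eq)
    also have "\<dots> = (\<Sum>x\<in>HB L. \<Sum>y\<in>HB L. g (rev3 x) * f (rev3 y) * of_int (hcoeff L (rev3 y) (rev3 x) (rev3 z)))"
      using z by (intro sum.cong refl) (simp add: hcoeff_star)
    also have "\<dots> = (\<Sum>x\<in>HB L. \<Sum>y\<in>HB L. g x * f y * of_int (hcoeff L y x (rev3 z)))"
      unfolding re[of "\<lambda>y. g _ * f y * of_int (hcoeff L y _ (rev3 z))"]
      by (rule re[of "\<lambda>x. \<Sum>y\<in>HB L. g x * f y * of_int (hcoeff L y x (rev3 z))"])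
    also have "\<dots> = (\<Sum>y\<in>HB L. \<Sum>x\<in>HB L. f y * g x * of_int (hcoeff L y x (rev3 z)))"
      by (subst sum.swap) (simp add: mult.commute)
    also have "\<dots> = hstar (hmult L f g) z" using z by (simp add: hmult_def hstar_eq)
    finally show ?thesis by simp
  qed (simp add: hmult_def hstar_eq)
qed

definition unit :: "weight \<times> weight \<times> weight \<Rightarrow> 'k::comm_ring_1" where
  "unit z = (if \<exists>al\<in>circB L. z = (al, al, al) then 1 else 0)"

lemma unit_Hspace: "unit \<in> Hspace L"
  unfolding Hspace_def unit_def using self_HB by auto

lemma hstar_unit: "hstar unit = unit"
  by (rule ext) (auto simp: hstar_eq unit_def rev3_def)

lemma hmult_unit_left:
  assumes g: "g \<in> Hspace L"
  shows "hmult L unit g = (g :: weight \<times> weight \<times> weight \<Rightarrow> 'k::comm_ring_1)"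
proof
  fix z
  show "hmult L unit g z = g z"
  proof (cases "z \<in> HB L")
    case z: True
    have c: "fst z \<in> circB L" using z unfolding HB_def by auto
    let ?e = "(fst z, fst z, fst z)"
    have in0: "(\<Sum>y\<in>HB L. unit x * g y * of_int (hcoeff L x y z)) = (if x = ?e then g z else 0)" if x: "x \<in> HB L" for x
    proof (cases "\<exists>al\<in>circB L. x = (al, al, al)")
      case True
      then obtain al where al: "al \<in> circB L" "x = (al, al, al)" by blast
      have "(\<Sum>y\<in>HB L. unit x * g y * of_int (hcoeff L x y z)) = (\<Sum>y\<in>HB L. if y = z then (if fst z = al then g z else 0) else 0)"
        using al z by (intro sum.cong refl) (auto simp: unit_def hcoeff_unit)
      also have "\<dots> = (if fst z = al then g z else 0)" using z finite_HB by simp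
      finally show ?thesis using al by auto
    next
      case False
      then have "x \<noteq> ?e" using c by blast
      moreover have "unit x = (0 :: 'k)" using False unfolding unit_def by simp
      ultimately show ?thesis by simp
    qed
    have "hmult L unit g z = (\<Sum>x\<in>HB L. if x = ?e then g z else 0)"
      using z in0 by (simp add: hmult_def)
    also have "\<dots> = g z" using self_HB[OF c] finite_HB by simp
    finally show ?thesis .
  next
    case False
    then have "g z = 0" using g unfolding Hspace_def by blast
    then show ?thesis using False unfolding hmult_def by simp
  qed
qed

lemma hmult_unit_right:
  assumes g: "g \<in> Hspace L"
  shows "hmult L g unit = (g :: weight \<times> weight \<times> weight \<Rightarrow> 'k::comm_ring_1)"
proof -
  have "hstar (hmult L g unit) = hmult L unit (hstar g)" unfolding hstar_hmult hstar_unit ..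
  also have "\<dots> = hstar g" by (rule hmult_unit_left[OF hstar_Hspace[OF g]])
  finally have "hstar (hstar (hmult L g unit)) = hstar (hstar g)" by simp
  then show ?thesis by simp
qed

lemma is_algebra_H: "is_algebra (Hspace L :: (weight \<times> weight \<times> weight \<Rightarrow> 'k::comm_ring_1) set) (hmult L)"
  unfolding is_algebra_def
proof (intro conjI ballI allI)
  show "(\<lambda>i. 0) \<in> (Hspace L :: (weight \<times> weight \<times> weight \<Rightarrow> 'k) set)" unfolding Hspace_def by simp
  fix x y z :: "weight \<times> weight \<times> weight \<Rightarrow> 'k" and r :: 'k
  show "x \<in> Hspace L \<Longrightarrow> y \<in> Hspace L \<Longrightarrow> (\<lambda>i. x i + y i) \<in> Hspace L" unfolding Hspace_def by simp
  show "x \<in> Hspace L \<Longrightarrow> (\<lambda>i. r * x i) \<in> Hspace L" unfolding Hspace_def by simp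
  show "hmult L x y \<in> Hspace L" by (rule hmult_Hspace)
  show "hmult L (\<lambda>i. x i + y i) z = (\<lambda>i. hmult L x z i + hmult L y z i)"
    by (rule ext) (simp add: hmult_def distrib_right sum.distrib)
  show "hmult L z (\<lambda>i. x i + y i) = (\<lambda>i. hmult L z x i + hmult L z y i)"
    by (rule ext) (simp add: hmult_def distrib_right distrib_left sum.distrib)
  show "hmult L (\<lambda>i. r * x i) y = (\<lambda>i. r * hmult L x y i)" "hmult L x (\<lambda>i. r * y i) = (\<lambda>i. r * hmult L x y i)"
    by (rule ext, simp add: hmult_def sum_distrib_left mult_ac)+
  show "hmult L (hmult L x y) z = hmult L x (hmult L y z)" by (rule hmult_assoc)
next
  show "\<exists>u\<in>Hspace L. \<forall>x\<in>Hspace L. hmult L u x = (x :: weight \<times> weight \<times> weight \<Rightarrow> 'k) \<and> hmult L x u = x"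
    using unit_Hspace hmult_unit_left hmult_unit_right by blast
qed

lemma SIGMA_HB: "(la, s, t) \<in> (SIGMA la:L. Mset L la \<times> Mset L la) \<longleftrightarrow> (s, la, t) \<in> HB L"
  unfolding HB_def Mset_def by auto

lemma hmult_Cbasis:
  fixes x :: "weight \<times> weight \<times> weight \<Rightarrow> 'k::comm_ring_1"
  assumes "(g, \<mu>, dl) \<in> HB L" "z \<in> HB L"
  shows "hmult L x (Cbasis \<mu> g dl) z = (\<Sum>w\<in>HB L. x w * of_int (hcoeff L w (g, \<mu>, dl) z))"
proof -
  have "hmult L x (Cbasis \<mu> g dl) z = (\<Sum>w\<in>HB L. \<Sum>y\<in>HB L. if y = (g, \<mu>, dl) then x w * of_int (hcoeff L w y z) else 0)"
    unfolding hmult_def Cbasis_def using assms(2) by (simp add: if_distrib[of "\<lambda>y. _ * y"] if_distrib[of "\<lambda>y. y * _"] cong: if_cong)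
  then show ?thesis using assms(1) finite_HB by simp
qed

lemma cell_rule:
  fixes x :: "weight \<times> weight \<times> weight \<Rightarrow> 'k::comm_ring_1"
  assumes m: "\<mu> \<in> L" "g \<in> Mset L \<mu>"
  shows "\<exists>r :: weight \<Rightarrow> 'k. \<forall>dl\<in>Mset L \<mu>.
    (\<lambda>i. hmult L x (Cbasis \<mu> g dl) i - (\<Sum>g'\<in>Mset L \<mu>. r g' * Cbasis \<mu> g' dl i))
      \<in> lspan {Cbasis \<nu> s t | \<nu> s t. \<nu> \<in> L \<and> bruhat_le \<mu> \<nu> \<and> \<nu> \<noteq> \<mu> \<and> s \<in> Mset L \<nu> \<and> t \<in> Mset L \<nu>}"
proof (intro exI ballI)
  fix dl assume dl: "dl \<in> Mset L \<mu>"
  \<comment> \<open>The coefficients are read off at dl = g; by \<open>hcoeff_cell\<close> every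
    other dl gives the same ones.\<close>
  define r where "r g' = hmult L x (Cbasis \<mu> g g) (g', \<mu>, g)" for g'
  let ?D = "\<lambda>i. hmult L x (Cbasis \<mu> g dl) i - (\<Sum>g'\<in>Mset L \<mu>. r g' * Cbasis \<mu> g' dl i)"
  let ?T = "{(s, \<nu>, t) \<in> HB L. bruhat_le \<mu> \<nu> \<and> \<nu> \<noteq> \<mu>}"
  have H: "(p, \<mu>, q) \<in> HB L" if "p \<in> Mset L \<mu>" "q \<in> Mset L \<mu>" for p q
    using that m(1) SIGMA_HB[of \<mu> p q] by simp
  have fM: "finite (Mset L \<mu>)" unfolding Mset_def circB_def using finL by simp
  have S: "(\<Sum>g'\<in>Mset L \<mu>. r g' * Cbasis \<mu> g' dl (al, \<nu>, be)) = (if al \<in> Mset L \<mu> \<and> \<nu> = \<mu> \<and> be = dl then r al else 0)" for al \<nu> be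
  proof -
    have "(\<Sum>g'\<in>Mset L \<mu>. r g' * Cbasis \<mu> g' dl (al, \<nu>, be)) = (\<Sum>g'\<in>Mset L \<mu>. if g' = al then (if \<nu> = \<mu> \<and> be = dl then r al else 0) else 0)"
      by (intro sum.cong refl) (auto simp: Cbasis_def)
    then show ?thesis using fM by simp
  qed
  have "?D z = 0" if z: "z \<notin> ?T" for z
  proof -
    obtain al \<nu> be where ze: "z = (al, \<nu>, be)" by (metis prod_cases3)
    show ?thesis
    proof (cases "z \<in> HB L")
      case False
      then have "\<not> (al \<in> Mset L \<mu> \<and> \<nu> = \<mu> \<and> be = dl)" using H dl unfolding ze by auto
      then show ?thesis using False unfolding ze S by (auto simp: hmult_def)
    next
      case zH: True
      have e: "hmult L x (Cbasis \<mu> g dl) z = (\<Sum>w\<in>HB L. x w * of_int (hcoeff L w (g, \<mu>, dl) z))"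
        by (rule hmult_Cbasis[OF H[OF m(2) dl] zH])
      show ?thesis
      proof (cases "be = dl \<and> bruhat_le \<mu> \<nu>")
        case False
        then have "hcoeff L w (g, \<mu>, dl) z = 0" if "w \<in> HB L" for w
          using hcoeff_bruhat[OF that H[OF m(2) dl] zH[unfolded ze]] unfolding ze by blast
        then have "hmult L x (Cbasis \<mu> g dl) z = 0" unfolding e by simp
        moreover have "\<not> (al \<in> Mset L \<mu> \<and> \<nu> = \<mu> \<and> be = dl)" using False bruhat_le_refl by auto
        ultimately show ?thesis unfolding ze S by auto
      next
        case True
        then have nm: "\<nu> = \<mu>" "be = dl" using z zH unfolding ze by auto
        have al: "al \<in> Mset L \<mu>" using zH unfolding ze nm HB_def Mset_def by auto
        have "r al = (\<Sum>w\<in>HB L. x w * of_int (hcoeff L w (g, \<mu>, g) (al, \<mu>, g)))"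
          unfolding r_def by (rule hmult_Cbasis[OF H[OF m(2,2)] H[OF al m(2)]])
        also have "\<dots> = hmult L x (Cbasis \<mu> g dl) z"
          unfolding e unfolding ze nm using hcoeff_cell[OF _ m(1,2) dl al] by (intro sum.cong refl) simp
        finally show ?thesis unfolding ze S using al nm by simp
      qed
    qed
  qed
  moreover have "finite ?T" by (rule finite_subset[OF _ finite_HB]) auto
  moreover have "delta ` ?T \<subseteq> {Cbasis \<nu> s t | \<nu> s t. \<nu> \<in> L \<and> bruhat_le \<mu> \<nu> \<and> \<nu> \<noteq> \<mu> \<and> s \<in> Mset L \<nu> \<and> t \<in> Mset L \<nu>}"
    unfolding delta_def HB_def Mset_def by auto
  ultimately show "?D \<in> lspan {Cbasis \<nu> s t | \<nu> s t. \<nu> \<in> L \<and> bruhat_le \<mu> \<nu> \<and> \<nu> \<noteq> \<mu> \<and> s \<in> Mset L \<nu> \<and> t \<in> Mset L \<nu>}"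
    by (intro lspan_delta) auto
qed

lemma cellular:
  "cellular_algebra (Hspace L :: (weight \<times> weight \<times> weight \<Rightarrow> 'k::comm_ring_1) set)
     (hmult L) L bruhat_le (Mset L) Cbasis hstar"
  unfolding cellular_algebra_def
proof (intro conjI ballI allI impI)
  show "is_algebra (Hspace L :: (weight \<times> weight \<times> weight \<Rightarrow> 'k) set) (hmult L)" by (rule is_algebra_H)
  show "bruhat_le x x" for x by (rule bruhat_le_refl)
  show "x = y" if "bruhat_le x y \<and> bruhat_le y x" for x y using that bruhat_le_antisym by blast
  show "bruhat_le x z" if "bruhat_le x y \<and> bruhat_le y z" for x y z using that bruhat_le_trans by blast
  show "finite (Mset L la)" for la unfolding Mset_def circB_def using finL by simp
  show "inj_on (\<lambda>(la, s, t). Cbasis la s t :: _ \<Rightarrow> 'k) (SIGMA la:L. Mset L la \<times> Mset L la)"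
  proof (rule inj_onI)
    fix q q' assume e: "(case q of (la, s, t) \<Rightarrow> (Cbasis la s t :: _ \<Rightarrow> 'k)) = (case q' of (la, s, t) \<Rightarrow> Cbasis la s t)"
    obtain la s t where q: "q = (la, s, t)" by (metis prod_cases3)
    obtain la' s' t' where q': "q' = (la', s', t')" by (metis prod_cases3)
    have "(delta (s, la, t) :: _ \<Rightarrow> 'k) = delta (s', la', t')" using e unfolding q q' delta_def by simp
    then have "(s, la, t) = (s', la', t')" by (rule inj_onD[OF inj_delta[of UNIV]]) simp_all
    then show "q = q'" unfolding q q' by simp
  qed
  show "(Cbasis la s t :: _ \<Rightarrow> 'k) \<in> Hspace L" if "la \<in> L" "s \<in> Mset L la" "t \<in> Mset L la" for la s t
    using that SIGMA_HB[of la s t] unfolding Hspace_def Cbasis_def by auto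
  show "(Hspace L :: (_ \<Rightarrow> 'k) set) \<subseteq> lspan {Cbasis la s t | la s t. la \<in> L \<and> s \<in> Mset L la \<and> t \<in> Mset L la}"
  proof
    fix f :: "_ \<Rightarrow> 'k" assume f: "f \<in> Hspace L"
    show "f \<in> lspan {Cbasis la s t | la s t. la \<in> L \<and> s \<in> Mset L la \<and> t \<in> Mset L la}"
    proof (rule lspan_delta[OF finite_HB])
      show "delta ` HB L \<subseteq> {Cbasis la s t :: _ \<Rightarrow> 'k | la s t. la \<in> L \<and> s \<in> Mset L la \<and> t \<in> Mset L la}"
        unfolding delta_def HB_def Mset_def by auto
    qed (use f in \<open>unfold Hspace_iff, blast\<close>)
  qed
  show "c q = 0"
    if F: "finite F \<and> F \<subseteq> (SIGMA la:L. Mset L la \<times> Mset L la)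
      \<and> (\<lambda>i. \<Sum>(la, s, t)\<in>F. c (la, s, t) * Cbasis la s t i) = (\<lambda>i. 0)" and q: "q \<in> F"
    for F and c :: "_ \<Rightarrow> 'k" and q
  proof -
    obtain la s t where qe: "q = (la, s, t)" by (metis prod_cases3)
    have "(\<lambda>i. \<Sum>(la, s, t)\<in>F. c (la, s, t) * Cbasis la s t i) (s, la, t) = (\<lambda>i. 0) (s, la, t)"
      by (rule fun_cong[OF conjunct2[OF conjunct2[OF F]]])
    moreover have "(\<lambda>i. \<Sum>(la, s, t)\<in>F. c (la, s, t) * Cbasis la s t i) (s, la, t) = (\<Sum>w\<in>F. if w = q then c q else 0)"
      by (intro sum.cong refl) (auto simp: Cbasis_def qe split: if_splits)
    ultimately show ?thesis using F q by simp
  qed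
  show "bij_betw hstar (Hspace L) (Hspace L :: (_ \<Rightarrow> 'k) set)"
    by (rule bij_betw_byWitness[of _ hstar]) (auto intro: hstar_Hspace)
  show "hstar (\<lambda>i. x i + y i) = (\<lambda>i. hstar x i + hstar y i)" for x y :: "_ \<Rightarrow> 'k" by (rule ext) (simp add: hstar_eq)
  show "hstar (\<lambda>i. r * x i) = (\<lambda>i. r * hstar x i)" for r and x :: "_ \<Rightarrow> 'k" by (rule ext) (simp add: hstar_eq)
  show "hstar (hmult L x y) = hmult L (hstar y) (hstar x)" for x y :: "_ \<Rightarrow> 'k" by (rule hstar_hmult)
  show "hstar (Cbasis la s t :: _ \<Rightarrow> 'k) = Cbasis la t s" for la s t
    by (rule ext) (auto simp: hstar_eq Cbasis_def rev3_def)
  show "\<exists>r :: weight \<Rightarrow> 'k. \<forall>dl\<in>Mset L \<mu>.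
    (\<lambda>i. hmult L x (Cbasis \<mu> g dl) i - (\<Sum>g'\<in>Mset L \<mu>. r g' * Cbasis \<mu> g' dl i))
      \<in> lspan {Cbasis \<nu> s t | \<nu> s t. \<nu> \<in> L \<and> bruhat_le \<mu> \<nu> \<and> \<nu> \<noteq> \<mu> \<and> s \<in> Mset L \<nu> \<and> t \<in> Mset L \<nu>}"
    if "\<mu> \<in> L" "g \<in> Mset L \<mu>" for x \<mu> g
    by (rule cell_rule[OF that])
qed

end

theorem theorem6p2:
  fixes L :: "weight set"
  assumes "is_block L" and "finite L"
  shows "cellular_algebra (Hspace L :: (weight \<times> weight \<times> weight \<Rightarrow> 'k::comm_ring_1) set)
           (hmult L) L bruhat_le (Mset L) Cbasis hstar"
proof -
  obtain N where "closed_block L N" using closed_block_exists[OF assms] .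
  then interpret closed_block L N .
  interpret finite_closed_block L N by unfold_locales (rule assms)
  show ?thesis by (rule cellular)
qed

end
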